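(* Let $K$ be a field and let $\Delta_1$ and $\Delta_2$ be two (finite) simplicial complexes. The following conditions are equivalent: \begin{enumerate} \item $\Delta_1$ and $\Delta_2$ are isomorphic as simplicial complexes. \item The Alexander duals $\Delta_1^{\vee}$ and $\Delta_2^{\vee}$ are isomorphic as simplicial complexes. \item The complement complexes $\Delta_1^{c}$ and $\Delta_2^{c}$ are isomorphic as simplicial complexes. \item The barycentric subdivisions $\Delta_1^{\flat}$ and $\Delta_2^{\flat}$ are isomorphic as simplicial complexes. \item The $m$-fold iterated barycentric subdivisions $\Delta_1^{\flat^m}$ and $\Delta_2^{\flat^m}$ are isomorphic as simplicial complexes for some positive integer $m$. \item The Stanley-Reisner rings $K[\Delta_1]$ and $K[\Delta_2]$ are isomorphic as $K$-algebras. \item The facet rings $K_{\mathcal{F}}[\Delta_1]$ and $K_{\mathcal{F}}[\Delta_2]$ are isomorphic as $K$-algebras. \item The comparability graphs $G(\Delta_1)$ and $G(\Delta_2)$ are isomorphic as graphs. \end{enumerate}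
   Context: For a positive integer $n$, let $[n]=\{1,2,\ldots,n\}$. A (finite) simplicial complex $\Delta$ on $[n]$ is a system of subsets of $[n]$ such that (a) $\{i\}\in\Delta$ for every $i\in[n]$, and (b) if $E\in\Delta$ and $F\subseteq E$, then $F\in\Delta$. The elements of $\Delta$ are called faces (the empty set is a face), and the faces that are maximal under inclusion are called facets. The vertex set of $\Delta$ is $[n]$. An isomorphism of simplicial complexes is a bijection between their vertex sets such that the image and the inverse image of every face is a face. Alexander dual: for $\Delta$ on $[n]$, $\Delta^{\vee}=\{[n]\setminus F : F\subseteq [n],\ F\notin\Delta\}$. Complement complex: for $\Delta$ on $[n]$, $\Delta^{c}$ is the simplicial complex whose facets are the sets $[n]\setminus F$, where $F$ is a facet of $\Delta$ (its faces are all subsets of these sets). Both $\Delta^{\vee}$ and $\Delta^{c}$ are regarded as complexes with vertex set (ground set) $[n]$; they satisfy condition (b) but need not satisfy condition (a), and $\Delta^\vee$ may be the empty family. An isomorphism between such complexes is a bijection between the ground sets $[n_1]$ and $[n_2]$ under which images and inverse images of faces are faces. Barycentric subdivision: $\Delta^{\flat}$ is the simplicial complex whose vertex set is the set of nonempty faces of $\Delta$, and whose faces are the sets of nonempty faces of $\Delta$ that are chains under inclusion (i.e. any two elements are comparable). The $m$-fold iterate is defined by $\Delta^{\flat^1}=\Delta^\flat$ and $\Delta^{\flat^{m+1}}=(\Delta^{\flat^m})^{\flat}$. Comparability graph: $G(\Delta)$ is the simple undirected graph whose vertices are the nonempty faces of $\Delta$, with two distinct nonempty faces $E,F$ joined by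 an edge if and only if $E\subset F$ or $F\subset E$. Rings: let $S=K[x_1,\ldots,x_n]$ be the polynomial ring. The Stanley-Reisner ring is $K[\Delta]=S/I_\Delta$, where $I_\Delta$ is the ideal generated by all square-free monomials $x_{i_1}\cdots x_{i_s}$ with $\{i_1,\ldots,i_s\}\notin\Delta$. The facet ring is $K_{\mathcal{F}}[\Delta]=S/I(\Delta)$, where $I(\Delta)$ is the ideal generated by all square-free monomials $x_{i_1}\cdots x_{i_s}$ with $\{i_1,\ldots,i_s\}$ a facet of $\Delta$.
   Formalization: Condition 7 implies condition 1 only if both complexes have equally many vertices or equally many isolated vertices: one point and two isolated points both have facet ring K. That converse is stated under this proviso; 1 implies 7 and all other equivalences are unconditional. *)

theory Defs
  imports Main "HOL-Library.Nat_Bijection" "HOL-Library.Poly_Mapping"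
    "HOL-Algebra.Module" "HOL-Algebra.QuotRing"
begin

section \<open>Simplicial complexes\<close>

text \<open>
  The ground set is kept explicitly, since Alexander duals and complement complexes are
  families on the ground set of the original complex that need not contain all singletons;
  the dual may even be the empty family.
\<close>

datatype 'a set_system = Set_System (ground: "'a set") (faces: "'a set set")

definition simplicial_complex :: "'a set_system \<Rightarrow> bool" where
  "simplicial_complex X \<longleftrightarrow>
     faces X \<subseteq> Pow (ground X) \<and>
     (\<forall>v\<in>ground X. {v} \<in> faces X) \<and>
     (\<forall>E\<in>faces X. \<forall>F. F \<subseteq> E \<longrightarrow> F \<in> faces X)"

definition simplicial_complex_on :: "nat \<Rightarrow> nat set_system \<Rightarrow> bool" where
  "simplicial_complex_on n X \<longleftrightarrow> 1 \<le> n \<and> ground X = {1..n} \<and> simplicial_complex X"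

definition facets :: "'a set_system \<Rightarrow> 'a set set" where
  "facets X = {F \<in> faces X. \<forall>E\<in>faces X. F \<subseteq> E \<longrightarrow> E = F}"

definition complex_isomorphic :: "'a set_system \<Rightarrow> 'b set_system \<Rightarrow> bool" where
  "complex_isomorphic X Y \<longleftrightarrow>
     (\<exists>f. bij_betw f (ground X) (ground Y) \<and>
          (\<forall>E\<in>faces X. f ` E \<in> faces Y) \<and>
          (\<forall>F\<in>faces Y. f -` F \<inter> ground X \<in> faces X))"

definition alexander_dual :: "'a set_system \<Rightarrow> 'a set_system" where
  "alexander_dual X =
     Set_System (ground X) {ground X - F |F. F \<subseteq> ground X \<and> F \<notin> faces X}"

definition complement_complex :: "'a set_system \<Rightarrow> 'a set_system" where
  "complement_complex X =
     Set_System (ground X) {E. \<exists>F\<in>facets X. E \<subseteq> ground X - F}"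

definition barycentric_subdivision :: "'a set_system \<Rightarrow> 'a set set_system" where
  "barycentric_subdivision X =
     Set_System (faces X - {{}})
       {C. C \<subseteq> faces X - {{}} \<and> (\<forall>E\<in>C. \<forall>F\<in>C. E \<subseteq> F \<or> F \<subseteq> E)}"

text \<open>
  The barycentric subdivision changes the type of the vertices, so it cannot be iterated a
  variable number of times as it stands.  For complexes on natural numbers we rename each
  vertex of the subdivision, a finite nonempty set of naturals, to its code under
  \<^const>\<open>set_encode\<close>, which is injective on finite sets.
\<close>

definition relabel :: "('a \<Rightarrow> 'b) \<Rightarrow> 'a set_system \<Rightarrow> 'b set_system" where
  "relabel f X = Set_System (f ` ground X) ((`) f ` faces X)"

definition barycentric_subdivision_nat :: "nat set_system \<Rightarrow> nat set_system" where
  "barycentric_subdivision_nat X = relabel set_encode (barycentric_subdivision X)"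

definition iterated_subdivision :: "nat \<Rightarrow> nat set_system \<Rightarrow> nat set_system" where
  "iterated_subdivision m X = (barycentric_subdivision_nat ^^ m) X"

section \<open>Comparability graphs\<close>

datatype 'a ugraph = Graph (vertices: "'a set") (edges: "'a set set")

definition graph_isomorphic :: "'a ugraph \<Rightarrow> 'b ugraph \<Rightarrow> bool" where
  "graph_isomorphic G H \<longleftrightarrow>
     (\<exists>f. bij_betw f (vertices G) (vertices H) \<and>
          (\<forall>u\<in>vertices G. \<forall>v\<in>vertices G. {u, v} \<in> edges G \<longleftrightarrow> {f u, f v} \<in> edges H))"

definition comparability_graph :: "'a set_system \<Rightarrow> 'a set ugraph" where
  "comparability_graph X =
     Graph (faces X - {{}})
       {{E, F} |E F. E \<in> faces X - {{}} \<and> F \<in> faces X - {{}} \<and> (E \<subset> F \<or> F \<subset> E)}"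

section \<open>Stanley-Reisner rings and facet rings\<close>

text \<open>
  Polynomials are finitely supported functions from monomials to coefficients, a monomial
  being a finitely supported exponent function.  The polynomial ring in the variables
  indexed by \<open>V\<close> consists of the polynomials all of whose monomials involve only
  variables from \<open>V\<close>.
\<close>

type_synonym ('v, 'k) mpoly = "('v \<Rightarrow>\<^sub>0 nat) \<Rightarrow>\<^sub>0 'k"

definition mconst :: "'k::field \<Rightarrow> ('v, 'k) mpoly" where
  "mconst c = Poly_Mapping.single 0 c"

definition mvar :: "'v \<Rightarrow> ('v, 'k::field) mpoly" where
  "mvar i = Poly_Mapping.single (Poly_Mapping.single i 1) 1"

definition polynomial_ring :: "'v set \<Rightarrow> ('v, 'k::field) mpoly ring" where
  "polynomial_ring V =
     \<lparr>carrier = {p. \<forall>m\<in>Poly_Mapping.keys p. Poly_Mapping.keys m \<subseteq> V}, mult = (*), one = 1, zero = 0, add = (+)\<rparr>"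

definition stanley_reisner_ideal :: "'v set_system \<Rightarrow> ('v, 'k::field) mpoly set" where
  "stanley_reisner_ideal X =
     genideal (polynomial_ring (ground X))
       {\<Prod>i\<in>F. mvar i |F. F \<subseteq> ground X \<and> F \<notin> faces X}"

definition facet_ideal :: "'v set_system \<Rightarrow> ('v, 'k::field) mpoly set" where
  "facet_ideal X =
     genideal (polynomial_ring (ground X)) {\<Prod>i\<in>F. mvar i |F. F \<in> facets X}"

text \<open>
  \<^typ>\<open>('k, 'b) module\<close> is a ring record extended by a scalar multiplication; here the scalar
  \<open>c\<close> acts on a quotient of a polynomial ring as multiplication by the class of the
  constant polynomial \<open>c\<close>.
\<close>

definition quotient_algebra ::
  "'v set \<Rightarrow> ('v, 'k::field) mpoly set \<Rightarrow> ('k, ('v, 'k) mpoly set) module" where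
  "quotient_algebra V I =
     (let S = polynomial_ring V; Q = S Quot I in
      ring.extend Q (module.fields (\<lambda>c C. (I +>\<^bsub>S\<^esub> mconst c) \<otimes>\<^bsub>Q\<^esub> C)))"

definition stanley_reisner_ring ::
  "'v set_system \<Rightarrow> ('k::field, ('v, 'k) mpoly set) module" where
  "stanley_reisner_ring X = quotient_algebra (ground X) (stanley_reisner_ideal X)"

text \<open>
  If \<open>{v}\<close> is a facet then the variable of \<open>v\<close> vanishes in the facet ring, so the facet
  ring alone does not see isolated vertices: the complexes consisting of one, respectively
  two isolated points both have facet ring \<open>K\<close>.
\<close>

definition facet_ring ::
  "'v set_system \<Rightarrow> ('k::field, ('v, 'k) mpoly set) module" where
  "facet_ring X = quotient_algebra (ground X) (facet_ideal X)"

definition algebra_isomorphic ::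
  "('k::field, 'a) module \<Rightarrow> ('k, 'b) module \<Rightarrow> bool" where
  "algebra_isomorphic A B \<longleftrightarrow>
     (\<exists>h\<in>ring_iso A B. \<forall>c. \<forall>x\<in>carrier A. h (c \<odot>\<^bsub>A\<^esub> x) = c \<odot>\<^bsub>B\<^esub> h x)"

end

theory Submission
  imports Defs "HOL-Computational_Algebra.Polynomial"
begin

text \<open>
  An algebra isomorphism matches the minimal primes of the two Stanley-Reisner rings, and these are
  the ideals \<open>P\<^sub>F\<close> generated by the variables outside a facet \<open>F\<close>.  A sum of such primes
  is \<open>P\<^sub>W\<close> for the intersection \<open>W\<close> of the facets, and its quotient is a polynomial ring in
  \<open>card W\<close> variables, so the matching preserves the sizes of all intersections of facets.  By
  inclusion-exclusion it is then induced by a bijection of the vertices.  A facet ring is the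
  Stanley-Reisner ring of the complex of the sets that contain no facet; its minimal nonfaces
  give back the facets.

  For the comparability graph one may treat connected components separately.  A full simplex is
  recognised by its face comparable to all others.  On any other component a comparability isomorphism
  either preserves all inclusions, and then restricts to the vertices, or reverses them all.  If it
  reverses them, every vertex has as many neighbours as the vertices of its image facet; this forces
  the component to be a cycle or the boundary of a simplex.  Both have an order-reversing automorphism
  of their nonempty faces, and composing with it yields an isomorphism that preserves inclusions.
\<close>

section \<open>Isomorphisms of set systems\<close>

text \<open>An isomorphism of Stanley-Reisner rings need not be graded: it may send a variable to an
  element with a constant term and terms of higher degree, so the vertices cannot be read off the
  images of the variables. The number of variables of a quotient polynomial ring is recovered from
  the tangent space at a rational point, where inverse isomorphisms have inverse Jacobians. This
  works over every field and replaces dimension theory.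

  Comparability records that two faces are nested, but not which one is larger. The direction has to
  be derived from incomparable pairs, which tie the directions of two inclusions to each other. It
  may change from one component to the next, and in a full simplex with three or more vertices it
  need not be uniform: complementing the proper faces while fixing the top face preserves
  comparability. Hence the separate treatment of components and of simplices. Components must be
  matched through faces, since the given map need not send vertices to vertices.\<close>

definition complex_iso :: "('a \<Rightarrow> 'b) \<Rightarrow> 'a set_system \<Rightarrow> 'b set_system \<Rightarrow> bool" where
  "complex_iso f X Y \<longleftrightarrow> bij_betw f (ground X) (ground Y) \<and>
     (\<forall>E\<subseteq>ground X. E \<in> faces X \<longleftrightarrow> f ` E \<in> faces Y)"

lemma bij_betw_image_vimage:
  assumes "bij_betw f A B" "F \<subseteq> B"
  shows "f ` (f -` F \<inter> A) = F"
  using assms unfolding bij_betw_def by blast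

lemma bij_betw_vimage_image:
  assumes "bij_betw f A B" "E \<subseteq> A"
  shows "f -` (f ` E) \<inter> A = E"
  using assms unfolding bij_betw_def inj_on_def by blast

lemma bij_betw_image_Diff:
  assumes "bij_betw f A B" "E \<subseteq> A"
  shows "f ` (A - E) = B - f ` E"
  using assms inj_on_image_set_diff[of f A A E] by (simp add: bij_betw_def)

lemma bij_betw_image_the_inv_into:
  assumes "bij_betw f A B" "F \<subseteq> B"
  shows "f ` the_inv_into A f ` F = F"
proof -
  have "f (the_inv_into A f w) = w" if "w \<in> F" for w
    using f_the_inv_into_f_bij_betw[OF assms(1)] assms(2) that by blast
  then show ?thesis by (simp add: image_image)
qed

lemma bij_betw_image_subset_iff:
  assumes "bij_betw f A B" "E \<subseteq> A" "E' \<subseteq> A"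
  shows "f ` E \<subseteq> f ` E' \<longleftrightarrow> E \<subseteq> E'"
proof -
  have "f v \<in> f ` E' \<longleftrightarrow> v \<in> E'" if "v \<in> E" for v
    using that assms by (intro inj_on_image_mem_iff[of f A]) (auto simp: bij_betw_def)
  then show ?thesis by (auto simp: image_subset_iff)
qed

text \<open>A single condition on all subsets of the ground set replaces the two conditions on
  images and preimages of faces. In this form it is visibly invariant under complementation and
  negation, as the Alexander dual requires. The hypotheses also hold for duals and complement
  complexes, which may lack singletons.\<close>

lemma complex_isomorphic_iff:
  assumes "faces X \<subseteq> Pow (ground X)" "faces Y \<subseteq> Pow (ground Y)"
  shows "complex_isomorphic X Y \<longleftrightarrow> (\<exists>f. complex_iso f X Y)"
proof -
  have "((\<forall>E\<in>faces X. f ` E \<in> faces Y) \<and> (\<forall>F\<in>faces Y. f -` F \<inter> ground X \<in> faces X)) \<longleftrightarrow>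
     (\<forall>E\<subseteq>ground X. E \<in> faces X \<longleftrightarrow> f ` E \<in> faces Y)" (is "?L \<longleftrightarrow> ?R")
    if b: "bij_betw f (ground X) (ground Y)" for f
  proof
    assume L: ?L
    show ?R
    proof (intro allI impI iffI)
      fix E assume E: "E \<subseteq> ground X" "f ` E \<in> faces Y"
      then have "f -` (f ` E) \<inter> ground X \<in> faces X" using L by blast
      then show "E \<in> faces X" by (simp only: bij_betw_vimage_image[OF b E(1)])
    qed (use L in blast)
  next
    assume R: ?R
    show ?L
    proof (intro conjI ballI)
      fix F assume F: "F \<in> faces Y"
      then have "f ` (f -` F \<inter> ground X) = F"
        using assms(2) by (intro bij_betw_image_vimage[OF b]) blast
      then show "f -` F \<inter> ground X \<in> faces X" using R F by (metis Int_lower2)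
    qed (use R assms(1) in blast)
  qed
  then show ?thesis unfolding complex_isomorphic_def complex_iso_def by blast
qed

lemma complex_iso_inv:
  assumes "complex_iso f X Y"
  shows "complex_iso (the_inv_into (ground X) f) Y X"
  unfolding complex_iso_def
proof (intro conjI allI impI)
  let ?g = "the_inv_into (ground X) f"
  have b: "bij_betw f (ground X) (ground Y)" using assms by (simp add: complex_iso_def)
  then show "bij_betw ?g (ground Y) (ground X)" by (rule bij_betw_the_inv_into)
  fix F assume F: "F \<subseteq> ground Y"
  have "f ` ?g ` F = F"
    by (rule bij_betw_image_the_inv_into[OF b F])
  moreover have "?g ` F \<subseteq> ground X"
    using F bij_betw_the_inv_into[OF b] by (auto simp: bij_betw_def)
  ultimately show "F \<in> faces Y \<longleftrightarrow> ?g ` F \<in> faces X"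
    using assms unfolding complex_iso_def by metis
qed

lemma complex_iso_comp:
  assumes "complex_iso f X Y" "complex_iso g Y Z"
  shows "complex_iso (g \<circ> f) X Z"
  unfolding complex_iso_def
proof (intro conjI allI impI)
  show "bij_betw (g \<circ> f) (ground X) (ground Z)"
    using assms by (auto simp: complex_iso_def intro: bij_betw_trans)
  fix E assume "E \<subseteq> ground X"
  moreover from this have "f ` E \<subseteq> ground Y"
    using assms by (auto simp: complex_iso_def bij_betw_def)
  ultimately show "E \<in> faces X \<longleftrightarrow> (g \<circ> f) ` E \<in> faces Z"
    using assms unfolding complex_iso_def image_comp[symmetric] by blast
qed

lemma faces_subset_ground: "simplicial_complex X \<Longrightarrow> faces X \<subseteq> Pow (ground X)"
  by (simp add: simplicial_complex_def)

lemma complex_isomorphic_simplicial_iff: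
  assumes "simplicial_complex X" "simplicial_complex Y"
  shows "complex_isomorphic X Y \<longleftrightarrow> (\<exists>f. complex_iso f X Y)"
  by (rule complex_isomorphic_iff) (rule assms[THEN faces_subset_ground])+

section \<open>Alexander duals\<close>

lemma alexander_dual_face_iff:
  assumes "E \<subseteq> ground X"
  shows "E \<in> faces (alexander_dual X) \<longleftrightarrow> ground X - E \<notin> faces X"
proof
  assume "ground X - E \<notin> faces X"
  then show "E \<in> faces (alexander_dual X)"
    unfolding alexander_dual_def set_system.sel using assms
    by (intro CollectI exI[of _ "ground X - E"]) (auto simp: double_diff)
qed (use assms in \<open>auto simp: alexander_dual_def double_diff\<close>)

text \<open>The same bijection serves both sides: \<open>E\<close> is a face of the dual exactly
  when its complement is a nonface, and taking complements is an involution that commutes with a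
  bijection of the ground sets.\<close>

lemma complex_iso_alexander_dual_iff:
  "complex_iso f (alexander_dual X) (alexander_dual Y) \<longleftrightarrow> complex_iso f X Y"
proof (cases "bij_betw f (ground X) (ground Y)")
  case b: True
  have im: "f ` (ground X - E) = ground Y - f ` E" if "E \<subseteq> ground X" for E
    by (rule bij_betw_image_Diff[OF b that])
  have g: "ground (alexander_dual Z) = ground Z" for Z :: "'c set_system"
    by (simp add: alexander_dual_def)
  have sub: "f ` E \<subseteq> ground Y" if "E \<subseteq> ground X" for E
    using b that by (auto simp: bij_betw_def)
  have "(\<forall>E\<subseteq>ground X. ground X - E \<in> faces X \<longleftrightarrow> ground Y - f ` E \<in> faces Y) \<longleftrightarrow>
    (\<forall>E\<subseteq>ground X. E \<in> faces X \<longleftrightarrow> f ` E \<in> faces Y)" (is "?L \<longleftrightarrow> ?R")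
  proof
    assume L: ?L
    show ?R
    proof (intro allI impI)
      fix E assume E: "E \<subseteq> ground X"
      have "ground X - (ground X - E) = E" "ground Y - f ` (ground X - E) = f ` E"
        using E sub[OF E] by (auto simp: im double_diff)
      then show "E \<in> faces X \<longleftrightarrow> f ` E \<in> faces Y" using L[rule_format, of "ground X - E"] by simp
    qed
  next
    assume R: ?R
    show ?L
    proof (intro allI impI)
      fix E assume "E \<subseteq> ground X"
      then show "ground X - E \<in> faces X \<longleftrightarrow> ground Y - f ` E \<in> faces Y"
        using R[rule_format, of "ground X - E"] im[of E] by simp
    qed
  qed
  then show ?thesis
    using b sub by (auto simp: complex_iso_def g alexander_dual_face_iff)
qed (simp add: complex_iso_def alexander_dual_def)

lemma alexander_dual_faces_subset: "faces (alexander_dual X) \<subseteq> Pow (ground (alexander_dual X))"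
  by (auto simp: alexander_dual_def)

section \<open>Facets and complement complexes\<close>

lemma face_subset_facet:
  assumes "finite (ground X)" "faces X \<subseteq> Pow (ground X)" "E \<in> faces X"
  obtains F where "F \<in> facets X" "E \<subseteq> F"
proof -
  have "finite (faces X)" using assms(1) by (intro finite_subset[OF assms(2)]) simp
  from finite_has_maximal2[OF this assms(3)]
  obtain F where F: "F \<in> faces X" "E \<subseteq> F" and max: "\<forall>G\<in>faces X. F \<subseteq> G \<longrightarrow> F = G"
    by (elim bexE conjE)
  have "F \<in> facets X"
    using F(1) max by (auto simp: facets_def)
  then show ?thesis using F(2) by (rule that)
qed

lemma faces_eq_subsets_facets:
  assumes "finite (ground X)" "simplicial_complex X"
  shows "faces X = {E. \<exists>F\<in>facets X. E \<subseteq> F}"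
proof (intro equalityI subsetI)
  fix E assume "E \<in> faces X"
  from face_subset_facet[OF assms(1) faces_subset_ground[OF assms(2)] this]
  show "E \<in> {E. \<exists>F\<in>facets X. E \<subseteq> F}" by auto
qed (use assms(2) in \<open>auto simp: simplicial_complex_def facets_def\<close>)

lemma complex_iso_facet_iff:
  assumes "complex_iso f X Y" "faces X \<subseteq> Pow (ground X)" "faces Y \<subseteq> Pow (ground Y)" "F \<subseteq> ground X"
  shows "F \<in> facets X \<longleftrightarrow> f ` F \<in> facets Y"
proof -
  have b: "bij_betw f (ground X) (ground Y)" using assms by (simp add: complex_iso_def)
  have f: "E \<in> faces X \<longleftrightarrow> f ` E \<in> faces Y" if "E \<subseteq> ground X" for E
    using assms(1) that by (simp add: complex_iso_def)
  have s: "f ` E \<subseteq> f ` E' \<longleftrightarrow> E \<subseteq> E'" "f ` E = f ` E' \<longleftrightarrow> E = E'"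
    if "E \<subseteq> ground X" "E' \<subseteq> ground X" for E E'
    using bij_betw_image_subset_iff[OF b] that by (simp_all add: set_eq_subset)
  have Y: "\<exists>E\<subseteq>ground X. G = f ` E" if "G \<in> faces Y" for G
    using bij_betw_image_vimage[OF b, of G] that assms(3) by (intro exI[of _ "f -` G \<inter> ground X"]) auto
  show ?thesis
  proof
    assume F: "F \<in> facets X"
    show "f ` F \<in> facets Y"
      unfolding facets_def
    proof (intro CollectI conjI ballI impI)
      show "f ` F \<in> faces Y" using F f[OF assms(4)] by (simp add: facets_def)
      fix G assume G: "G \<in> faces Y" "f ` F \<subseteq> G"
      then obtain E where E: "E \<subseteq> ground X" "G = f ` E" using Y[OF G(1)] by (elim exE conjE)
      then have "E \<in> faces X" "F \<subseteq> E" using G f[OF E(1)] s(1)[OF assms(4) E(1)] by simp_all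
      then have "E = F" using F by (simp add: facets_def)
      then show "G = f ` F" using E(2) by simp
    qed
  next
    assume F: "f ` F \<in> facets Y"
    show "F \<in> facets X"
      unfolding facets_def
    proof (intro CollectI conjI ballI impI)
      show "F \<in> faces X" using F f[OF assms(4)] by (simp add: facets_def)
      fix E assume E: "E \<in> faces X" "F \<subseteq> E"
      then have sub: "E \<subseteq> ground X" using assms(2) by blast
      have "f ` E \<in> faces Y" using E f[OF sub] by simp
      then have "f ` E = f ` F" using F E(2) by (simp add: facets_def image_mono)
      then show "E = F" using s(2)[OF sub assms(4)] by simp
    qed
  qed
qed

lemma complex_isoI_facets:
  assumes "finite (ground X)" "simplicial_complex X" "finite (ground Y)" "simplicial_complex Y"
    and b: "bij_betw f (ground X) (ground Y)"
    and fac: "\<And>F. F \<subseteq> ground X \<Longrightarrow> F \<in> facets X \<longleftrightarrow> f ` F \<in> facets Y"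
  shows "complex_iso f X Y"
  unfolding complex_iso_def
proof (intro conjI allI impI b)
  fix E assume E: "E \<subseteq> ground X"
  have gr: "F \<in> facets X \<Longrightarrow> F \<subseteq> ground X" "G \<in> facets Y \<Longrightarrow> G \<subseteq> ground Y" for F G
    using assms(2,4) by (auto simp: facets_def simplicial_complex_def)
  show "E \<in> faces X \<longleftrightarrow> f ` E \<in> faces Y"
  proof
    assume "E \<in> faces X"
    then obtain F where "F \<in> facets X" "E \<subseteq> F"
      using faces_eq_subsets_facets[OF assms(1,2)] by auto
    then have "f ` F \<in> facets Y" "f ` E \<subseteq> f ` F" using fac gr by auto
    then show "f ` E \<in> faces Y" using faces_eq_subsets_facets[OF assms(3,4)] by auto
  next
    assume "f ` E \<in> faces Y"
    then obtain G where G: "G \<in> facets Y" "f ` E \<subseteq> G"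
      using faces_eq_subsets_facets[OF assms(3,4)] by auto
    define F where "F = f -` G \<inter> ground X"
    have "f ` F = G" unfolding F_def by (rule bij_betw_image_vimage[OF b gr(2)[OF G(1)]])
    then have "F \<in> facets X" using fac G(1) by (simp add: F_def)
    moreover have "E \<subseteq> F" using G(2) E by (simp add: F_def image_subset_iff_subset_vimage)
    ultimately show "E \<in> faces X" using faces_eq_subsets_facets[OF assms(1,2)] by auto
  qed
qed

lemma ground_complement_complex [simp]: "ground (complement_complex X) = ground X"
  by (simp add: complement_complex_def)

lemma complement_complex_faces_subset:
  "faces (complement_complex X) \<subseteq> Pow (ground (complement_complex X))"
  by (auto simp: complement_complex_def)

text \<open>Complementation reverses inclusion, so the complements of the facets again form an
  antichain and each of them stays maximal.\<close>

lemma facets_complement_complex: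
  assumes "faces X \<subseteq> Pow (ground X)" "F \<subseteq> ground X"
  shows "F \<in> facets (complement_complex X) \<longleftrightarrow> ground X - F \<in> facets X"
proof
  assume F: "F \<in> facets (complement_complex X)"
  then obtain G where G: "G \<in> facets X" "F \<subseteq> ground X - G"
    unfolding facets_def[of "complement_complex X"] by (auto simp: complement_complex_def)
  then have "ground X - G \<in> faces (complement_complex X)"
    by (auto simp: complement_complex_def)
  then have "ground X - G = F" using F G by (auto simp: facets_def)
  moreover have "G \<subseteq> ground X" using G assms(1) by (auto simp: facets_def)
  ultimately have "ground X - F = G" by blast
  then show "ground X - F \<in> facets X" using G by simp
next
  assume F: "ground X - F \<in> facets X"
  show "F \<in> facets (complement_complex X)"
    unfolding facets_def
  proof (intro CollectI conjI ballI impI)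
    show "F \<in> faces (complement_complex X)"
      using F assms(2) unfolding complement_complex_def by auto
    fix E assume E: "E \<in> faces (complement_complex X)" "F \<subseteq> E"
    then obtain G where G: "G \<in> facets X" "E \<subseteq> ground X - G"
      by (auto simp: complement_complex_def)
    then have "G \<subseteq> ground X - F" using E assms(1) by (auto simp: facets_def)
    then have "ground X - F = G" using F G(1) by (auto simp: facets_def)
    then show "E = F" using E G assms(2) by blast
  qed
qed

lemma complex_iso_complement_complex_iff:
  assumes "finite (ground X)" "simplicial_complex X" "finite (ground Y)" "simplicial_complex Y"
  shows "complex_iso f (complement_complex X) (complement_complex Y) \<longleftrightarrow> complex_iso f X Y"
proof (cases "bij_betw f (ground X) (ground Y)")
  case b: True
  note sX = faces_subset_ground[OF assms(2)] and sY = faces_subset_ground[OF assms(4)]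
  have im: "f ` (ground X - E) = ground Y - f ` E" if "E \<subseteq> ground X" for E
    by (rule bij_betw_image_Diff[OF b that])
  have sub: "f ` E \<subseteq> ground Y" if "E \<subseteq> ground X" for E
    using b that by (auto simp: bij_betw_def)
  show ?thesis
  proof
    assume iso: "complex_iso f (complement_complex X) (complement_complex Y)"
    show "complex_iso f X Y"
    proof (rule complex_isoI_facets[OF assms b])
      fix F assume F: "F \<subseteq> ground X"
      have "ground X - F \<in> facets (complement_complex X) \<longleftrightarrow>
          f ` (ground X - F) \<in> facets (complement_complex Y)"
        by (rule complex_iso_facet_iff[OF iso complement_complex_faces_subset complement_complex_faces_subset]) simp
      then show "F \<in> facets X \<longleftrightarrow> f ` F \<in> facets Y"
        using F sub[OF F] by (simp add: im facets_complement_complex[OF sX]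
            facets_complement_complex[OF sY] double_diff)
    qed
  next
    assume iso: "complex_iso f X Y"
    have eq: "faces (complement_complex Z) = {E. \<exists>F\<in>facets Z. E \<subseteq> ground Z - F}" for Z :: "'c set_system"
      by (simp add: complement_complex_def)
    have fac: "F \<in> facets X \<longleftrightarrow> f ` F \<in> facets Y" if "F \<subseteq> ground X" for F
      by (rule complex_iso_facet_iff[OF iso sX sY that])
    show "complex_iso f (complement_complex X) (complement_complex Y)"
      unfolding complex_iso_def eq
    proof (intro conjI allI impI)
      fix E assume E: "E \<subseteq> ground (complement_complex X)"
      have *: "f ` E \<subseteq> ground Y - f ` F \<longleftrightarrow> E \<subseteq> ground X - F" if "F \<subseteq> ground X" for F
        using bij_betw_image_subset_iff[OF b, of E "ground X - F"] E im[OF that] by simp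
      have gY: "\<exists>F\<subseteq>ground X. G = f ` F" if "G \<in> facets Y" for G
      proof -
        have "f ` (f -` G \<inter> ground X) = G"
          using that sY by (intro bij_betw_image_vimage[OF b]) (auto simp: facets_def)
        then show ?thesis by (metis Int_lower2)
      qed
      have gX: "F \<subseteq> ground X" if "F \<in> facets X" for F using that sX by (auto simp: facets_def)
      show "E \<in> {E. \<exists>F\<in>facets X. E \<subseteq> ground X - F} \<longleftrightarrow>
        f ` E \<in> {E. \<exists>F\<in>facets Y. E \<subseteq> ground Y - F}" 
      proof
        assume "E \<in> {E. \<exists>F\<in>facets X. E \<subseteq> ground X - F}"
        then obtain F where F: "F \<in> facets X" "E \<subseteq> ground X - F" by blast
        have "f ` F \<in> facets Y" using fac[OF gX[OF F(1)]] F(1) by simp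
        moreover have "f ` E \<subseteq> ground Y - f ` F" using *[OF gX[OF F(1)]] F(2) by simp
        ultimately show "f ` E \<in> {E. \<exists>F\<in>facets Y. E \<subseteq> ground Y - F}" by blast
      next
        assume "f ` E \<in> {E. \<exists>F\<in>facets Y. E \<subseteq> ground Y - F}"
        then obtain G where G: "G \<in> facets Y" "f ` E \<subseteq> ground Y - G" by blast
        then obtain F where F: "F \<subseteq> ground X" "G = f ` F" using gY[OF G(1)] by (elim exE conjE)
        have "F \<in> facets X" using fac[OF F(1)] F(2) G(1) by simp
        moreover have "E \<subseteq> ground X - F" using *[OF F(1)] F(2) G(2) by simp
        ultimately show "E \<in> {E. \<exists>F\<in>facets X. E \<subseteq> ground X - F}" by blast
      qed
    qed (simp add: b)
  qed
qed (simp add: complex_iso_def)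

section \<open>Barycentric subdivisions\<close>

lemma simplicial_complex_barycentric_subdivision: "simplicial_complex (barycentric_subdivision X)"
  by (auto simp: simplicial_complex_def barycentric_subdivision_def)

lemma ground_barycentric_subdivision [simp]: "ground (barycentric_subdivision X) = faces X - {{}}"
  by (simp add: barycentric_subdivision_def)

lemma complex_iso_relabel:
  assumes "simplicial_complex X" "inj_on f (ground X)"
  shows "complex_iso f X (relabel f X)"
  unfolding complex_iso_def
proof (intro conjI allI impI)
  fix E assume E: "E \<subseteq> ground X"
  have "E \<in> faces X" if "E' \<in> faces X" "f ` E = f ` E'" for E'
    using that E assms inj_on_image_eq_iff[OF assms(2)] by (metis PowD faces_subset_ground subset_iff)
  then show "E \<in> faces X \<longleftrightarrow> f ` E \<in> faces (relabel f X)" by (auto simp: relabel_def)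
qed (use assms in \<open>auto simp: relabel_def bij_betw_def\<close>)

lemma simplicial_complex_iso:
  assumes "simplicial_complex X" "complex_iso f X Y" "faces Y \<subseteq> Pow (ground Y)"
  shows "simplicial_complex Y"
  unfolding simplicial_complex_def
proof (intro conjI ballI allI impI assms)
  have b: "bij_betw f (ground X) (ground Y)" using assms by (simp add: complex_iso_def)
  { fix v assume "v \<in> ground Y"
    then obtain u where "u \<in> ground X" "v = f u" using b by (auto simp: bij_betw_def)
    then show "{v} \<in> faces Y" using assms(1,2) by (force simp: complex_iso_def simplicial_complex_def) }
  fix E F assume E: "E \<in> faces Y" "F \<subseteq> E"
  let ?p = "\<lambda>E. f -` E \<inter> ground X"
  have eq: "f ` ?p E = E" "f ` ?p F = F" using E assms(3) by (intro bij_betw_image_vimage[OF b]; blast)+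
  then have "?p E \<in> faces X" using assms(2) E by (metis Int_lower2 complex_iso_def)
  moreover have "?p F \<subseteq> ?p E" using E(2) by blast
  ultimately have "?p F \<in> faces X" using assms(1) unfolding simplicial_complex_def by blast
  then show "F \<in> faces Y" using eq assms(2) by (metis Int_lower2 complex_iso_def)
qed

lemma complex_iso_barycentric_subdivision:
  assumes "complex_iso f X Y" "simplicial_complex X" "simplicial_complex Y"
  shows "complex_iso ((`) f) (barycentric_subdivision X) (barycentric_subdivision Y)"
proof -
  have b: "bij_betw f (ground X) (ground Y)" using assms by (simp add: complex_iso_def)
  note sX = faces_subset_ground[OF assms(2)] and sY = faces_subset_ground[OF assms(3)]
  have s: "f ` E \<subseteq> f ` E' \<longleftrightarrow> E \<subseteq> E'" if "E \<in> faces X" "E' \<in> faces X" for E E'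
    using that sX by (intro bij_betw_image_subset_iff[OF b]) auto
  have inj: "inj_on ((`) f) (faces X - {{}})"
    by (intro inj_onI equalityI) (simp_all flip: s)
  have im: "((`) f) ` (faces X - {{}}) = faces Y - {{}}"
  proof
    show "(`) f ` (faces X - {{}}) \<subseteq> faces Y - {{}}"
      using assms(1) sX by (auto simp: complex_iso_def)
    show "faces Y - {{}} \<subseteq> (`) f ` (faces X - {{}})"
    proof
      fix F assume F: "F \<in> faces Y - {{}}"
      have eq: "f ` (f -` F \<inter> ground X) = F"
        using F sY by (intro bij_betw_image_vimage[OF b]) blast
      then have "f -` F \<inter> ground X \<in> faces X"
        using F assms(1) by (metis DiffD1 Int_lower2 complex_iso_def)
      then show "F \<in> (`) f ` (faces X - {{}})"
        using eq F by (metis (no_types, lifting) Diff_iff image_empty image_eqI insert_iff empty_iff)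
    qed
  qed
  show ?thesis
    unfolding complex_iso_def
  proof (intro conjI allI impI)
    show "bij_betw ((`) f) (ground (barycentric_subdivision X)) (ground (barycentric_subdivision Y))"
      using inj im by (simp add: bij_betw_def)
    fix C assume C: "C \<subseteq> ground (barycentric_subdivision X)"
    then have "(`) f ` C \<subseteq> faces Y - {{}}" using im by auto
    then show "C \<in> faces (barycentric_subdivision X) \<longleftrightarrow> (`) f ` C \<in> faces (barycentric_subdivision Y)"
      using C s by (auto simp: barycentric_subdivision_def subset_iff)
  qed
qed

lemma relabel_faces_subset:
  "faces X \<subseteq> Pow (ground X) \<Longrightarrow> faces (relabel f X) \<subseteq> Pow (ground (relabel f X))"
  by (auto simp: relabel_def)

lemma complex_iso_barycentric_subdivision_nat:
  assumes "simplicial_complex X" "finite (ground X)"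
  shows "complex_iso set_encode (barycentric_subdivision X) (barycentric_subdivision_nat X)"
proof -
  have "faces X \<subseteq> Collect finite" using faces_subset_ground[OF assms(1)] finite_subset[OF _ assms(2)] by auto
  then have "inj_on set_encode (ground (barycentric_subdivision X))"
    using inj_on_set_encode inj_on_subset by (metis Diff_subset ground_barycentric_subdivision)
  then show ?thesis
    unfolding barycentric_subdivision_nat_def
    by (intro complex_iso_relabel simplicial_complex_barycentric_subdivision)
qed

lemma barycentric_subdivision_nat_simplicial_complex:
  assumes "simplicial_complex X" "finite (ground X)"
  shows "simplicial_complex (barycentric_subdivision_nat X)" "finite (ground (barycentric_subdivision_nat X))"
proof -
  show "simplicial_complex (barycentric_subdivision_nat X)"
    by (rule simplicial_complex_iso[OF _ complex_iso_barycentric_subdivision_nat[OF assms]])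
      (simp_all only: barycentric_subdivision_nat_def simplicial_complex_barycentric_subdivision
         relabel_faces_subset[OF faces_subset_ground])
  have "finite (faces X)"
    using assms(2) by (intro finite_subset[OF faces_subset_ground[OF assms(1)]]) simp
  then show "finite (ground (barycentric_subdivision_nat X))"
    by (simp add: barycentric_subdivision_nat_def relabel_def)
qed

lemma complex_isomorphic_barycentric_subdivision_nat_iff:
  assumes X: "simplicial_complex X" "finite (ground X)" and Y: "simplicial_complex Y" "finite (ground Y)"
  shows "complex_isomorphic (barycentric_subdivision_nat X) (barycentric_subdivision_nat Y) \<longleftrightarrow>
     complex_isomorphic (barycentric_subdivision X) (barycentric_subdivision Y)"
proof -
  note iX = complex_iso_barycentric_subdivision_nat[OF X] and iY = complex_iso_barycentric_subdivision_nat[OF Y]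
  show ?thesis
    unfolding complex_isomorphic_simplicial_iff[OF simplicial_complex_barycentric_subdivision
        simplicial_complex_barycentric_subdivision]
      complex_isomorphic_simplicial_iff[OF barycentric_subdivision_nat_simplicial_complex(1)[OF X]
        barycentric_subdivision_nat_simplicial_complex(1)[OF Y]]
  proof
    assume "\<exists>f. complex_iso f (barycentric_subdivision_nat X) (barycentric_subdivision_nat Y)"
    then obtain f where "complex_iso f (barycentric_subdivision_nat X) (barycentric_subdivision_nat Y)" ..
    from complex_iso_comp[OF complex_iso_comp[OF iX this] complex_iso_inv[OF iY]]
    show "\<exists>f. complex_iso f (barycentric_subdivision X) (barycentric_subdivision Y)" by blast
  next
    assume "\<exists>f. complex_iso f (barycentric_subdivision X) (barycentric_subdivision Y)"
    then obtain f where "complex_iso f (barycentric_subdivision X) (barycentric_subdivision Y)" ..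
    from complex_iso_comp[OF complex_iso_comp[OF complex_iso_inv[OF iX] this] iY]
    show "\<exists>f. complex_iso f (barycentric_subdivision_nat X) (barycentric_subdivision_nat Y)" by blast
  qed
qed

text \<open>The comparability graph is the 1-skeleton of the subdivision: its edges are the chains
  with exactly two elements.\<close>

lemma graph_isomorphic_barycentric_subdivision:
  assumes "complex_isomorphic (barycentric_subdivision X) (barycentric_subdivision Y)"
  shows "graph_isomorphic (comparability_graph X) (comparability_graph Y)"
proof -
  obtain f where f: "complex_iso f (barycentric_subdivision X) (barycentric_subdivision Y)"
    using assms by (auto simp: complex_isomorphic_simplicial_iff simplicial_complex_barycentric_subdivision)
  let ?X = "faces X - {{}}" and ?Y = "faces Y - {{}}"
  have b: "bij_betw f ?X ?Y" using f by (simp add: complex_iso_def)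
  have fi: "f u = f v \<longleftrightarrow> u = v" if "u \<in> ?X" "v \<in> ?X" for u v
    using inj_on_eq_iff[OF bij_betw_imp_inj_on[OF b]] that by blast
  have fc: "f u \<in> ?Y" if "u \<in> ?X" for u
    using bij_betwE[OF b] that by blast
  have e: "{u, v} \<in> edges (comparability_graph Z) \<longleftrightarrow> u \<noteq> v \<and> {u, v} \<in> faces (barycentric_subdivision Z)"
    if "u \<in> faces Z - {{}}" "v \<in> faces Z - {{}}" for u v and Z :: "'c set_system"
    using that by (auto simp: comparability_graph_def barycentric_subdivision_def doubleton_eq_iff)
  have "{u, v} \<in> edges (comparability_graph X) \<longleftrightarrow> {f u, f v} \<in> edges (comparability_graph Y)"
    if "u \<in> ?X" "v \<in> ?X" for u v
  proof -
    have "{u, v} \<in> faces (barycentric_subdivision X) \<longleftrightarrow> f ` {u, v} \<in> faces (barycentric_subdivision Y)"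
      using f that unfolding complex_iso_def by (metis empty_subsetI ground_barycentric_subdivision insert_subset)
    then show ?thesis
      unfolding e[OF that] e[OF fc[OF that(1)] fc[OF that(2)]] using fi[OF that] by simp
  qed
  then show ?thesis
    unfolding graph_isomorphic_def using b
    by (intro exI[of _ f]) (auto simp: comparability_graph_def)
qed

section \<open>Polynomials and face ideals\<close>

lemma keys_add_nat: "Poly_Mapping.keys (m + n) = Poly_Mapping.keys m \<union> Poly_Mapping.keys n"
  for m n :: "'v \<Rightarrow>\<^sub>0 nat"
  by (auto simp: in_keys_iff lookup_add)

lemma poly_mapping_sum_singles:
  "p = (\<Sum>m\<in>Poly_Mapping.keys p. Poly_Mapping.single m (Poly_Mapping.lookup p m))"
proof (rule poly_mapping_eqI)
  fix n
  have "(\<Sum>m\<in>Poly_Mapping.keys p. Poly_Mapping.lookup (Poly_Mapping.single m (Poly_Mapping.lookup p m)) n)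
      = (\<Sum>m\<in>Poly_Mapping.keys p. if m = n then Poly_Mapping.lookup p n else 0)"
    by (intro sum.cong refl) (simp add: lookup_single when_def)
  also have "\<dots> = Poly_Mapping.lookup p n" by (simp add: in_keys_iff)
  finally show "Poly_Mapping.lookup p n =
      Poly_Mapping.lookup (\<Sum>m\<in>Poly_Mapping.keys p. Poly_Mapping.single m (Poly_Mapping.lookup p m)) n"
    by (simp add: lookup_sum)
qed

abbreviation polys :: "'v set \<Rightarrow> ('v, 'k::field) mpoly set" where
  "polys V \<equiv> carrier (polynomial_ring V)"

lemma polynomial_ring_simps [simp]:
  "p \<otimes>\<^bsub>polynomial_ring V\<^esub> q = p * q" "\<one>\<^bsub>polynomial_ring V\<^esub> = 1"
  "\<zero>\<^bsub>polynomial_ring V\<^esub> = 0" "p \<oplus>\<^bsub>polynomial_ring V\<^esub> q = p + q"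
  by (simp_all add: polynomial_ring_def)

lemma polys_iff: "p \<in> polys V \<longleftrightarrow> (\<forall>m\<in>Poly_Mapping.keys p. Poly_Mapping.keys m \<subseteq> V)"
  by (simp add: polynomial_ring_def)

lemma polys_add [intro]: "p \<in> polys V \<Longrightarrow> q \<in> polys V \<Longrightarrow> p + q \<in> polys V"
  using keys_add[of p q] by (auto simp: polys_iff)

lemma polys_mult [intro]: "p \<in> polys V \<Longrightarrow> q \<in> polys V \<Longrightarrow> p * q \<in> polys V"
  using keys_mult[of p q] by (fastforce simp: polys_iff keys_add_nat)

lemma polys_uminus [intro]: "p \<in> polys V \<Longrightarrow> - p \<in> polys V"
  by (simp add: polys_iff in_keys_iff)

lemma polys_diff [intro]: "p \<in> polys V \<Longrightarrow> q \<in> polys V \<Longrightarrow> p - q \<in> polys V"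
  using polys_add[of p V "- q"] polys_uminus[of q V] by simp

lemma polys_zero [intro, simp]: "0 \<in> polys V" and polys_one [intro, simp]: "1 \<in> polys V"
  and polys_mconst [intro, simp]: "mconst c \<in> polys V"
  by (simp_all add: polys_iff mconst_def)

lemma polys_mvar_iff [simp]: "mvar v \<in> (polys V :: ('v, 'k::field) mpoly set) \<longleftrightarrow> v \<in> V"
  by (simp add: polys_iff mvar_def)

lemma polys_single: "Poly_Mapping.keys m \<subseteq> V \<Longrightarrow> Poly_Mapping.single m c \<in> polys V"
  by (simp add: polys_iff)

lemma polys_monomial:
  fixes p :: "('v, 'k::field) mpoly"
  shows "p \<in> polys V \<Longrightarrow> m \<in> Poly_Mapping.keys p \<Longrightarrow> Poly_Mapping.single m c \<in> (polys V :: ('v, 'k) mpoly set)"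
  by (simp add: polys_iff)

lemma polys_sum [intro]: "(\<And>i. i \<in> A \<Longrightarrow> f i \<in> polys V) \<Longrightarrow> sum f A \<in> polys V"
  by (induction A rule: infinite_finite_induct) auto

lemma polys_prod [intro]: "(\<And>i. i \<in> A \<Longrightarrow> f i \<in> polys V) \<Longrightarrow> prod f A \<in> polys V"
  by (induction A rule: infinite_finite_induct) auto

lemma cring_polynomial_ring: "cring (polynomial_ring V :: ('v, 'k::field) mpoly ring)"
proof (intro cringI abelian_groupI comm_monoidI)
  fix p :: "('v, 'k) mpoly" assume "p \<in> polys V"
  then show "\<exists>q\<in>polys V. q \<oplus>\<^bsub>polynomial_ring V\<^esub> p = \<zero>\<^bsub>polynomial_ring V\<^esub>"
    by (intro bexI[of _ "- p"]) auto
qed (auto simp: algebra_simps)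

lemma polynomial_ring_a_inv:
  assumes "p \<in> polys V"
  shows "\<ominus>\<^bsub>polynomial_ring V\<^esub> p = - p"
proof -
  interpret cring "polynomial_ring V" by (rule cring_polynomial_ring)
  show ?thesis using minus_equality[of "- p" p] assms by (auto intro: polys_uminus)
qed

lemma polynomial_ring_a_minus:
  "p \<in> polys V \<Longrightarrow> q \<in> polys V \<Longrightarrow> p \<ominus>\<^bsub>polynomial_ring V\<^esub> q = p - q"
  by (simp add: a_minus_def polynomial_ring_a_inv)

section \<open>Ideals and induction principles for polynomials\<close>

lemma ideal_polynomial_ringI:
  fixes J :: "('v, 'k::field) mpoly set"
  assumes "J \<subseteq> polys V" "0 \<in> J" "\<And>p q. p \<in> J \<Longrightarrow> q \<in> J \<Longrightarrow> p + q \<in> J"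
    "\<And>p q. p \<in> polys V \<Longrightarrow> q \<in> J \<Longrightarrow> p * q \<in> J"
  shows "ideal J (polynomial_ring V)"
proof -
  interpret cring "polynomial_ring V :: ('v, 'k) mpoly ring" by (rule cring_polynomial_ring)
  have uminus: "- p \<in> J" if "p \<in> J" for p
    using assms(4)[of "- 1" p] that by (simp add: polys_uminus)
  show ?thesis
  proof (rule idealI)
    show "subgroup J (add_monoid (polynomial_ring V))"
    proof (rule add.subgroupI)
      show "\<ominus>\<^bsub>polynomial_ring V\<^esub> p \<in> J" if p: "p \<in> J" for p
        using polynomial_ring_a_inv[of p V] assms(1) p uminus[OF p] by auto
    qed (use assms in auto)
    show "p \<otimes>\<^bsub>polynomial_ring V\<^esub> q \<in> J" if "p \<in> J" "q \<in> polys V" for p q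
      using assms(4)[OF that(2,1)] by (simp add: mult.commute)
  qed (use assms ring_axioms in simp_all)
qed

lemma ideal_polynomial_ringD:
  fixes J :: "('v, 'k::field) mpoly set"
  assumes "ideal J (polynomial_ring V)"
  shows "p \<in> J \<Longrightarrow> p \<in> polys V" "0 \<in> J" "p \<in> J \<Longrightarrow> q \<in> J \<Longrightarrow> p + q \<in> J"
    "p \<in> polys V \<Longrightarrow> q \<in> J \<Longrightarrow> p * q \<in> J" "p \<in> J \<Longrightarrow> q \<in> J \<Longrightarrow> p - q \<in> J"
proof -
  interpret ideal J "polynomial_ring V" by (rule assms)
  show *: "p \<in> J \<Longrightarrow> p \<in> polys V" "0 \<in> J" "p \<in> J \<Longrightarrow> q \<in> J \<Longrightarrow> p + q \<in> J"
    "p \<in> polys V \<Longrightarrow> q \<in> J \<Longrightarrow> p * q \<in> J" for p q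
    using Icarr additive_subgroup.zero_closed[OF additive_subgroup_axioms]
      additive_subgroup.a_closed[OF additive_subgroup_axioms, of p q] I_l_closed[of q p] by simp_all
  show "p \<in> J \<Longrightarrow> q \<in> J \<Longrightarrow> p - q \<in> J"
    using *(3)[of p "- 1 * q"] *(4)[of "- 1" q] by (simp add: polys_uminus)
qed

lemma mvar_mult_single: "mvar v * Poly_Mapping.single m c = Poly_Mapping.single (Poly_Mapping.single v 1 + m) c"
  by (simp add: mvar_def mult_single)

lemma single_eq_mvar_mult:
  fixes m :: "'v \<Rightarrow>\<^sub>0 nat"
  assumes "v \<in> Poly_Mapping.keys m"
  obtains m' where "m = Poly_Mapping.single v 1 + m'" "Poly_Mapping.keys m' \<subseteq> Poly_Mapping.keys m"
    "Poly_Mapping.lookup m' v < Poly_Mapping.lookup m v"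
proof -
  have "m = Poly_Mapping.single v 1 + (m - Poly_Mapping.single v 1)"
    using assms by (intro poly_mapping_eqI) (auto simp: lookup_add lookup_minus lookup_single in_keys_iff when_def)
  moreover have "Poly_Mapping.keys (m - Poly_Mapping.single v 1) \<subseteq> Poly_Mapping.keys m"
    by (auto simp: in_keys_iff lookup_minus)
  moreover have "Poly_Mapping.lookup (m - Poly_Mapping.single v 1) v < Poly_Mapping.lookup m v"
    using assms by (auto simp: lookup_minus in_keys_iff)
  ultimately show ?thesis by (rule that)
qed

lemma polys_monomial_induct [consumes 1, case_names monomial add]:
  assumes p: "p \<in> polys V"
    and monomial: "\<And>m c. Poly_Mapping.keys m \<subseteq> V \<Longrightarrow> P (Poly_Mapping.single m c)"
    and add: "\<And>p q. p \<in> polys V \<Longrightarrow> q \<in> polys V \<Longrightarrow> P p \<Longrightarrow> P q \<Longrightarrow> P (p + q)"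
  shows "P p"
proof -
  have "P (\<Sum>m\<in>A. Poly_Mapping.single m (Poly_Mapping.lookup p m))" if "finite A" "\<forall>m\<in>A. Poly_Mapping.keys m \<subseteq> V" for A
    using that
  proof (induction A rule: finite_induct)
    case empty
    show ?case using monomial[of 0 0] by simp
  next
    case (insert m A)
    then have "P (Poly_Mapping.single m (Poly_Mapping.lookup p m) + (\<Sum>m\<in>A. Poly_Mapping.single m (Poly_Mapping.lookup p m)))"
      by (intro add polys_sum polys_single monomial) auto
    then show ?case using insert by simp
  qed
  from this[of "Poly_Mapping.keys p"] p show ?thesis
    by (simp add: polys_iff flip: poly_mapping_sum_singles)
qed

lemma polys_induct [consumes 1, case_names const add mvar]:
  assumes p: "p \<in> polys V"
    and const: "\<And>c. P (mconst c)"
    and add: "\<And>p q. p \<in> polys V \<Longrightarrow> q \<in> polys V \<Longrightarrow> P p \<Longrightarrow> P q \<Longrightarrow> P (p + q)"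
    and mvar: "\<And>v p. v \<in> V \<Longrightarrow> p \<in> polys V \<Longrightarrow> P p \<Longrightarrow> P (mvar v * p)"
  shows "P p"
proof -
  have single: "P (Poly_Mapping.single m c)" if "Poly_Mapping.keys m \<subseteq> V" for m c
    using that
  \<comment> \<open>Induction on the total degree; splitting off one variable lowers it, whether or
    not that variable remains in the support.\<close>
  proof (induction "\<Sum>v\<in>Poly_Mapping.keys m. Poly_Mapping.lookup m v" arbitrary: m rule: less_induct)
    case less
    show ?case
    proof (cases "m = 0")
      case True
      then show ?thesis using const[of c] by (simp add: mconst_def)
    next
      case False
      then obtain v where v: "v \<in> Poly_Mapping.keys m" by (metis all_not_in_conv keys_eq_empty)
      then obtain m' where m': "m = Poly_Mapping.single v 1 + m'" "Poly_Mapping.keys m' \<subseteq> Poly_Mapping.keys m"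
        "Poly_Mapping.lookup m' v < Poly_Mapping.lookup m v"
        by (rule single_eq_mvar_mult)
      have "(\<Sum>u\<in>Poly_Mapping.keys m'. Poly_Mapping.lookup m' u) \<le> (\<Sum>u\<in>Poly_Mapping.keys m. Poly_Mapping.lookup m' u)"
        using m'(2) by (intro sum_mono2) auto
      also have "\<dots> < (\<Sum>u\<in>Poly_Mapping.keys m. Poly_Mapping.lookup m u)"
        using v m'(3) by (intro sum_strict_mono_ex1 ballI bexI[of _ v]) (simp_all add: m'(1) lookup_add)
      finally have "P (Poly_Mapping.single m' c)" using less m'(2) by auto
      then show ?thesis unfolding m'(1) mvar_mult_single[symmetric] using v less.prems m'(2) by (intro mvar polys_single) auto
    qed
  qed
  show ?thesis using p by (induction rule: polys_monomial_induct) (simp_all add: single add)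
qed

lemma polys_UNIV: "p \<in> polys UNIV"
  by (simp add: polys_iff)

lemma mconst_simps: "mconst 0 = 0" "mconst 1 = 1" "mconst (a + b) = mconst a + mconst b"
  "mconst (a * b) = mconst a * mconst b"
  by (simp_all add: mconst_def single_add mult_single)

text \<open>One evaluation homomorphism serves three purposes: values for the identity on the field,
  directional derivatives for constants in \<open>poly\<close>, and substitution for constants in
  another polynomial ring.\<close>

locale coeff_hom =
  fixes \<kappa> :: "'k::field \<Rightarrow> 'r::comm_ring_1"
  assumes zero [simp]: "\<kappa> 0 = 0" and one [simp]: "\<kappa> 1 = 1"
    and add [simp]: "\<kappa> (a + b) = \<kappa> a + \<kappa> b" and mult [simp]: "\<kappa> (a * b) = \<kappa> a * \<kappa> b"
begin

definition monom_eval :: "('v \<Rightarrow> 'r) \<Rightarrow> ('v \<Rightarrow>\<^sub>0 nat) \<Rightarrow> 'r" where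
  "monom_eval a m = (\<Prod>v\<in>Poly_Mapping.keys m. a v ^ Poly_Mapping.lookup m v)"

definition meval :: "('v \<Rightarrow> 'r) \<Rightarrow> ('v, 'k) mpoly \<Rightarrow> 'r" where
  "meval a p = (\<Sum>m\<in>Poly_Mapping.keys p. \<kappa> (Poly_Mapping.lookup p m) * monom_eval a m)"

lemma monom_eval_superset:
  assumes "finite A" "Poly_Mapping.keys m \<subseteq> A"
  shows "monom_eval a m = (\<Prod>v\<in>A. a v ^ Poly_Mapping.lookup m v)"
  unfolding monom_eval_def using assms
  by (intro prod.mono_neutral_left) (auto simp: in_keys_iff)

lemma monom_eval_add: "monom_eval a (m + n) = monom_eval a m * monom_eval a n"
proof -
  let ?A = "Poly_Mapping.keys m \<union> Poly_Mapping.keys n"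
  have "monom_eval a (m + n) = (\<Prod>v\<in>?A. a v ^ Poly_Mapping.lookup (m + n) v)"
    by (rule monom_eval_superset) (auto simp: keys_add_nat)
  also have "\<dots> = (\<Prod>v\<in>?A. a v ^ Poly_Mapping.lookup m v) * (\<Prod>v\<in>?A. a v ^ Poly_Mapping.lookup n v)"
    by (simp add: lookup_add power_add prod.distrib)
  also have "\<dots> = monom_eval a m * monom_eval a n"
    using monom_eval_superset[of ?A m a] monom_eval_superset[of ?A n a] by simp
  finally show ?thesis .
qed

lemma monom_eval_single [simp]: "monom_eval a (Poly_Mapping.single v k) = a v ^ k"
  by (simp add: monom_eval_def)

lemma monom_eval_zero [simp]: "monom_eval a 0 = 1"
  by (simp add: monom_eval_def)

lemma meval_superset:
  assumes "finite A" "Poly_Mapping.keys p \<subseteq> A"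
  shows "meval a p = (\<Sum>m\<in>A. \<kappa> (Poly_Mapping.lookup p m) * monom_eval a m)"
  unfolding meval_def using assms
  by (intro sum.mono_neutral_left) (auto simp: in_keys_iff)

lemma meval_add: "meval a (p + q) = meval a p + meval a q"
proof -
  let ?A = "Poly_Mapping.keys p \<union> Poly_Mapping.keys q"
  have "meval a (p + q) = (\<Sum>m\<in>?A. \<kappa> (Poly_Mapping.lookup (p + q) m) * monom_eval a m)"
    by (rule meval_superset) (auto dest: keys_add[THEN subsetD])
  then show ?thesis
    using meval_superset[of ?A p a] meval_superset[of ?A q a]
    by (simp add: lookup_add algebra_simps sum.distrib)
qed

lemma meval_single: "meval a (Poly_Mapping.single m c) = \<kappa> c * monom_eval a m"
  by (simp add: meval_def)

lemma meval_mconst [simp]: "meval a (mconst c) = \<kappa> c"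
  by (simp add: mconst_def meval_single)

lemma meval_zero [simp]: "meval a 0 = 0"
  by (simp add: meval_def)

lemma meval_one [simp]: "meval a 1 = 1"
  using meval_mconst[of a 1] by (simp add: mconst_simps)

lemma meval_mvar [simp]: "meval a (mvar v) = a v"
  by (simp add: mvar_def meval_single)

lemma meval_mult: "meval a (p * q) = meval a p * meval a q"
proof (induction p rule: polys_monomial_induct[OF polys_UNIV])
  case (1 m c)
  show ?case
  proof (induction q rule: polys_monomial_induct[OF polys_UNIV])
    case (1 n d)
    show ?case by (simp add: mult_single meval_single monom_eval_add)
  next
    case (2 p q)
    then show ?case by (simp add: meval_add distrib_left)
  qed
next
  case (2 p q)
  then show ?case by (simp add: meval_add distrib_right)
qed

lemma meval_prod: "meval a (prod f A) = (\<Prod>i\<in>A. meval a (f i))"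
  by (induction A rule: infinite_finite_induct) (simp_all add: meval_mult)

lemma meval_uminus: "meval a (- p) = - meval a p"
  using meval_add[of a p "- p"] by (simp add: eq_neg_iff_add_eq_0 add.commute)

lemma meval_diff: "meval a (p - q) = meval a p - meval a q"
  using meval_add[of a p "- q"] by (simp add: meval_uminus)

lemma meval_eq_0:
  assumes "\<And>m. m \<in> Poly_Mapping.keys p \<Longrightarrow> \<exists>v\<in>Poly_Mapping.keys m. a v = 0"
  shows "meval a p = 0"
proof -
  have "monom_eval a m = 0" if m: "m \<in> Poly_Mapping.keys p" for m
  proof -
    obtain v where "v \<in> Poly_Mapping.keys m" "a v = 0" using assms[OF m] by blast
    then show ?thesis unfolding monom_eval_def
      by (intro prod_zero bexI[of _ v]) (simp_all add: zero_power in_keys_iff)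
  qed
  then show ?thesis by (simp add: meval_def)
qed

end

lemma coeff_hom_mconst: "coeff_hom mconst"
  by unfold_locales (simp_all add: mconst_simps)

lemma coeff_hom_id: "coeff_hom (\<lambda>c::'k::field. c)"
  by unfold_locales simp_all

lemma coeff_hom_pCons: "coeff_hom (\<lambda>c::'k::field. [:c:])"
  by unfold_locales (simp_all add: one_pCons)

definition msubst :: "('v \<Rightarrow> ('w, 'k::field) mpoly) \<Rightarrow> ('v, 'k) mpoly \<Rightarrow> ('w, 'k) mpoly" where
  "msubst = coeff_hom.meval mconst"

lemmas msubst_simps [simp] =
  coeff_hom.meval_zero[OF coeff_hom_mconst, folded msubst_def]
  coeff_hom.meval_one[OF coeff_hom_mconst, folded msubst_def]
  coeff_hom.meval_mconst[OF coeff_hom_mconst, folded msubst_def]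
  coeff_hom.meval_mvar[OF coeff_hom_mconst, folded msubst_def]
  coeff_hom.meval_add[OF coeff_hom_mconst, folded msubst_def]
  coeff_hom.meval_diff[OF coeff_hom_mconst, folded msubst_def]
  coeff_hom.meval_mult[OF coeff_hom_mconst, folded msubst_def]
  coeff_hom.meval_prod[OF coeff_hom_mconst, folded msubst_def]

lemma msubst_polys:
  assumes "p \<in> polys V" "\<And>v. v \<in> V \<Longrightarrow> a v \<in> polys W"
  shows "msubst a p \<in> polys W"
  using assms(1) by (induction rule: polys_induct) (auto simp: assms(2))

lemma msubst_msubst:
  assumes "p \<in> polys V" "\<And>v. v \<in> V \<Longrightarrow> msubst b (a v) = mvar v"
  shows "msubst b (msubst a p) = p"
  using assms(1) by (induction rule: polys_induct) (auto simp: assms(2))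

lemma msubst_mvar: "msubst mvar p = p"
  by (induction p rule: polys_induct[OF polys_UNIV]) simp_all

text \<open>The ideal generated by the variables in \<open>V - W\<close>, described through
  monomials. Membership can thus be tested term by term, on which the treatment of sums of such
  ideals rests.\<close>

definition face_ideal :: "'v set \<Rightarrow> 'v set \<Rightarrow> ('v, 'k::field) mpoly set" where
  "face_ideal V W = {p \<in> polys V. \<forall>m\<in>Poly_Mapping.keys p. \<not> Poly_Mapping.keys m \<subseteq> W}"

lemma face_ideal_polys: "p \<in> face_ideal V W \<Longrightarrow> p \<in> polys V"
  by (simp add: face_ideal_def)

lemma face_ideal_zero [simp]: "0 \<in> face_ideal V W"
  by (simp add: face_ideal_def)

lemma face_ideal_add: "p \<in> face_ideal V W \<Longrightarrow> q \<in> face_ideal V W \<Longrightarrow> p + q \<in> face_ideal V W"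
  using keys_add[of p q] by (auto simp: face_ideal_def)

lemma face_ideal_uminus: "p \<in> face_ideal V W \<Longrightarrow> - p \<in> face_ideal V W"
  by (auto simp: face_ideal_def in_keys_iff)

lemma face_ideal_diff: "p \<in> face_ideal V W \<Longrightarrow> q \<in> face_ideal V W \<Longrightarrow> p - q \<in> face_ideal V W"
  using face_ideal_add[of p V W "- q"] by (simp add: face_ideal_uminus)

lemma face_ideal_mult: "p \<in> face_ideal V W \<Longrightarrow> q \<in> polys V \<Longrightarrow> q * p \<in> face_ideal V W"
  using keys_mult[of q p] by (fastforce simp: face_ideal_def polys_mult keys_add_nat)

lemma face_ideal_mult2: "p \<in> face_ideal V W \<Longrightarrow> q \<in> polys V \<Longrightarrow> p * q \<in> face_ideal V W"
  using face_ideal_mult[of p V W q] by (simp add: mult.commute)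

lemma face_ideal_antimono: "W \<subseteq> W' \<Longrightarrow> face_ideal V W' \<subseteq> face_ideal V W"
  by (auto simp: face_ideal_def)

lemma mvar_face_ideal_iff [simp]: "mvar v \<in> (face_ideal V W :: ('v, 'k::field) mpoly set) \<longleftrightarrow> v \<in> V - W"
  by (auto simp: face_ideal_def mvar_def polys_iff)

lemma one_notin_face_ideal [simp]: "1 \<notin> face_ideal V W"
  by (simp add: face_ideal_def)

lemma ideal_face_ideal: "ideal (face_ideal V W) (polynomial_ring V)"
  by (rule ideal_polynomial_ringI) (auto simp: face_ideal_polys face_ideal_add face_ideal_mult)

text \<open>
  Setting the variables outside \<open>W\<close> to zero is a homomorphism with kernel \<open>face_ideal V W\<close>,
  whence this ideal is prime.
\<close>

lemma lookup_msubst_restrict: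
  "Poly_Mapping.lookup (msubst (\<lambda>v. if v \<in> W then mvar v else 0) p) m =
     (if Poly_Mapping.keys m \<subseteq> W then Poly_Mapping.lookup p m else 0)"
proof (induction p rule: polys_monomial_induct[OF polys_UNIV])
  case (1 n c)
  interpret coeff_hom mconst by (rule coeff_hom_mconst)
  show ?case
  proof (cases "Poly_Mapping.keys n \<subseteq> W")
    case True
    have "msubst (\<lambda>v. if v \<in> W then mvar v else 0) (Poly_Mapping.single n c) = msubst mvar (Poly_Mapping.single n c)"
      using True by (auto simp: msubst_def meval_single monom_eval_def subset_iff intro!: prod.cong arg_cong2[of _ _ _ _ "(*)"])
    then show ?thesis using True by (auto simp: msubst_mvar lookup_single when_def)
  next
    case False
    then have "msubst (\<lambda>v. if v \<in> W then mvar v else 0) (Poly_Mapping.single n c) = 0"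
      unfolding msubst_def by (intro meval_eq_0) (auto split: if_splits)
    then show ?thesis using False by (auto simp: lookup_single when_def)
  qed
next
  case (2 p q)
  then show ?case by (simp add: lookup_add)
qed

lemma face_ideal_iff_msubst:
  "p \<in> face_ideal V W \<longleftrightarrow> p \<in> polys V \<and> msubst (\<lambda>v. if v \<in> W then mvar v else 0) p = 0"
  by (auto simp: face_ideal_def poly_mapping_eq_iff fun_eq_iff lookup_msubst_restrict in_keys_iff)

text \<open>The order on the variables induces one on monomials that is compatible with
  multiplication; comparing leading terms shows that the polynomials have no zero divisors, which is
  applied to the restrictions to \<open>W\<close>.\<close>

lemma face_ideal_prime:
  fixes p q :: "('v::linorder, 'k::field) mpoly"
  assumes "p \<in> polys V" "q \<in> polys V" "p * q \<in> face_ideal V W"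
  shows "p \<in> face_ideal V W \<or> q \<in> face_ideal V W"
  using assms by (simp add: face_ideal_iff_msubst)

section \<open>Algebra isomorphisms and face ideals\<close>

definition val :: "('v \<Rightarrow> 'k) \<Rightarrow> ('v, 'k::field) mpoly \<Rightarrow> 'k" where
  "val = coeff_hom.meval (\<lambda>c. c)"

text \<open>Directional derivative at \<open>a\<close> in direction \<open>b\<close>, read off from \<open>p (a + t b)\<close>.\<close>

definition dir_deriv :: "('v \<Rightarrow> 'k) \<Rightarrow> ('v \<Rightarrow> 'k) \<Rightarrow> ('v, 'k::field) mpoly \<Rightarrow> 'k" where
  "dir_deriv a b p = coeff (coeff_hom.meval (\<lambda>c. [:c:]) (\<lambda>v. [:a v, b v:]) p) 1"

lemmas val_simps [simp] =
  coeff_hom.meval_mconst[OF coeff_hom_id, folded val_def]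
  coeff_hom.meval_mvar[OF coeff_hom_id, folded val_def]
  coeff_hom.meval_add[OF coeff_hom_id, folded val_def]
  coeff_hom.meval_diff[OF coeff_hom_id, folded val_def]
  coeff_hom.meval_mult[OF coeff_hom_id, folded val_def]

lemma coeff_0_meval:
  fixes p :: "('v, 'k::field) mpoly"
  shows "coeff (coeff_hom.meval (\<lambda>c. [:c:]) (\<lambda>v. [:a v, b v:]) p) 0 = val a p"
proof -
  interpret coeff_hom "\<lambda>c::'k. [:c:]" by (rule coeff_hom_pCons)
  show ?thesis
    by (induction p rule: polys_induct[OF polys_UNIV]) (simp_all add: meval_add meval_mult coeff_mult)
qed

lemma dir_deriv_simps [simp]:
  fixes p q :: "('v, 'k::field) mpoly"
  shows "dir_deriv a b (mconst c) = 0"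
  "dir_deriv a b (mvar v) = b v"
  "dir_deriv a b (p + q) = dir_deriv a b p + dir_deriv a b q"
  "dir_deriv a b (p - q) = dir_deriv a b p - dir_deriv a b q"
  "dir_deriv a b (p * q) = val a p * dir_deriv a b q + dir_deriv a b p * val a q"
proof -
  interpret coeff_hom "\<lambda>c::'k. [:c:]" by (rule coeff_hom_pCons)
  show "dir_deriv a b (p * q) = val a p * dir_deriv a b q + dir_deriv a b p * val a q"
    by (simp add: dir_deriv_def meval_mult coeff_mult coeff_0_meval)
qed (simp_all add: dir_deriv_def coeff_hom.meval_add coeff_hom.meval_diff coeff_hom.meval_mconst
    coeff_hom.meval_mvar coeff_hom_pCons)

lemma dir_deriv_sum: "dir_deriv a b (sum f A) = (\<Sum>i\<in>A. dir_deriv a b (f i))"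
  using dir_deriv_simps(1)[of a b 0]
  by (induction A rule: infinite_finite_induct) (simp_all add: mconst_simps)

lemma val_face_ideal:
  assumes "p \<in> face_ideal V W" "\<And>v. v \<notin> W \<Longrightarrow> a v = 0"
  shows "val a p = 0"
  unfolding val_def
proof (rule coeff_hom.meval_eq_0[OF coeff_hom_id])
  fix m assume "m \<in> Poly_Mapping.keys p"
  then obtain v where "v \<in> Poly_Mapping.keys m" "v \<notin> W" using assms(1) by (auto simp: face_ideal_def)
  then show "\<exists>v\<in>Poly_Mapping.keys m. a v = 0" using assms(2) by blast
qed

text \<open>Both \<open>a\<close> and \<open>b\<close> lie in the coordinate subspace belonging to
  \<open>W\<close>, hence so does the whole line through \<open>a\<close> in direction
  \<open>b\<close>, and the ideal vanishes along it.\<close>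

lemma dir_deriv_face_ideal:
  assumes "p \<in> face_ideal V W" "\<And>v. v \<notin> W \<Longrightarrow> a v = 0" "\<And>v. v \<notin> W \<Longrightarrow> b v = 0"
  shows "dir_deriv a b p = 0"
proof -
  have "coeff_hom.meval (\<lambda>c. [:c:]) (\<lambda>v. [:a v, b v:]) p = 0"
  proof (rule coeff_hom.meval_eq_0[OF coeff_hom_pCons])
    fix m assume "m \<in> Poly_Mapping.keys p"
    then obtain v where "v \<in> Poly_Mapping.keys m" "v \<notin> W" using assms(1) by (auto simp: face_ideal_def)
    then show "\<exists>v\<in>Poly_Mapping.keys m. [:a v, b v:] = 0" using assms(2,3) by (intro bexI[of _ v]) simp_all
  qed
  then show ?thesis by (simp add: dir_deriv_def)
qed

text \<open>The identity matrix on \<open>M\<close> factors through \<open>N\<close>, so this is a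
  bound on a rank. It is obtained by exchange: the linear forms \<open>mvar i\<close> for
  \<open>i \<in> M\<close> are independent and lie in the span of the forms \<open>row j\<close> for
  \<open>j \<in> N\<close>. Polynomials merely provide a vector space with a basis indexed by an
  arbitrary type.\<close>

lemma card_le_if_left_inverse:
  fixes A :: "'i \<Rightarrow> 'j \<Rightarrow> 'k::field" and B :: "'j \<Rightarrow> 'i \<Rightarrow> 'k"
  assumes fin: "finite M" "finite N"
    and inv: "\<And>i k. i \<in> M \<Longrightarrow> k \<in> M \<Longrightarrow> (\<Sum>j\<in>N. A i j * B j k) = (if i = k then 1 else 0)"
  shows "card M \<le> card N"
proof -
  interpret vector_space "\<lambda>c (p :: ('i, 'k) mpoly). mconst c * p"
    by unfold_locales (simp_all add: mconst_simps algebra_simps)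
  define row :: "'j \<Rightarrow> ('i, 'k) mpoly" where "row j = (\<Sum>k\<in>M. mconst (B j k) * mvar k)" for j
  have mconst_sum: "mconst (sum f S) = (\<Sum>j\<in>S. mconst (f j) :: ('i, 'k) mpoly)" for f :: "'j \<Rightarrow> 'k" and S
    by (induction S rule: infinite_finite_induct) (simp_all add: mconst_simps)
  have mvar: "mvar i \<in> span (row ` N)" if i: "i \<in> M" for i
  proof -
    have "(\<Sum>j\<in>N. mconst (A i j) * row j) = (\<Sum>j\<in>N. \<Sum>k\<in>M. mconst (A i j * B j k) * mvar k)"
      by (simp only: row_def scale_sum_right scale_scale)
    also have "\<dots> = (\<Sum>k\<in>M. \<Sum>j\<in>N. mconst (A i j * B j k) * mvar k)" by (rule sum.swap)
    also have "\<dots> = (\<Sum>k\<in>M. mconst (\<Sum>j\<in>N. A i j * B j k) * mvar k)"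
      by (simp only: mconst_sum sum_distrib_right)
    also have "\<dots> = (\<Sum>k\<in>M. if i = k then mvar k else 0)"
      by (intro sum.cong) (simp_all add: inv i mconst_simps)
    also have "\<dots> = mvar i" using fin i by simp
    finally have "mvar i = (\<Sum>j\<in>N. mconst (A i j) * row j)" ..
    moreover have "\<dots> \<in> span (row ` N)" by (intro span_sum span_scale span_base imageI)
    ultimately show ?thesis by simp
  qed
  have inj: "inj_on (mvar :: 'i \<Rightarrow> ('i, 'k) mpoly) M"
  proof (rule inj_onI)
    fix i k assume "mvar i = (mvar k :: ('i, 'k) mpoly)"
    then have "dir_deriv (\<lambda>_. 0) (\<lambda>v. if v = i then 1 else 0 :: 'k) (mvar i) =
        dir_deriv (\<lambda>_. 0) (\<lambda>v. if v = i then 1 else 0) (mvar k)" by simp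
    then show "i = k" by (simp split: if_splits)
  qed
  have "independent (mvar ` M)"
    unfolding dependent_finite[OF finite_imageI[OF fin(1)]]
  proof (intro notI, elim exE conjE bexE)
    fix u :: "('i, 'k) mpoly \<Rightarrow> 'k" and p
    assume p: "p \<in> mvar ` M" "u p \<noteq> 0" and u: "(\<Sum>v\<in>mvar ` M. mconst (u v) * v) = 0"
    then obtain i where i: "i \<in> M" "p = mvar i" by blast
    \<comment> \<open>The derivative in the direction of the variable \<open>i\<close> reads off the
      coefficient of \<open>mvar i\<close> in a linear form.\<close>
    have "0 = dir_deriv (\<lambda>_. 0) (\<lambda>k. if k = i then 1 else 0) (\<Sum>k\<in>M. mconst (u (mvar k)) * mvar k)"
      using u dir_deriv_simps(1)[of "\<lambda>_::'i. 0::'k" _ 0] by (simp add: sum.reindex[OF inj] mconst_simps)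
    also have "\<dots> = (\<Sum>k\<in>M. if k = i then u (mvar k) else 0)"
      unfolding dir_deriv_sum by (intro sum.cong) simp_all
    also have "\<dots> = u p" using i fin by simp
    finally show False using p by simp
  qed
  from independent_span_bound[OF finite_imageI[OF fin(2)] this]
  have "card (mvar ` M :: ('i, 'k) mpoly set) \<le> card (row ` N)" using mvar by blast
  also have "\<dots> \<le> card N" by (rule card_image_le[OF fin(2)])
  finally show ?thesis by (simp add: card_image[OF inj])
qed

text \<open>A lift to polynomials of an algebra homomorphism between the quotients by
  \<open>I1\<close> and \<open>I2\<close>. Representatives are chosen arbitrarily, so the operations
  are respected only up to \<open>I2\<close>.\<close>

locale mod_hom =
  fixes V1 :: "'v set" and I1 :: "('v, 'k::field) mpoly set"
    and V2 :: "'w set" and I2 :: "('w, 'k) mpoly set" and \<Phi>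
  assumes polys: "f \<in> polys V1 \<Longrightarrow> \<Phi> f \<in> polys V2"
    and add: "f \<in> polys V1 \<Longrightarrow> g \<in> polys V1 \<Longrightarrow> \<Phi> (f + g) - (\<Phi> f + \<Phi> g) \<in> I2"
    and mult: "f \<in> polys V1 \<Longrightarrow> g \<in> polys V1 \<Longrightarrow> \<Phi> (f * g) - \<Phi> f * \<Phi> g \<in> I2"
    and mconst: "\<Phi> (mconst c) - mconst c \<in> I2"
    and zero: "f \<in> I1 \<Longrightarrow> \<Phi> f \<in> I2"

text \<open>The ideal of an intersection is the sum of the ideals of the \<open>F j\<close>: every
  monomial of \<open>f\<close> involves a variable outside some \<open>F j\<close> and therefore
  lies in that ideal already. It remains to add up the images of the terms, each sum being correct
  up to \<open>I2\<close>.\<close>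

lemma (in mod_hom) hom_face_ideal_Inter:
  assumes f: "f \<in> face_ideal V1 (\<Inter>j\<in>J. F j)"
    and m: "\<And>j f. j \<in> J \<Longrightarrow> f \<in> face_ideal V1 (F j) \<Longrightarrow> \<Phi> f \<in> face_ideal V2 (G j)"
    and I: "I2 \<subseteq> face_ideal V2 (\<Inter>j\<in>J. G j)"
  shows "\<Phi> f \<in> face_ideal V2 (\<Inter>j\<in>J. G j)"
proof -
  let ?P = "face_ideal V2 (\<Inter>j\<in>J. G j) :: ('w, 'k) mpoly set"
  let ?t = "\<lambda>m. Poly_Mapping.single m (Poly_Mapping.lookup f m)"
  have fV: "f \<in> polys V1" using f by (rule face_ideal_polys)
  have mono: "\<Phi> (?t m) \<in> ?P" if m': "m \<in> Poly_Mapping.keys f" for m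
  proof -
    obtain j where j: "j \<in> J" "\<not> Poly_Mapping.keys m \<subseteq> F j"
      using f m' unfolding face_ideal_def by blast
    then have "?t m \<in> face_ideal V1 (F j)"
      using fV m' by (simp add: face_ideal_def polys_single polys_iff)
    then have "\<Phi> (?t m) \<in> face_ideal V2 (G j)" by (rule m[OF j(1)])
    also have "\<dots> \<subseteq> ?P" by (rule face_ideal_antimono) (use j in blast)
    finally show ?thesis .
  qed
  have zero: "\<Phi> 0 \<in> ?P" using mconst[of 0] I by (auto simp: mconst_simps)
  have "\<Phi> (sum ?t A) \<in> ?P" if "finite A" "A \<subseteq> Poly_Mapping.keys f" for A
    using that
  proof (induction A rule: finite_induct)
    case (insert m A)
    then have s: "\<Phi> (?t m) + \<Phi> (sum ?t A) \<in> ?P" using mono by (intro face_ideal_add) auto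
    have d: "\<Phi> (?t m + sum ?t A) - (\<Phi> (?t m) + \<Phi> (sum ?t A)) \<in> ?P"
      using add[of "?t m" "sum ?t A"] insert.prems I by (auto intro: polys_monomial[OF fV])
    have "\<Phi> (?t m + sum ?t A) \<in> ?P" using face_ideal_add[OF d s] by simp
    then show ?case using insert by simp
  qed (simp add: zero)
  from this[of "Poly_Mapping.keys f"] show ?thesis
    by (simp flip: poly_mapping_sum_singles)
qed

locale mod_iso = mod_hom V1 I1 V2 I2 \<Phi> + inv: mod_hom V2 I2 V1 I1 \<Psi>
  for V1 :: "'v set" and I1 :: "('v, 'k::field) mpoly set"
    and V2 :: "'w set" and I2 :: "('w, 'k) mpoly set" and \<Phi> \<Psi> +
  assumes inv_left: "f \<in> polys V1 \<Longrightarrow> \<Psi> (\<Phi> f) - f \<in> I1"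
    and inv_right: "g \<in> polys V2 \<Longrightarrow> \<Phi> (\<Psi> g) - g \<in> I2"

lemma mod_iso_sym: "mod_iso V1 I1 V2 I2 \<Phi> \<Psi> \<Longrightarrow> mod_iso V2 I2 V1 I1 \<Psi> \<Phi>"
  unfolding mod_iso_def mod_iso_axioms_def by blast

context mod_iso begin

text \<open>If the two ideals contain \<open>I1\<close> and \<open>I2\<close>, this says that they
  correspond under the isomorphism of the quotients. Both inclusions are demanded because the lifts
  \<open>\<Phi>\<close> and \<open>\<Psi>\<close> are inverse to each other only modulo the
  ideals.\<close>

definition matched :: "'v set \<Rightarrow> 'w set \<Rightarrow> bool" where
  "matched F G \<longleftrightarrow> (\<forall>f\<in>face_ideal V1 F. \<Phi> f \<in> face_ideal V2 G) \<and> (\<forall>g\<in>face_ideal V2 G. \<Psi> g \<in> face_ideal V1 F)"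

text \<open>
  If \<open>\<Phi>\<close> and \<open>\<Psi>\<close> match \<open>face_ideal V1 W\<close> with \<open>face_ideal V2 W'\<close>, the quotients, polynomial
  rings in the variables \<open>W\<close> and \<open>W'\<close>, are isomorphic, and the tangent spaces at corresponding
  points have the same dimension.  The two Jacobians are inverse to each other by the chain rule.
\<close>

lemma card_le_if_matched:
  assumes fin: "finite W" "finite W'" and W: "W \<subseteq> V1" "W' \<subseteq> V2"
    and I: "I1 \<subseteq> face_ideal V1 W" "I2 \<subseteq> face_ideal V2 W'" and m: "matched W W'"
  shows "card W \<le> card W'"
proof -
  note Phi_add = add and Phi_mult = mult
  \<comment> \<open>The point to which the origin of the second space pulls back; it need not be the
    origin. Its coordinates outside \<open>W\<close> are zero, in accordance with
    \<open>\<Phi>\<close> sending those variables into \<open>face_ideal V2 W'\<close>.\<close>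
  define a where "a v = (if v \<in> W then val (\<lambda>_. 0) (\<Phi> (mvar v)) else 0)" for v
  define e where "e i = (\<lambda>k. if k = i then 1 else 0 :: 'k)" for i :: 'v
  define e' where "e' j = (\<lambda>k. if k = j then 1 else 0 :: 'k)" for j :: 'w
  have a: "a v = 0" if "v \<notin> W" for v using that by (simp add: a_def)
  have val2: "val (\<lambda>_. 0) p = val (\<lambda>_. 0) q" if "p - q \<in> I2" for p q
    using val_face_ideal[of "p - q" V2 W' "\<lambda>_. 0"] that I by auto
  have val_\<Phi>: "val (\<lambda>_. 0) (\<Phi> f) = val a f" if "f \<in> polys V1" for f
    using that
  proof (induction rule: polys_induct)
    case (const c)
    show ?case using val2[OF mconst[of c]] by simp
  next
    case (add p q)
    then show ?case using val2[OF Phi_add[of p q]] by simp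
  next
    case (mvar v p)
    have "val (\<lambda>_. 0) (\<Phi> (mvar v)) = a v"
    proof (cases "v \<in> W")
      case False
      then have "\<Phi> (mvar v) \<in> face_ideal V2 W'" using m mvar(1) by (simp add: matched_def)
      then show ?thesis using False by (simp add: a_def val_face_ideal)
    qed (simp add: a_def)
    then show ?case using mvar val2[OF Phi_mult[of "mvar v" p]] by simp
  qed
  have val_\<Psi>: "val a (\<Psi> g) = val (\<lambda>_. 0) g" if "g \<in> polys V2" for g
    using val_\<Phi>[OF inv.polys[OF that]] val2[OF inv_right[OF that]] by simp
  \<comment> \<open>Since \<open>a\<close> and \<open>e i\<close> with \<open>i \<in> W\<close> lie
    in the subspace on which \<open>I1\<close> vanishes, the derivative depends only on the class
    modulo \<open>I1\<close>.\<close>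
  have deriv: "dir_deriv a (e i) p = dir_deriv a (e i) q" if "p - q \<in> I1" "i \<in> W" for p q i
  proof -
    have "dir_deriv a (e i) (p - q) = 0"
      by (rule dir_deriv_face_ideal[of _ V1 W]) (use that I a in \<open>auto simp: e_def\<close>)
    then show ?thesis by simp
  qed
  \<comment> \<open>The chain rule at the origin. The sum runs over \<open>W'\<close> only, as for
    any other variable \<open>\<Psi> (mvar v)\<close> lies in \<open>face_ideal V1 W\<close> and has
    derivative zero at \<open>a\<close> along \<open>e i\<close>.\<close>
  have deriv_\<Psi>: "dir_deriv a (e i) (\<Psi> g) =
      (\<Sum>j\<in>W'. dir_deriv a (e i) (\<Psi> (mvar j)) * dir_deriv (\<lambda>_. 0) (e' j) g)"
    if "g \<in> polys V2" and i: "i \<in> W" for g i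
    using that(1)
  proof (induction rule: polys_induct)
    case (const c)
    show ?case using deriv[OF inv.mconst[of c] i] by simp
  next
    case (add p q)
    then show ?case using deriv[OF inv.add[of p q] i] by (simp add: distrib_left sum.distrib)
  next
    case (mvar v p)
    have "dir_deriv a (e i) (\<Psi> (mvar v * p)) = dir_deriv a (e i) (\<Psi> (mvar v)) * val (\<lambda>_. 0) p"
      using deriv[OF inv.mult[of "mvar v" p] i] mvar(1,2) by (simp add: val_\<Psi>)
    also have "\<dots> = (\<Sum>j\<in>W'. if j = v then dir_deriv a (e i) (\<Psi> (mvar j)) * val (\<lambda>_. 0) p else 0)"
    proof (cases "v \<in> W'")
      case False
      then have "\<Psi> (mvar v) \<in> face_ideal V1 W" using m mvar(1) by (simp add: matched_def)
      then have "dir_deriv a (e i) (\<Psi> (mvar v)) = 0"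
        using a i by (intro dir_deriv_face_ideal[of _ V1 W]) (auto simp: e_def)
      then show ?thesis using fin(2) False by simp
    qed (use fin(2) in simp)
    also have "\<dots> = (\<Sum>j\<in>W'. dir_deriv a (e i) (\<Psi> (mvar j)) * dir_deriv (\<lambda>_. 0) (e' j) (mvar v * p))"
      by (intro sum.cong) (auto simp: e'_def)
    finally show ?case .
  qed
  show ?thesis
  proof (rule card_le_if_left_inverse[OF fin])
    fix i k assume ik: "i \<in> W" "k \<in> W"
    then have k: "mvar k \<in> (polys V1 :: ('v, 'k) mpoly set)" using W by auto
    have "(\<Sum>j\<in>W'. dir_deriv a (e i) (\<Psi> (mvar j)) * dir_deriv (\<lambda>_. 0) (e' j) (\<Phi> (mvar k)))
        = dir_deriv a (e i) (\<Psi> (\<Phi> (mvar k)))"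
      using deriv_\<Psi>[OF polys[OF k] ik(1)] by simp
    also have "\<dots> = dir_deriv a (e i) (mvar k)" by (rule deriv[OF inv_left[OF k] ik(1)])
    also have "\<dots> = (if i = k then 1 else 0)" by (auto simp: e_def)
    finally show "(\<Sum>j\<in>W'. dir_deriv a (e i) (\<Psi> (mvar j)) * dir_deriv (\<lambda>_. 0) (e' j) (\<Phi> (mvar k)))
        = (if i = k then 1 else 0)" .
  qed
qed

lemma matched_Inter:
  assumes m: "\<And>j. j \<in> J \<Longrightarrow> matched (F j) (G j)"
    and I: "I1 \<subseteq> face_ideal V1 (\<Inter>j\<in>J. F j)" "I2 \<subseteq> face_ideal V2 (\<Inter>j\<in>J. G j)"
  shows "matched (\<Inter>j\<in>J. F j) (\<Inter>j\<in>J. G j)"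
  unfolding matched_def
proof (intro conjI ballI)
  show "\<Phi> f \<in> face_ideal V2 (\<Inter>j\<in>J. G j)" if "f \<in> face_ideal V1 (\<Inter>j\<in>J. F j)" for f
    using hom_face_ideal_Inter[OF that _ I(2)] m by (simp add: matched_def)
  show "\<Psi> g \<in> face_ideal V1 (\<Inter>j\<in>J. F j)" if "g \<in> face_ideal V2 (\<Inter>j\<in>J. G j)" for g
    using inv.hom_face_ideal_Inter[OF that _ I(1)] m by (simp add: matched_def)
qed

end

section \<open>Squarefree monomial ideals and their minimal primes\<close>

definition squarefree_ideal :: "'v set \<Rightarrow> 'v set set \<Rightarrow> ('v, 'k::field) mpoly set" where
  "squarefree_ideal V \<G> = genideal (polynomial_ring V) {\<Prod>i\<in>G. mvar i |G. G \<in> \<G>}"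

text \<open>The complex with Stanley-Reisner ideal \<open>squarefree_ideal V \<G>\<close>, up to the
  variables that lie in this ideal themselves. Those vertices must leave the ground set, since
  singletons of the ground set have to be faces; the polynomial ring keeps all of
  \<open>V\<close>.\<close>

definition independence_complex :: "'v set \<Rightarrow> 'v set set \<Rightarrow> 'v set_system" where
  "independence_complex V \<G> =
     Set_System {v \<in> V. \<forall>G\<in>\<G>. \<not> G \<subseteq> {v}} {F. F \<subseteq> V \<and> (\<forall>G\<in>\<G>. \<not> G \<subseteq> F)}"

lemma simplicial_complex_independence_complex: "simplicial_complex (independence_complex V \<G>)"
  unfolding simplicial_complex_def independence_complex_def by auto

lemma finite_ground_independence_complex: "finite V \<Longrightarrow> finite (ground (independence_complex V \<G>))"
  by (simp add: independence_complex_def)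

lemma prod_mvar_polys: "G \<subseteq> V \<Longrightarrow> (\<Prod>i\<in>G. mvar i) \<in> polys V"
  by (intro polys_prod) auto

lemma squarefree_generators: "\<Union>\<G> \<subseteq> V \<Longrightarrow> {\<Prod>i\<in>G. mvar i |G. G \<in> \<G>} \<subseteq> polys V"
  by (auto intro: prod_mvar_polys)

lemma ideal_squarefree_ideal: "\<Union>\<G> \<subseteq> V \<Longrightarrow> ideal (squarefree_ideal V \<G>) (polynomial_ring V)"
  unfolding squarefree_ideal_def
  by (intro ring.genideal_ideal squarefree_generators cring.axioms(1) cring_polynomial_ring)

lemma squarefree_ideal_minimal:
  assumes "ideal J (polynomial_ring V)" "\<And>G. G \<in> \<G> \<Longrightarrow> (\<Prod>i\<in>G. mvar i) \<in> J"
  shows "squarefree_ideal V \<G> \<subseteq> J"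
  unfolding squarefree_ideal_def
  using cring_polynomial_ring assms by (intro ring.genideal_minimal cring.axioms(1)) auto

lemma prod_mvar_face_ideal:
  assumes "finite G" "G \<subseteq> V" "\<not> G \<subseteq> W"
  shows "(\<Prod>i\<in>G. mvar i) \<in> face_ideal V W"
proof -
  obtain v where v: "v \<in> G" "v \<notin> W" using assms by blast
  then have "mvar v * (\<Prod>i\<in>G - {v}. mvar i) \<in> face_ideal V W"
    using assms by (intro face_ideal_mult2 prod_mvar_polys) auto
  then show ?thesis using v assms(1) by (simp add: prod.remove)
qed

lemma squarefree_ideal_face_ideal:
  assumes "finite V" "\<Union>\<G> \<subseteq> V" "F \<in> faces (independence_complex V \<G>)"
  shows "squarefree_ideal V \<G> \<subseteq> face_ideal V F"
proof (rule squarefree_ideal_minimal[OF ideal_face_ideal])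
  fix G assume "G \<in> \<G>"
  then show "(\<Prod>i\<in>G. mvar i) \<in> face_ideal V F"
    using assms by (intro prod_mvar_face_ideal) (auto simp: independence_complex_def intro: finite_subset)
qed

lemma prod_mvar_squarefree_ideal:
  fixes V :: "'v set"
  assumes "finite V" "\<Union>\<G> \<subseteq> V" "F \<subseteq> V" "F \<notin> faces (independence_complex V \<G>)"
  shows "(\<Prod>i\<in>F. mvar i) \<in> (squarefree_ideal V \<G> :: ('v, 'k::field) mpoly set)"
proof -
  interpret ideal "squarefree_ideal V \<G> :: ('v, 'k) mpoly set" "polynomial_ring V" by (rule ideal_squarefree_ideal[OF assms(2)])
  obtain G where G: "G \<in> \<G>" "G \<subseteq> F" using assms by (auto simp: independence_complex_def)
  have "(\<Prod>i\<in>G. mvar i) \<in> (squarefree_ideal V \<G> :: ('v, 'k) mpoly set)"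
    using genideal_self[OF squarefree_generators[OF assms(2)]] G(1)
    unfolding squarefree_ideal_def by blast
  then have "(\<Prod>i\<in>F - G. mvar i) * (\<Prod>i\<in>G. mvar i) \<in> (squarefree_ideal V \<G> :: ('v, 'k) mpoly set)"
    using I_l_closed prod_mvar_polys[of "F - G" V] assms(3) by auto
  then show ?thesis
    using prod.subset_diff[OF G(2), of "mvar :: 'v \<Rightarrow> ('v, 'k) mpoly"] assms(1,3)
    by (simp add: finite_subset)
qed

text \<open>The vertices whose variables avoid \<open>Q\<close> form a face: by primality their
  product avoids \<open>Q\<close> as well, whereas products over nonfaces lie in the squarefree
  ideal. Any facet above this face works, because all variables outside it lie in \<open>Q\<close>.
  Membership in \<open>polys V\<close> is required separately, as \<open>Q\<close> will be a
  preimage condition that holds vacuously for other polynomials.\<close>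

lemma prime_contains_face_ideal:
  fixes Q :: "('v, 'k::field) mpoly set"
  assumes fin: "finite V" and \<G>: "\<Union>\<G> \<subseteq> V" and I: "squarefree_ideal V \<G> \<subseteq> Q"
    and add: "\<And>p q. p \<in> Q \<Longrightarrow> q \<in> Q \<Longrightarrow> p \<in> polys V \<Longrightarrow> q \<in> polys V \<Longrightarrow> p + q \<in> Q"
    and mult: "\<And>p q. p \<in> polys V \<Longrightarrow> q \<in> Q \<Longrightarrow> q \<in> polys V \<Longrightarrow> p * q \<in> Q"
    and prime: "\<And>p q. p \<in> polys V \<Longrightarrow> q \<in> polys V \<Longrightarrow> p * q \<in> Q \<Longrightarrow> p \<in> Q \<or> q \<in> Q"
    and one: "1 \<notin> Q" and zero: "0 \<in> Q"
  obtains F where "F \<in> facets (independence_complex V \<G>)" "face_ideal V F \<subseteq> Q"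
proof -
  define F0 where "F0 = {v \<in> V. mvar v \<notin> Q}"
  have "(\<Prod>i\<in>F. mvar i) \<notin> Q" if "finite F" "F \<subseteq> F0" for F
    using that
  proof (induction F rule: finite_induct)
    case (insert v F)
    then have "mvar v * (\<Prod>i\<in>F. mvar i) \<notin> Q"
      using prime[of "mvar v" "\<Prod>i\<in>F. mvar i"] prod_mvar_polys[of F V] by (auto simp: F0_def)
    then show ?case using insert by simp
  qed (use one in simp)
  moreover have F0: "F0 \<subseteq> V" "finite F0" using fin by (auto simp: F0_def)
  ultimately have "F0 \<in> faces (independence_complex V \<G>)"
    using prod_mvar_squarefree_ideal[OF fin \<G> F0(1)] I by blast
  with face_subset_facet[OF finite_ground_independence_complex[OF fin]
      faces_subset_ground[OF simplicial_complex_independence_complex]]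
  obtain F where F: "F \<in> facets (independence_complex V \<G>)" "F0 \<subseteq> F" by blast
  have single: "Poly_Mapping.single m c \<in> Q" if m: "Poly_Mapping.keys m \<subseteq> V" "\<not> Poly_Mapping.keys m \<subseteq> F" for m c
  proof -
    obtain v where v: "v \<in> Poly_Mapping.keys m" "v \<notin> F" using m by blast
    obtain m' where m': "m = Poly_Mapping.single v 1 + m'" "Poly_Mapping.keys m' \<subseteq> Poly_Mapping.keys m"
      using single_eq_mvar_mult[OF v(1)] by metis
    have "Poly_Mapping.single m' c * mvar v \<in> Q"
      using v m m'(2) F(2) by (intro mult polys_single) (auto simp: F0_def)
    then show ?thesis unfolding m'(1) mvar_mult_single[symmetric] by (simp add: mult.commute)
  qed
  have "face_ideal V F \<subseteq> Q"
  proof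
    fix p :: "('v, 'k) mpoly" assume p: "p \<in> face_ideal V F"
    have "(\<Sum>m\<in>A. Poly_Mapping.single m (Poly_Mapping.lookup p m)) \<in> Q" if "finite A" "A \<subseteq> Poly_Mapping.keys p" for A
      using that
    proof (induction A rule: finite_induct)
      case (insert m A)
      have "Poly_Mapping.single m (Poly_Mapping.lookup p m) + (\<Sum>m\<in>A. Poly_Mapping.single m (Poly_Mapping.lookup p m)) \<in> Q"
        using insert p by (intro add single polys_sum polys_single) (auto simp: face_ideal_def polys_iff)
      then show ?case using insert by simp
    qed (simp add: zero)
    from this[of "Poly_Mapping.keys p"] show "p \<in> Q" by (simp flip: poly_mapping_sum_singles)
  qed
  with F(1) show ?thesis by (rule that)
qed

section \<open>Bijections from the sizes of intersections\<close>

lemma card_fibres_eq_imp_bij: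
  assumes "finite A" "finite B" "\<And>t. card {a \<in> A. p a = t} = card {b \<in> B. q b = t}"
  obtains f where "bij_betw f A B" "\<And>a. a \<in> A \<Longrightarrow> q (f a) = p a"
proof -
  have "\<exists>g. bij_betw g {a \<in> A. p a = t} {b \<in> B. q b = t}" for t
    using assms by (intro finite_same_card_bij) auto
  then obtain g where g: "\<And>t. bij_betw (g t) {a \<in> A. p a = t} {b \<in> B. q b = t}" by metis
  define f where "f a = g (p a) a" for a
  have f: "f a \<in> B" "q (f a) = p a" if "a \<in> A" for a
    using bij_betwE[OF g[of "p a"]] that by (auto simp: f_def)
  have "bij_betw f A B"
    unfolding bij_betw_def
  proof (intro conjI inj_onI equalityI subsetI)
    fix a a' assume a: "a \<in> A" "a' \<in> A" "f a = f a'"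
    then have p: "p a = p a'" using f(2)[OF a(1)] f(2)[OF a(2)] by simp
    show "a = a'"
      using bij_betw_imp_inj_on[OF g[of "p a"]] a p by (auto simp: f_def inj_on_def)
  next
    fix b assume "b \<in> B"
    then have "b \<in> g (q b) ` {a \<in> A. p a = q b}" using g[of "q b"] by (simp add: bij_betw_def)
    then obtain a where "a \<in> A" "p a = q b" "b = g (q b) a" by blast
    then show "b \<in> f ` A" by (intro image_eqI[of _ _ a]) (simp_all add: f_def)
  qed (use f in auto)
  then show ?thesis using f(2) by (rule that)
qed

text \<open>
  By downward induction on \<open>J\<close>, the points lying in exactly the sets indexed by \<open>J\<close> are
  counted by inclusion-exclusion.
\<close>

lemma card_Inter_eq_imp_bij:
  fixes A :: "'i \<Rightarrow> 'a set" and B :: "'i \<Rightarrow> 'b set"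
  assumes I: "finite I" and A: "\<And>i. i \<in> I \<Longrightarrow> finite (A i)" and B: "\<And>i. i \<in> I \<Longrightarrow> finite (B i)"
    and card: "\<And>J. J \<subseteq> I \<Longrightarrow> J \<noteq> {} \<Longrightarrow> card (\<Inter>i\<in>J. A i) = card (\<Inter>i\<in>J. B i)"
  obtains f where "bij_betw f (\<Union>i\<in>I. A i) (\<Union>i\<in>I. B i)"
    "\<And>i v. i \<in> I \<Longrightarrow> v \<in> (\<Union>i\<in>I. A i) \<Longrightarrow> f v \<in> B i \<longleftrightarrow> v \<in> A i"
proof -
  define p where "p v = {i \<in> I. v \<in> A i}" for v
  define q where "q w = {i \<in> I. w \<in> B i}" for w
  have partition: "card (\<Inter>i\<in>J. C i) = (\<Sum>K | J \<subseteq> K \<and> K \<subseteq> I. card {v \<in> \<Union>i\<in>I. C i. {i \<in> I. v \<in> C i} = K})"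
    if J: "J \<subseteq> I" "J \<noteq> {}" and C: "\<And>i. i \<in> I \<Longrightarrow> finite (C i)" for J and C :: "'i \<Rightarrow> 'c set"
  proof -
    \<comment> \<open>That \<open>J\<close> is nonempty places the intersection inside the union of
      all \<open>C i\<close>.\<close>
    have "(\<Inter>i\<in>J. C i) = (\<Union>K\<in>{K. J \<subseteq> K \<and> K \<subseteq> I}. {v \<in> \<Union>i\<in>I. C i. {i \<in> I. v \<in> C i} = K})"
      using J by blast
    also have "card \<dots> = (\<Sum>K | J \<subseteq> K \<and> K \<subseteq> I. card {v \<in> \<Union>i\<in>I. C i. {i \<in> I. v \<in> C i} = K})"
      using I C by (intro card_UN_disjoint) auto
    finally show ?thesis .
  qed
  have exact: "card {v \<in> \<Union>i\<in>I. A i. p v = J} = card {w \<in> \<Union>i\<in>I. B i. q w = J}"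
    if J: "J \<subseteq> I" "J \<noteq> {}" for J
    using J
  proof (induction "card (I - J)" arbitrary: J rule: less_induct)
    case less
    let ?S = "{K. J \<subseteq> K \<and> K \<subseteq> I}"
    let ?a = "\<lambda>K. card {v \<in> \<Union>i\<in>I. A i. p v = K}" and ?b = "\<lambda>K. card {w \<in> \<Union>i\<in>I. B i. q w = K}"
    have fin: "finite ?S" using I by (auto intro: finite_subset[of _ "Pow I"])
    have JS: "J \<in> ?S" using less by simp
    have "(\<Sum>K\<in>?S. ?a K) = (\<Sum>K\<in>?S. ?b K)"
      using partition[OF less.prems, of A] partition[OF less.prems, of B] card[OF less.prems] A B
      by (simp add: p_def q_def)
    \<comment> \<open>Patterns strictly larger than \<open>J\<close> have smaller complements in
      \<open>I\<close>; by induction their terms agree on both sides and cancel, leaving the term of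
      \<open>J\<close>.\<close>
    moreover have "(\<Sum>K\<in>?S - {J}. ?a K) = (\<Sum>K\<in>?S - {J}. ?b K)"
    proof (intro sum.cong refl less.hyps)
      fix K assume K: "K \<in> ?S - {J}"
      then have "I - K \<subset> I - J" by blast
      then show "card (I - K) < card (I - J)" using I by (intro psubset_card_mono) auto
    qed (use less.prems in auto)
    ultimately show ?case using sum.remove[OF fin JS, of ?a] sum.remove[OF fin JS, of ?b] by simp
  qed
  have "card {v \<in> \<Union>i\<in>I. A i. p v = J} = card {w \<in> \<Union>i\<in>I. B i. q w = J}" for J
  proof (cases "J \<subseteq> I \<and> J \<noteq> {}")
    case False
    then have "{v \<in> \<Union>i\<in>I. A i. p v = J} = {}" "{w \<in> \<Union>i\<in>I. B i. q w = J} = {}"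
      by (auto simp: p_def q_def)
    then show ?thesis by (simp only: card.empty)
  qed (use exact in blast)
  moreover have "finite (\<Union>i\<in>I. A i)" "finite (\<Union>i\<in>I. B i)" using I A B by auto
  ultimately obtain f where f: "bij_betw f (\<Union>i\<in>I. A i) (\<Union>i\<in>I. B i)" "\<And>v. v \<in> (\<Union>i\<in>I. A i) \<Longrightarrow> q (f v) = p v"
    using card_fibres_eq_imp_bij[of "\<Union>i\<in>I. A i" "\<Union>i\<in>I. B i" p q] by metis
  have "f v \<in> B i \<longleftrightarrow> v \<in> A i" if "i \<in> I" "v \<in> (\<Union>i\<in>I. A i)" for i v
    using f(2)[OF that(2)] that(1) by (auto simp: p_def q_def)
  with f(1) show ?thesis by (rule that)
qed

lemma faces_independence_complex_mono:
  "F \<in> faces (independence_complex V \<G>) \<Longrightarrow> E \<subseteq> F \<Longrightarrow> E \<in> faces (independence_complex V \<G>)"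
  unfolding independence_complex_def by (auto dest: subset_trans)

lemma facet_independence_complex_subset:
  "F \<in> facets (independence_complex V \<G>) \<Longrightarrow> F \<subseteq> V"
  by (auto simp: facets_def independence_complex_def)

lemma Union_facets:
  assumes "finite (ground X)" "simplicial_complex X"
  shows "\<Union>(facets X) = ground X"
proof -
  have "v \<in> \<Union>(facets X)" if "v \<in> ground X" for v
  proof -
    have "{v} \<in> faces X" using assms(2) that by (simp add: simplicial_complex_def)
    then show ?thesis using faces_eq_subsets_facets[OF assms] by auto
  qed
  moreover have "F \<subseteq> ground X" if "F \<in> facets X" for F
    using that faces_subset_ground[OF assms(2)] by (auto simp: facets_def)
  ultimately show ?thesis by blast
qed

text \<open>The preimage of a prime is a prime containing the squarefree ideal, and hence contains
  the ideal of a facet.\<close>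

lemma mod_hom_facet_preimage:
  fixes V1 :: "'v set" and V2 :: "'w::linorder set" and \<Phi> :: "('v, 'k::field) mpoly \<Rightarrow> ('w, 'k) mpoly"
  assumes hom: "mod_hom V1 (squarefree_ideal V1 \<G>) V2 I2 \<Phi>"
    and fin: "finite V1" and \<G>: "\<Union>\<G> \<subseteq> V1" and I: "I2 \<subseteq> face_ideal V2 W"
  obtains F where "F \<in> facets (independence_complex V1 \<G>)"
    "\<And>f. f \<in> face_ideal V1 F \<Longrightarrow> \<Phi> f \<in> face_ideal V2 W"
proof -
  interpret mod_hom V1 "squarefree_ideal V1 \<G>" V2 I2 \<Phi> by (rule hom)
  let ?P = "face_ideal V2 W :: ('w, 'k) mpoly set"
  have cong: "p \<in> ?P \<longleftrightarrow> q \<in> ?P" if "p - q \<in> I2" for p q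
    using face_ideal_add[of "p - q" V2 W q] face_ideal_diff[of p V2 W "p - q"] that I by auto
  define Q where "Q = {p. p \<in> polys V1 \<longrightarrow> \<Phi> p \<in> ?P}"
  obtain F where F: "F \<in> facets (independence_complex V1 \<G>)" "face_ideal V1 F \<subseteq> Q"
  proof (rule prime_contains_face_ideal[OF fin \<G>])
    show "squarefree_ideal V1 \<G> \<subseteq> Q" using zero I by (auto simp: Q_def)
    show "p + q \<in> Q" if "p \<in> Q" "q \<in> Q" "p \<in> polys V1" "q \<in> polys V1" for p q
      using that cong[OF add] face_ideal_add by (auto simp: Q_def)
    show "p * q \<in> Q" if "p \<in> polys V1" "q \<in> Q" "q \<in> polys V1" for p q
      using that cong[OF mult] face_ideal_mult[of "\<Phi> q" V2 W "\<Phi> p"] polys by (auto simp: Q_def)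
    show "p \<in> Q \<or> q \<in> Q" if "p \<in> polys V1" "q \<in> polys V1" "p * q \<in> Q" for p q
      using that cong[OF mult] face_ideal_prime[of "\<Phi> p" V2 "\<Phi> q" W] polys by (auto simp: Q_def)
    show "1 \<notin> Q" using cong[OF mconst[of 1]] by (simp add: Q_def mconst_simps)
    show "0 \<in> Q" using cong[OF mconst[of 0]] by (simp add: Q_def mconst_simps)
  qed blast
  then show ?thesis using that[of F] face_ideal_polys[of _ V1 F] by (auto simp: Q_def)
qed

text \<open>The composition of \<open>\<Phi>\<close> and \<open>\<Psi>\<close> sends the variable of
  a vertex outside \<open>F'\<close> into \<open>face_ideal V1 F\<close>. As it is the identity
  modulo \<open>I1\<close>, the variable itself lies there, and the vertex is outside
  \<open>F\<close>.\<close>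

lemma subset_if_face_ideal_compat:
  fixes F F' :: "'v set"
  assumes iso: "mod_iso V1 I1 V2 I2 \<Phi> \<Psi>" and "F \<subseteq> V1" "I1 \<subseteq> face_ideal V1 F"
    and "\<And>f. f \<in> face_ideal V1 F' \<Longrightarrow> \<Phi> f \<in> face_ideal V2 G"
    and "\<And>g. g \<in> face_ideal V2 G \<Longrightarrow> \<Psi> g \<in> face_ideal V1 F"
  shows "F \<subseteq> F'"
proof
  interpret mod_iso V1 I1 V2 I2 \<Phi> \<Psi> by (rule iso)
  fix v assume v: "v \<in> F"
  show "v \<in> F'"
  proof (rule ccontr)
    assume "v \<notin> F'"
    then have "mvar v \<in> face_ideal V1 F'" using v assms(2) by auto
    then have "\<Psi> (\<Phi> (mvar v)) \<in> face_ideal V1 F" by (intro assms(4,5))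
    moreover have "\<Psi> (\<Phi> (mvar v)) - mvar v \<in> face_ideal V1 F"
      using inv_left[of "mvar v"] v assms(2,3) by auto
    ultimately have "\<Psi> (\<Phi> (mvar v)) - (\<Psi> (\<Phi> (mvar v)) - mvar v) \<in> face_ideal V1 F"
      by (rule face_ideal_diff)
    then show False using v by simp
  qed
qed

theorem mod_iso_imp_complex_iso:
  fixes V1 :: "'v::linorder set" and V2 :: "'w::linorder set"
  assumes fin: "finite V1" "finite V2" and \<G>: "\<Union>\<G>1 \<subseteq> V1" "\<Union>\<G>2 \<subseteq> V2"
    and iso: "mod_iso V1 (squarefree_ideal V1 \<G>1 :: ('v, 'k::field) mpoly set) V2 (squarefree_ideal V2 \<G>2) \<Phi> \<Psi>"
  shows "\<exists>f. complex_iso f (independence_complex V1 \<G>1) (independence_complex V2 \<G>2)"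
proof -
  let ?C1 = "independence_complex V1 \<G>1" and ?C2 = "independence_complex V2 \<G>2"
  let ?I1 = "squarefree_ideal V1 \<G>1 :: ('v, 'k) mpoly set" and ?I2 = "squarefree_ideal V2 \<G>2 :: ('w, 'k) mpoly set"
  interpret mod_iso V1 ?I1 V2 ?I2 \<Phi> \<Psi> by (rule iso)
  interpret sym: mod_iso V2 ?I2 V1 ?I1 \<Psi> \<Phi> by (rule mod_iso_sym[OF iso])
  note f1 = facet_independence_complex_subset[of _ V1 \<G>1] and f2 = facet_independence_complex_subset[of _ V2 \<G>2]
  have I1: "?I1 \<subseteq> face_ideal V1 F" if "F \<in> faces ?C1" for F
    by (rule squarefree_ideal_face_ideal[OF fin(1) \<G>(1) that])
  have I2: "?I2 \<subseteq> face_ideal V2 G" if "G \<in> faces ?C2" for G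
    by (rule squarefree_ideal_face_ideal[OF fin(2) \<G>(2) that])
  have face1: "F \<in> faces ?C1" if "F \<in> facets ?C1" for F using that by (simp add: facets_def)
  have face2: "F \<in> faces ?C2" if "F \<in> facets ?C2" for F using that by (simp add: facets_def)
  have sym_matched: "sym.matched G F \<longleftrightarrow> matched F G" for F G
    by (auto simp: matched_def sym.matched_def)
  \<comment> \<open>The round trip from \<open>F\<close> to \<open>G\<close> and on to
    \<open>F'\<close>, taking preimages of primes twice, can only enlarge a facet; by maximality it
    returns to \<open>F\<close>, which makes \<open>F\<close> and \<open>G\<close> match in both
    directions.\<close>
  have ex1: "\<exists>G\<in>facets ?C2. matched F G" if F: "F \<in> facets ?C1" for F
  proof -
    obtain G where G: "G \<in> facets ?C2" "\<And>g. g \<in> face_ideal V2 G \<Longrightarrow> \<Psi> g \<in> face_ideal V1 F"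
      using mod_hom_facet_preimage[OF inv.mod_hom_axioms fin(2) \<G>(2) I1[OF face1[OF F]]] by blast
    obtain F' where F': "F' \<in> facets ?C1" "\<And>f. f \<in> face_ideal V1 F' \<Longrightarrow> \<Phi> f \<in> face_ideal V2 G"
      using mod_hom_facet_preimage[OF mod_hom_axioms fin(1) \<G>(1) I2[OF face2[OF G(1)]]] by blast
    have "F \<subseteq> F'"
      by (rule subset_if_face_ideal_compat[OF iso f1[OF F] I1[OF face1[OF F]] F'(2) G(2)])
    then have "F' = F" using F F'(1) by (auto simp: facets_def)
    then show ?thesis using G F'(2) by (auto simp: matched_def)
  qed
  have ex2: "\<exists>F\<in>facets ?C1. matched F G" if G: "G \<in> facets ?C2" for G
  proof -
    obtain F where F: "F \<in> facets ?C1" "\<And>f. f \<in> face_ideal V1 F \<Longrightarrow> \<Phi> f \<in> face_ideal V2 G"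
      using mod_hom_facet_preimage[OF mod_hom_axioms fin(1) \<G>(1) I2[OF face2[OF G]]] by blast
    obtain G' where G': "G' \<in> facets ?C2" "\<And>g. g \<in> face_ideal V2 G' \<Longrightarrow> \<Psi> g \<in> face_ideal V1 F"
      using mod_hom_facet_preimage[OF inv.mod_hom_axioms fin(2) \<G>(2) I1[OF face1[OF F(1)]]] by blast
    have "G \<subseteq> G'"
      by (rule subset_if_face_ideal_compat[OF mod_iso_sym[OF iso] f2[OF G] I2[OF face2[OF G]] G'(2) F(2)])
    then have "G' = G" using G G'(1) by (auto simp: facets_def)
    then show ?thesis using F G'(2) by (auto simp: matched_def)
  qed
  have uniq: "G = G'" if "G \<in> facets ?C2" "G' \<in> facets ?C2" "matched F G" "matched F G'" for F G G'
  proof -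
    have "G \<subseteq> G'"
      by (rule subset_if_face_ideal_compat[OF mod_iso_sym[OF iso] f2[OF that(1)] I2[OF face2[OF that(1)]]])
        (use that(3,4) in \<open>auto simp: matched_def\<close>)
    then show ?thesis using that(1,2) by (auto simp: facets_def)
  qed
  obtain \<sigma> where \<sigma>: "\<And>F. F \<in> facets ?C1 \<Longrightarrow> \<sigma> F \<in> facets ?C2 \<and> matched F (\<sigma> F)"
    using ex1 by metis
  have \<sigma>_surj: "\<sigma> ` facets ?C1 = facets ?C2"
  proof
    show "facets ?C2 \<subseteq> \<sigma> ` facets ?C1"
    proof
      fix G assume G: "G \<in> facets ?C2"
      then obtain F where F: "F \<in> facets ?C1" "matched F G" using ex2 by blast
      then have "G = \<sigma> F" using uniq[OF G _ F(2)] \<sigma>[OF F(1)] by simp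
      then show "G \<in> \<sigma> ` facets ?C1" using F(1) by simp
    qed
  qed (use \<sigma> in auto)
  note fin1 = finite_ground_independence_complex[OF fin(1), of \<G>1]
    and fin2 = finite_ground_independence_complex[OF fin(2), of \<G>2]
  note sc = simplicial_complex_independence_complex
  have g1: "F \<in> facets ?C1 \<Longrightarrow> F \<subseteq> ground ?C1" for F using Union_facets[OF fin1 sc] by blast
  have "finite (facets ?C1)"
    by (rule finite_subset[of _ "Pow V1"]) (use f1 fin(1) in auto)
  \<comment> \<open>For nonempty \<open>J\<close> both intersections are faces, so their ideals
    contain the squarefree ideals. The two inequalities come from the isomorphism and its
    inverse.\<close>
  moreover have "card (\<Inter>F\<in>J. F) = card (\<Inter>F\<in>J. \<sigma> F)" if J: "J \<subseteq> facets ?C1" "J \<noteq> {}" for J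
  proof -
    let ?W = "\<Inter>F\<in>J. F" and ?W' = "\<Inter>F\<in>J. \<sigma> F"
    obtain F0 where F0: "F0 \<in> J" using J by blast
    then have F0': "F0 \<in> facets ?C1" using J by blast
    have W: "?W \<in> faces ?C1" "?W \<subseteq> V1"
      using faces_independence_complex_mono[OF face1[OF F0'], of ?W] f1[OF F0'] F0 by blast+
    have W': "?W' \<in> faces ?C2" "?W' \<subseteq> V2"
      using faces_independence_complex_mono[OF face2[OF conjunct1[OF \<sigma>[OF F0']]], of ?W']
        f2[OF conjunct1[OF \<sigma>[OF F0']]] F0 by blast+
    have m: "matched ?W ?W'"
      using \<sigma> J by (intro matched_Inter I1 I2 W W') blast
    have "card ?W \<le> card ?W'"
      by (rule card_le_if_matched[OF _ _ W(2) W'(2) I1[OF W(1)] I2[OF W'(1)] m])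
        (use fin W W' finite_subset in auto)
    moreover have "card ?W' \<le> card ?W"
      by (rule sym.card_le_if_matched[OF _ _ W'(2) W(2) I2[OF W'(1)] I1[OF W(1)]])
        (use fin W W' finite_subset m sym_matched in auto)
    ultimately show ?thesis by simp
  qed
  ultimately obtain f where f: "bij_betw f (\<Union>F\<in>facets ?C1. F) (\<Union>F\<in>facets ?C1. \<sigma> F)"
    "\<And>F v. F \<in> facets ?C1 \<Longrightarrow> v \<in> (\<Union>F\<in>facets ?C1. F) \<Longrightarrow> f v \<in> \<sigma> F \<longleftrightarrow> v \<in> F"
    using card_Inter_eq_imp_bij[of "facets ?C1" "\<lambda>F. F" \<sigma>] \<sigma> f1 f2 fin finite_subset by (smt (verit, best))
  have b: "bij_betw f (ground ?C1) (ground ?C2)"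
    using f(1) Union_facets[OF fin1 sc] Union_facets[OF fin2 sc] \<sigma>_surj by simp
  have im: "f ` F = \<sigma> F" if F: "F \<in> facets ?C1" for F
  proof
    show "f ` F \<subseteq> \<sigma> F" using f(2)[OF F] F by blast
    show "\<sigma> F \<subseteq> f ` F"
    proof
      fix w assume w: "w \<in> \<sigma> F"
      then have "w \<in> (\<Union>F\<in>facets ?C1. \<sigma> F)" using F by blast
      then obtain v where "v \<in> (\<Union>F\<in>facets ?C1. F)" "w = f v" using bij_betw_imp_surj_on[OF f(1)] by blast
      then show "w \<in> f ` F" using f(2)[OF F] w by blast
    qed
  qed
  have "complex_iso f ?C1 ?C2"
  proof (rule complex_isoI_facets[OF fin1 sc fin2 sc b])
    fix F assume F: "F \<subseteq> ground ?C1"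
    show "F \<in> facets ?C1 \<longleftrightarrow> f ` F \<in> facets ?C2"
    proof
      assume "f ` F \<in> facets ?C2"
      then obtain F' where F': "F' \<in> facets ?C1" "f ` F = \<sigma> F'" using \<sigma>_surj by blast
      then have "f ` F = f ` F'" using im by simp
      then have "F = F'" using bij_betw_imp_inj_on[OF b] F g1[OF F'(1)] by (simp add: inj_on_image_eq_iff)
      then show "F \<in> facets ?C1" using F'(1) by simp
    qed (use im \<sigma> in simp)
  qed
  then show ?thesis by blast
qed

section \<open>Quotient algebras\<close>

definition residue :: "'v set \<Rightarrow> ('v, 'k::field) mpoly set \<Rightarrow> ('v, 'k) mpoly \<Rightarrow> ('v, 'k) mpoly set" where
  "residue V I p = I +>\<^bsub>polynomial_ring V\<^esub> p"

context
  fixes V :: "'v set" and I :: "('v, 'k::field) mpoly set"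
  assumes I: "ideal I (polynomial_ring V)"
begin

lemma carrier_quotient_algebra: "carrier (quotient_algebra V I) = residue V I ` polys V"
  by (auto simp: quotient_algebra_def Let_def ring.defs module.defs FactRing_def A_RCOSETS_def' residue_def)

lemma one_quotient_algebra: "\<one>\<^bsub>quotient_algebra V I\<^esub> = residue V I 1"
  by (simp add: quotient_algebra_def Let_def ring.defs module.defs FactRing_def residue_def)

lemma mult_quotient_algebra:
  assumes "p \<in> polys V" "q \<in> polys V"
  shows "residue V I p \<otimes>\<^bsub>quotient_algebra V I\<^esub> residue V I q = residue V I (p * q)"
  using ideal.rcoset_mult_add[OF I assms]
  by (simp add: quotient_algebra_def Let_def ring.defs module.defs FactRing_def residue_def)

lemma add_quotient_algebra:
  assumes "p \<in> polys V" "q \<in> polys V"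
  shows "residue V I p \<oplus>\<^bsub>quotient_algebra V I\<^esub> residue V I q = residue V I (p + q)"
proof -
  interpret ideal I "polynomial_ring V" by (rule I)
  show ?thesis
    using a_rcos_sum[OF assms]
    by (simp add: quotient_algebra_def Let_def ring.defs module.defs FactRing_def residue_def)
qed

lemma smult_quotient_algebra:
  assumes "p \<in> polys V"
  shows "c \<odot>\<^bsub>quotient_algebra V I\<^esub> residue V I p = residue V I (mconst c * p)"
  using ideal.rcoset_mult_add[OF I, of "mconst c" p] assms
  by (simp add: quotient_algebra_def Let_def ring.defs module.defs FactRing_def residue_def)

lemma residue_eq_iff:
  assumes "p \<in> polys V" "q \<in> polys V"
  shows "residue V I p = residue V I q \<longleftrightarrow> p - q \<in> I"
proof -
  interpret ideal I "polynomial_ring V" by (rule I)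
  have "p \<in> residue V I q \<longleftrightarrow> p - q \<in> I"
    using a_rcos_module_minus[OF ring_axioms assms(2,1)] polynomial_ring_a_minus[OF assms]
    by (simp add: residue_def)
  moreover have "residue V I p = residue V I q \<longleftrightarrow> p \<in> residue V I q"
    unfolding residue_def using a_repr_independence[OF _ assms(2) a_subgroup] a_rcos_self[OF assms(1)] by blast
  ultimately show ?thesis by simp
qed

end

text \<open>\<open>\<Phi>\<close> picks a representative of the image of each class,
  \<open>\<Psi>\<close> one of the preimage; equations between classes then become congruences
  between polynomials.\<close>

lemma algebra_isomorphic_imp_mod_iso:
  fixes V1 :: "'v set" and V2 :: "'w set" and I1 :: "('v, 'k::field) mpoly set"
  assumes I: "ideal I1 (polynomial_ring V1)" "ideal I2 (polynomial_ring V2)"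
    and "algebra_isomorphic (quotient_algebra V1 I1) (quotient_algebra V2 I2)"
  obtains \<Phi> \<Psi> where "mod_iso V1 I1 V2 I2 \<Phi> \<Psi>"
proof -
  let ?A1 = "quotient_algebra V1 I1" and ?A2 = "quotient_algebra V2 I2"
  let ?r1 = "residue V1 I1" and ?r2 = "residue V2 I2"
  note q1 = carrier_quotient_algebra[OF I(1)] one_quotient_algebra[OF I(1)] mult_quotient_algebra[OF I(1)]
    add_quotient_algebra[OF I(1)] smult_quotient_algebra[OF I(1)]
  note q2 = carrier_quotient_algebra[OF I(2)] one_quotient_algebra[OF I(2)] mult_quotient_algebra[OF I(2)]
    add_quotient_algebra[OF I(2)] smult_quotient_algebra[OF I(2)]
  note e1 = residue_eq_iff[OF I(1)] and e2 = residue_eq_iff[OF I(2)]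
  obtain h where h: "h \<in> ring_iso ?A1 ?A2" and sc: "\<And>c x. x \<in> carrier ?A1 \<Longrightarrow> h (c \<odot>\<^bsub>?A1\<^esub> x) = c \<odot>\<^bsub>?A2\<^esub> h x"
    using assms(3) unfolding algebra_isomorphic_def by blast
  note hom = ring_iso_memE[OF h]
  have c1: "?r1 p \<in> carrier ?A1" if "p \<in> polys V1" for p using that q1(1) by simp
  have "\<exists>g\<in>polys V2. h (?r1 f) = ?r2 g" if "f \<in> polys V1" for f
    using hom(1)[OF c1[OF that]] q2(1) by auto
  then obtain \<Phi> where \<Phi>: "\<And>f. f \<in> polys V1 \<Longrightarrow> \<Phi> f \<in> polys V2" "\<And>f. f \<in> polys V1 \<Longrightarrow> h (?r1 f) = ?r2 (\<Phi> f)"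
    by metis
  have "\<exists>f\<in>polys V1. h (?r1 f) = ?r2 g" if "g \<in> polys V2" for g
  proof -
    have "?r2 g \<in> h ` carrier ?A1"
      using bij_betw_imp_surj_on[OF hom(5)] q2(1) that by simp
    then show ?thesis using q1(1) by auto
  qed
  then obtain \<Psi> where \<Psi>: "\<And>g. g \<in> polys V2 \<Longrightarrow> \<Psi> g \<in> polys V1" "\<And>g. g \<in> polys V2 \<Longrightarrow> h (?r1 (\<Psi> g)) = ?r2 g"
    by metis
  have inj: "?r1 f = ?r1 f' \<longleftrightarrow> ?r2 (\<Phi> f) = ?r2 (\<Phi> f')" if "f \<in> polys V1" "f' \<in> polys V1" for f f'
    using inj_on_eq_iff[OF bij_betw_imp_inj_on[OF hom(5)] c1[OF that(1)] c1[OF that(2)]] \<Phi>(2) that by simp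
  have add: "?r2 (\<Phi> (f + g)) = ?r2 (\<Phi> f + \<Phi> g)" if fg: "f \<in> polys V1" "g \<in> polys V1" for f g
    using hom(3)[OF c1[OF fg(1)] c1[OF fg(2)]] fg by (simp add: q1(4) q2(4) \<Phi> polys_add)
  have mult: "?r2 (\<Phi> (f * g)) = ?r2 (\<Phi> f * \<Phi> g)" if fg: "f \<in> polys V1" "g \<in> polys V1" for f g
    using hom(2)[OF c1[OF fg(1)] c1[OF fg(2)]] fg by (simp add: q1(3) q2(3) \<Phi> polys_mult)
  have const: "?r2 (\<Phi> (mconst c)) = ?r2 (mconst c)" for c
    using sc[OF c1[of 1], of c] hom(4) by (simp add: q1(2,5) q2(2,5) \<Phi>(2))
  have \<Phi>\<Psi>: "?r2 (\<Phi> (\<Psi> g)) = ?r2 g" if "g \<in> polys V2" for g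
    using \<Phi>(2)[OF \<Psi>(1)[OF that]] \<Psi>(2)[OF that] by simp
  have \<Psi>\<Phi>: "?r1 (\<Psi> (\<Phi> f)) = ?r1 f" if f: "f \<in> polys V1" for f
    using inj[OF \<Psi>(1)[OF \<Phi>(1)[OF f]] f] \<Phi>\<Psi>[OF \<Phi>(1)[OF f]] by simp
  have zero1: "f \<in> I1 \<longleftrightarrow> ?r1 f = ?r1 0" if "f \<in> polys V1" for f using e1[OF that, of 0] by simp
  have zero2: "f \<in> I2 \<longleftrightarrow> ?r2 f = ?r2 0" if "f \<in> polys V2" for f using e2[OF that, of 0] by simp
  have \<Phi>0: "?r2 (\<Phi> 0) = ?r2 0" using const[of 0] by (simp add: mconst_simps)
  have "mod_hom V1 I1 V2 I2 \<Phi>"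
  proof
    show "\<Phi> f \<in> I2" if f: "f \<in> I1" for f
    proof -
      have fV: "f \<in> polys V1" using ideal_polynomial_ringD(1)[OF I(1) f] .
      then have "?r2 (\<Phi> f) = ?r2 0" using zero1 f inj[OF fV, of 0] \<Phi>0 by simp
      then show ?thesis using zero2[OF \<Phi>(1)[OF fV]] by simp
    qed
  qed (use \<Phi>(1) add mult const in \<open>simp_all add: polys_add polys_mult flip: e2\<close>)
  moreover have "mod_hom V2 I2 V1 I1 \<Psi>"
  proof
    \<comment> \<open>Since \<open>h\<close> is injective, a congruence between values of
      \<open>\<Psi>\<close> may be checked after applying \<open>\<Phi>\<close>, where its
      properties are known.\<close>
    have via: "?r1 p = ?r1 q" if "p \<in> polys V1" "q \<in> polys V1" "?r2 (\<Phi> p) = ?r2 (\<Phi> q)" for p q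
      using inj that by simp
    show "\<Psi> (f + g) - (\<Psi> f + \<Psi> g) \<in> I1" if "f \<in> polys V2" "g \<in> polys V2" for f g
    proof -
      have "?r2 (\<Phi> (\<Psi> f + \<Psi> g)) = ?r2 (\<Phi> (\<Psi> f)) \<oplus>\<^bsub>?A2\<^esub> ?r2 (\<Phi> (\<Psi> g))"
        using that by (simp add: add q2(4) \<Phi>(1) \<Psi>(1))
      also have "\<dots> = ?r2 (\<Phi> (\<Psi> (f + g)))" using that by (simp add: \<Phi>\<Psi> q2(4) polys_add)
      finally show ?thesis using that by (simp add: via \<Psi>(1) polys_add flip: e1)
    qed
    show "\<Psi> (f * g) - \<Psi> f * \<Psi> g \<in> I1" if "f \<in> polys V2" "g \<in> polys V2" for f g
    proof -
      have "?r2 (\<Phi> (\<Psi> f * \<Psi> g)) = ?r2 (\<Phi> (\<Psi> f)) \<otimes>\<^bsub>?A2\<^esub> ?r2 (\<Phi> (\<Psi> g))"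
        using that by (simp add: mult q2(3) \<Phi>(1) \<Psi>(1))
      also have "\<dots> = ?r2 (\<Phi> (\<Psi> (f * g)))" using that by (simp add: \<Phi>\<Psi> q2(3) polys_mult)
      finally show ?thesis using that by (simp add: via \<Psi>(1) polys_mult flip: e1)
    qed
    show "\<Psi> (mconst c) - mconst c \<in> I1" for c
      by (simp add: via \<Psi>(1) \<Phi>\<Psi> const flip: e1)
    show "\<Psi> g \<in> I1" if g: "g \<in> I2" for g
    proof -
      have gV: "g \<in> polys V2" using ideal_polynomial_ringD(1)[OF I(2) g] .
      then have "?r2 (\<Phi> (\<Psi> g)) = ?r2 (\<Phi> 0)" using zero2 g \<Phi>\<Psi> \<Phi>0 by simp
      then show ?thesis using zero1[OF \<Psi>(1)[OF gV]] via[OF \<Psi>(1)[OF gV]] by simp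
    qed
  qed (rule \<Psi>(1))
  ultimately have "mod_iso V1 I1 V2 I2 \<Phi> \<Psi>"
    unfolding mod_iso_def mod_iso_axioms_def using \<Phi>(1) \<Psi>(1) \<Phi>\<Psi> \<Psi>\<Phi> by (simp flip: e1 e2)
  then show ?thesis by (rule that)
qed

lemma mod_iso_imp_algebra_isomorphic:
  fixes V1 :: "'v set" and V2 :: "'w set" and I1 :: "('v, 'k::field) mpoly set"
  assumes I: "ideal I1 (polynomial_ring V1)" "ideal I2 (polynomial_ring V2)"
    and iso: "mod_iso V1 I1 V2 I2 \<Phi> \<Psi>"
  shows "algebra_isomorphic (quotient_algebra V1 I1) (quotient_algebra V2 I2)"
proof -
  interpret mod_iso V1 I1 V2 I2 \<Phi> \<Psi> by (rule iso)
  let ?A1 = "quotient_algebra V1 I1" and ?A2 = "quotient_algebra V2 I2"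
  let ?r1 = "residue V1 I1" and ?r2 = "residue V2 I2"
  note q1 = carrier_quotient_algebra[OF I(1)] one_quotient_algebra[OF I(1)] mult_quotient_algebra[OF I(1)]
    add_quotient_algebra[OF I(1)] smult_quotient_algebra[OF I(1)]
  note q2 = carrier_quotient_algebra[OF I(2)] one_quotient_algebra[OF I(2)] mult_quotient_algebra[OF I(2)]
    add_quotient_algebra[OF I(2)] smult_quotient_algebra[OF I(2)]
  note e1 = residue_eq_iff[OF I(1)] and e2 = residue_eq_iff[OF I(2)]
  have cong: "\<Phi>' p - \<Phi>' q \<in> I2'"
    if hom: "mod_hom V1' I1' V2' I2' \<Phi>'" and I2': "ideal I2' (polynomial_ring V2')" and p: "p \<in> polys V1'" "q \<in> polys V1'" "p - q \<in> I1'"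
    for V1' :: "'x set" and I1' :: "('x, 'k) mpoly set" and V2' :: "'y set" and I2' \<Phi>' p q
  proof -
    interpret h: mod_hom V1' I1' V2' I2' \<Phi>' by (rule hom)
    have "\<Phi>' (q + (p - q)) - (\<Phi>' q + \<Phi>' (p - q)) + \<Phi>' (p - q) \<in> I2'"
      using p by (intro ideal_polynomial_ringD(3)[OF I2'] h.add h.zero polys_diff) auto
    then show ?thesis by simp
  qed
  have \<Phi>_cong: "?r2 (\<Phi> p) = ?r2 (\<Phi> q)" if "p \<in> polys V1" "q \<in> polys V1" "?r1 p = ?r1 q" for p q
    using cong[OF mod_hom_axioms I(2) that(1,2)] that by (simp add: e1 e2 polys)
  have \<Psi>_cong: "?r1 (\<Psi> p) = ?r1 (\<Psi> q)" if "p \<in> polys V2" "q \<in> polys V2" "?r2 p = ?r2 q" for p q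
    using cong[OF inv.mod_hom_axioms I(1) that(1,2)] that by (simp add: e1 e2 inv.polys)
  define h where "h C = ?r2 (\<Phi> (SOME p. p \<in> polys V1 \<and> C = ?r1 p))" for C
  have h: "h (?r1 p) = ?r2 (\<Phi> p)" if p: "p \<in> polys V1" for p
  proof -
    define q where "q = (SOME q. q \<in> polys V1 \<and> ?r1 p = ?r1 q)"
    have "q \<in> polys V1 \<and> ?r1 p = ?r1 q" unfolding q_def by (rule someI[of _ p]) (simp add: p)
    then have "?r2 (\<Phi> q) = ?r2 (\<Phi> p)" using p by (intro \<Phi>_cong) auto
    then show ?thesis unfolding h_def q_def .
  qed
  have inv1: "?r1 (\<Psi> (\<Phi> p)) = ?r1 p" if "p \<in> polys V1" for p
    using inv_left[OF that] that by (simp add: e1 polys inv.polys)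
  have inv2: "?r2 (\<Phi> (\<Psi> p)) = ?r2 p" if "p \<in> polys V2" for p
    using inv_right[OF that] that by (simp add: e2 polys inv.polys)
  have "h \<in> ring_iso ?A1 ?A2"
  proof (rule ring_iso_memI)
    show "bij_betw h (carrier ?A1) (carrier ?A2)"
      unfolding bij_betw_def q1(1) q2(1)
    proof (rule conjI[OF inj_onI equalityI[OF subsetI subsetI]])
      fix C D assume "C \<in> ?r1 ` polys V1" "D \<in> ?r1 ` polys V1" and CD: "h C = h D"
      then obtain p q where pq: "p \<in> polys V1" "q \<in> polys V1" "C = ?r1 p" "D = ?r1 q" by blast
      then have "?r1 (\<Psi> (\<Phi> p)) = ?r1 (\<Psi> (\<Phi> q))" using CD by (intro \<Psi>_cong polys) (simp_all add: h)
      then show "C = D" using pq by (simp add: inv1)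
    next
      fix D assume "D \<in> ?r2 ` polys V2"
      then obtain q where "q \<in> polys V2" "D = ?r2 q" by blast
      then have "D = h (?r1 (\<Psi> q))" "?r1 (\<Psi> q) \<in> ?r1 ` polys V1" by (simp_all add: h inv.polys inv2)
      then show "D \<in> h ` ?r1 ` polys V1" by (rule image_eqI)
    qed (auto simp: h polys)
    show "h \<one>\<^bsub>?A1\<^esub> = \<one>\<^bsub>?A2\<^esub>"
      using mconst[of 1] polys[of 1] by (simp add: q1(2) q2(2) h e2 mconst_simps)
    show "h x \<in> carrier ?A2" if "x \<in> carrier ?A1" for x
      using that by (auto simp: q1(1) q2(1) h polys)
    show "h (x \<otimes>\<^bsub>?A1\<^esub> y) = h x \<otimes>\<^bsub>?A2\<^esub> h y" if "x \<in> carrier ?A1" "y \<in> carrier ?A1" for x y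
    proof -
      obtain p q where "p \<in> polys V1" "q \<in> polys V1" "x = ?r1 p" "y = ?r1 q"
        using \<open>x \<in> carrier ?A1\<close> \<open>y \<in> carrier ?A1\<close> unfolding q1(1) by blast
      then show ?thesis using mult by (simp add: q1(3) q2(3) h polys polys_mult e2)
    qed
    show "h (x \<oplus>\<^bsub>?A1\<^esub> y) = h x \<oplus>\<^bsub>?A2\<^esub> h y" if "x \<in> carrier ?A1" "y \<in> carrier ?A1" for x y
    proof -
      obtain p q where "p \<in> polys V1" "q \<in> polys V1" "x = ?r1 p" "y = ?r1 q"
        using \<open>x \<in> carrier ?A1\<close> \<open>y \<in> carrier ?A1\<close> unfolding q1(1) by blast
      then show ?thesis using add by (simp add: q1(4) q2(4) h polys polys_add e2)
    qed
  qed
  moreover have "h (c \<odot>\<^bsub>?A1\<^esub> x) = c \<odot>\<^bsub>?A2\<^esub> h x" if "x \<in> carrier ?A1" for c x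
  proof -
    obtain p where p: "p \<in> polys V1" "x = ?r1 p" using \<open>x \<in> carrier ?A1\<close> q1(1) by auto
    \<comment> \<open>\<open>\<Phi>\<close> fixes constants only modulo \<open>I2\<close>; the
      second summand replaces \<open>\<Phi> (mconst c)\<close> by \<open>mconst c\<close>.\<close>
    have "(\<Phi> (mconst c * p) - \<Phi> (mconst c) * \<Phi> p) + \<Phi> p * (\<Phi> (mconst c) - mconst c) \<in> I2"
      using p by (intro ideal_polynomial_ringD(3,4)[OF I(2)] mult mconst polys) auto
    then have "\<Phi> (mconst c * p) - mconst c * \<Phi> p \<in> I2" by (simp add: algebra_simps)
    then show ?thesis using p by (simp add: q1(5) q2(5) h polys polys_mult e2)
  qed
  ultimately show ?thesis unfolding algebra_isomorphic_def by blast
qed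

text \<open>The polynomials sent into the second ideal form an ideal, so only generators have to be
  checked. Injectivity of \<open>\<pi>\<close> keeps the image of a squarefree monomial
  squarefree.\<close>

lemma mod_hom_msubst:
  fixes V1 :: "'v set" and V2 :: "'w set"
  assumes \<pi>: "\<pi> ` V1 \<subseteq> V2" and \<G>: "\<Union>\<G>1 \<subseteq> V1" "\<Union>\<G>2 \<subseteq> V2"
    and gen: "\<And>G. G \<in> \<G>1 \<Longrightarrow> \<pi> ` G \<in> \<G>2" and inj: "inj_on \<pi> V1"
  shows "mod_hom V1 (squarefree_ideal V1 \<G>1 :: ('v, 'k::field) mpoly set) V2 (squarefree_ideal V2 \<G>2) (msubst (\<lambda>v. mvar (\<pi> v)))"
proof -
  let ?I1 = "squarefree_ideal V1 \<G>1 :: ('v, 'k) mpoly set" and ?I2 = "squarefree_ideal V2 \<G>2 :: ('w, 'k) mpoly set"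
  let ?\<Phi> = "msubst (\<lambda>v. mvar (\<pi> v)) :: ('v, 'k) mpoly \<Rightarrow> ('w, 'k) mpoly"
  note D = ideal_polynomial_ringD[OF ideal_squarefree_ideal[OF \<G>(2)], where ?'k = 'k]
  have \<Phi>: "?\<Phi> p \<in> polys V2" if "p \<in> polys V1" for p
    using that by (rule msubst_polys) (use \<pi> in auto)
  have "?I1 \<subseteq> {p \<in> polys V1. ?\<Phi> p \<in> ?I2}"
  proof (rule squarefree_ideal_minimal)
    show "ideal {p \<in> polys V1. ?\<Phi> p \<in> ?I2} (polynomial_ring V1)"
      by (rule ideal_polynomial_ringI) (auto intro: D \<Phi>)
    fix G assume G: "G \<in> \<G>1"
    have "inj_on \<pi> G" using G \<G>(1) by (intro inj_on_subset[OF inj]) blast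
    then have "?\<Phi> (\<Prod>i\<in>G. mvar i) = (\<Prod>i\<in>\<pi> ` G. mvar i)" by (simp add: prod.reindex)
    also have "\<dots> \<in> ?I2"
      unfolding squarefree_ideal_def
      using ring.genideal_self[OF cring.axioms(1)[OF cring_polynomial_ring] squarefree_generators[OF \<G>(2)]] gen[OF G]
      by blast
    finally show "(\<Prod>i\<in>G. mvar i) \<in> {p \<in> polys V1. ?\<Phi> p \<in> ?I2}"
      using G \<G>(1) by (auto intro: prod_mvar_polys)
  qed
  then show ?thesis by unfold_locales (auto simp: \<Phi> D(2))
qed

lemma algebra_isomorphic_squarefree:
  fixes V1 :: "'v set" and V2 :: "'w set"
  assumes \<pi>: "bij_betw \<pi> V1 V2" and \<G>: "\<Union>\<G>1 \<subseteq> V1" "\<Union>\<G>2 \<subseteq> V2"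
    and gen: "\<And>G. G \<subseteq> V1 \<Longrightarrow> G \<in> \<G>1 \<longleftrightarrow> \<pi> ` G \<in> \<G>2"
  shows "algebra_isomorphic (quotient_algebra V1 (squarefree_ideal V1 \<G>1 :: ('v, 'k::field) mpoly set))
    (quotient_algebra V2 (squarefree_ideal V2 \<G>2 :: ('w, 'k) mpoly set))"
proof (rule mod_iso_imp_algebra_isomorphic[OF ideal_squarefree_ideal[OF \<G>(1)] ideal_squarefree_ideal[OF \<G>(2)]])
  let ?\<pi>' = "the_inv_into V1 \<pi>"
  let ?\<Phi> = "msubst (\<lambda>v. mvar (\<pi> v)) :: ('v, 'k) mpoly \<Rightarrow> ('w, 'k) mpoly"
    and ?\<Psi> = "msubst (\<lambda>v. mvar (?\<pi>' v)) :: ('w, 'k) mpoly \<Rightarrow> ('v, 'k) mpoly"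
  note inj = bij_betw_imp_inj_on[OF \<pi>] and im = bij_betw_imp_surj_on[OF \<pi>]
  note \<pi>' = bij_betw_the_inv_into[OF \<pi>]
  have hom1: "mod_hom V1 (squarefree_ideal V1 \<G>1) V2 (squarefree_ideal V2 \<G>2) ?\<Phi>"
  proof (rule mod_hom_msubst[OF _ \<G> _ inj])
    show "\<pi> ` G \<in> \<G>2" if "G \<in> \<G>1" for G
      using gen[of G] that \<G>(1) by (simp add: Sup_le_iff)
  qed (simp add: im)
  have "?\<pi>' ` G \<in> \<G>1" if G: "G \<in> \<G>2" for G
  proof -
    have "G \<subseteq> V2" using G \<G>(2) by blast
    then have "\<pi> ` ?\<pi>' ` G = G" "?\<pi>' ` G \<subseteq> V1"
      using bij_betw_image_the_inv_into[OF \<pi>] bij_betw_imp_surj_on[OF \<pi>'] by (simp, blast)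
    then show ?thesis using gen[of "?\<pi>' ` G"] G by simp
  qed
  then have hom2: "mod_hom V2 (squarefree_ideal V2 \<G>2) V1 (squarefree_ideal V1 \<G>1) ?\<Psi>"
    using \<G> bij_betw_imp_surj_on[OF \<pi>'] bij_betw_imp_inj_on[OF \<pi>'] by (intro mod_hom_msubst) auto
  have zero: "(0 :: ('v, 'k) mpoly) \<in> squarefree_ideal V1 \<G>1" "(0 :: ('w, 'k) mpoly) \<in> squarefree_ideal V2 \<G>2"
    using ideal_polynomial_ringD(2) ideal_squarefree_ideal \<G> by blast+
  have "?\<Psi> (?\<Phi> f) = f" if "f \<in> polys V1" for f
    using that by (rule msubst_msubst) (simp add: the_inv_into_f_f[OF inj])
  moreover have "?\<Phi> (?\<Psi> g) = g" if "g \<in> polys V2" for g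
    using that by (rule msubst_msubst) (simp add: f_the_inv_into_f[OF inj] im)
  ultimately show "mod_iso V1 (squarefree_ideal V1 \<G>1) V2 (squarefree_ideal V2 \<G>2) ?\<Phi> ?\<Psi>"
    using hom1 hom2 zero by (simp add: mod_iso_def mod_iso_axioms_def)
qed

section \<open>Comparability isomorphisms\<close>

abbreviation pfaces :: "'a set_system \<Rightarrow> 'a set set" where
  "pfaces X \<equiv> faces X - {{}}"

lemma pface_ground: "simplicial_complex X \<Longrightarrow> E \<in> pfaces X \<Longrightarrow> E \<subseteq> ground X"
  by (auto simp: simplicial_complex_def)

lemma pface_subset: "simplicial_complex X \<Longrightarrow> E \<in> pfaces X \<Longrightarrow> F \<subseteq> E \<Longrightarrow> F \<noteq> {} \<Longrightarrow> F \<in> pfaces X"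
  by (auto simp: simplicial_complex_def)

lemma vertex_pface: "simplicial_complex X \<Longrightarrow> v \<in> ground X \<Longrightarrow> {v} \<in> pfaces X"
  by (simp add: simplicial_complex_def)

text \<open>Vertices are the minimal nonempty faces, so an order isomorphism permutes them; it is
  determined by this, since a face is known from the vertices below it.\<close>

lemma face_order_iso_imp_complex_iso:
  assumes X: "simplicial_complex X" and Y: "simplicial_complex Y" and empty: "{} \<in> faces X" "{} \<in> faces Y"
    and b: "bij_betw f (pfaces X) (pfaces Y)"
    and mono: "\<And>S T. S \<in> pfaces X \<Longrightarrow> T \<in> pfaces X \<Longrightarrow> S \<subseteq> T \<longleftrightarrow> f S \<subseteq> f T"
  shows "\<exists>g. complex_iso g X Y"
proof -
  note PX = vertex_pface[OF X] and PY = vertex_pface[OF Y]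
  have fP: "f E \<in> pfaces Y" if "E \<in> pfaces X" for E using bij_betwE[OF b] that by blast
  have fsurj: "\<exists>E\<in>pfaces X. f E = G" if "G \<in> pfaces Y" for G
    using bij_betw_imp_surj_on[OF b] that by (metis imageE)
  have finj: "E = E'" if "E \<in> pfaces X" "E' \<in> pfaces X" "f E = f E'" for E E'
    using inj_on_eq_iff[OF bij_betw_imp_inj_on[OF b] that(1,2)] that(3) by simp
  have "\<exists>w. f {v} = {w}" if v: "v \<in> ground X" for v
  proof -
    obtain w where w: "w \<in> f {v}" using fP[OF PX[OF v]] by blast
    then have "{w} \<in> pfaces Y" using pface_ground[OF Y fP[OF PX[OF v]]] by (intro PY) blast
    then obtain E where E: "E \<in> pfaces X" "f E = {w}" using fsurj by blast
    then have "E \<subseteq> {v}" using mono[OF E(1) PX[OF v]] w by simp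
    then have "E = {v}" using E(1) by blast
    then show ?thesis using E(2) by blast
  qed
  then obtain g where g: "\<And>v. v \<in> ground X \<Longrightarrow> f {v} = {g v}" by metis
  have g_iff: "g v \<in> f E \<longleftrightarrow> v \<in> E" if "v \<in> ground X" "E \<in> pfaces X" for v E
    using mono[OF PX[OF that(1)] that(2)] g[OF that(1)] by simp
  have gG: "g v \<in> ground Y" if "v \<in> ground X" for v
    using pface_ground[OF Y fP[OF PX[OF that]]] g[OF that] by simp
  have gsurj: "\<exists>v\<in>ground X. g v = w" if w: "w \<in> ground Y" for w
  proof -
    obtain E where E: "E \<in> pfaces X" "f E = {w}" using fsurj[OF PY[OF w]] by blast
    then obtain v where v: "v \<in> E" by blast
    then have "v \<in> ground X" using pface_ground[OF X E(1)] by blast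
    then show ?thesis using g_iff[OF _ E(1), of v] E(2) v by auto
  qed
  have inj: "inj_on g (ground X)"
  proof (rule inj_onI)
    fix u v assume uv: "u \<in> ground X" "v \<in> ground X" "g u = g v"
    then have "{u} = {v}" using g by (intro finj PX) simp_all
    then show "u = v" by simp
  qed
  have im: "g ` E = f E" if E: "E \<in> pfaces X" for E
  proof
    show "g ` E \<subseteq> f E" using g_iff[OF _ E] pface_ground[OF X E] by blast
    show "f E \<subseteq> g ` E"
    proof
      fix w assume w: "w \<in> f E"
      then have "w \<in> ground Y" using pface_ground[OF Y fP[OF E]] by blast
      then obtain v where "v \<in> ground X" "g v = w" using gsurj by blast
      then show "w \<in> g ` E" using g_iff[OF _ E, of v] w by blast
    qed
  qed
  have "complex_iso g X Y"
    unfolding complex_iso_def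
  proof (intro conjI allI impI)
    show bg: "bij_betw g (ground X) (ground Y)"
      unfolding bij_betw_def using inj gG gsurj by blast
    fix E assume E: "E \<subseteq> ground X"
    show "E \<in> faces X \<longleftrightarrow> g ` E \<in> faces Y"
    proof (cases "E = {}")
      case False
      show ?thesis
      proof
        assume "E \<in> faces X"
        then show "g ` E \<in> faces Y" using im[of E] fP[of E] False by simp
      next
        assume "g ` E \<in> faces Y"
        then obtain E' where E': "E' \<in> pfaces X" "f E' = g ` E" using fsurj[of "g ` E"] False by blast
        then have "g ` E' = g ` E" using im by simp
        then have "E' = E" using inj E pface_ground[OF X E'(1)] by (simp add: inj_on_image_eq_iff)
        then show "E \<in> faces X" using E'(1) by simp
      qed
    qed (simp add: empty)
  qed
  then show ?thesis by blast
qed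

text \<open>These are the unions of connected components, described without paths; connectedness
  then means that the only nonempty one is the ground set.\<close>

definition closed_in :: "'a set_system \<Rightarrow> 'a set \<Rightarrow> bool" where
  "closed_in X A \<longleftrightarrow> A \<subseteq> ground X \<and> (\<forall>E\<in>faces X. E \<inter> A \<noteq> {} \<longrightarrow> E \<subseteq> A)"

definition connected_complex :: "'a set_system \<Rightarrow> bool" where
  "connected_complex X \<longleftrightarrow> ground X \<noteq> {} \<and> (\<forall>A. closed_in X A \<and> A \<noteq> {} \<longrightarrow> A = ground X)"

definition subcomplex_on :: "'a set_system \<Rightarrow> 'a set \<Rightarrow> 'a set_system" where
  "subcomplex_on X C = Set_System C {E \<in> faces X. E \<subseteq> C}"

lemma subcomplex_on_simps [simp]:
  "ground (subcomplex_on X C) = C" "faces (subcomplex_on X C) = {E \<in> faces X. E \<subseteq> C}"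
  by (simp_all add: subcomplex_on_def)

lemma simplicial_complex_subcomplex_on:
  "simplicial_complex X \<Longrightarrow> C \<subseteq> ground X \<Longrightarrow> simplicial_complex (subcomplex_on X C)"
  unfolding simplicial_complex_def subcomplex_on_simps by blast

text \<open>A property that passes along edges holds on a closed set of vertices, because any two
  distinct vertices of a face span an edge.\<close>

lemma connected_induct [consumes 3, case_names ground start step]:
  assumes X: "simplicial_complex X" "connected_complex X" and v: "v \<in> ground X"
    and start: "a \<in> ground X" "P a"
    and step: "\<And>u v. u \<noteq> v \<Longrightarrow> {u, v} \<in> faces X \<Longrightarrow> P u \<Longrightarrow> P v"
  shows "P v"
proof -
  have "closed_in X {v \<in> ground X. P v}"
    unfolding closed_in_def
  proof (intro conjI ballI impI subsetI)
    fix E w assume E: "E \<in> faces X" "E \<inter> {v \<in> ground X. P v} \<noteq> {}" "w \<in> E"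
    then obtain u where u: "u \<in> E" "P u" by blast
    have "{u, w} \<in> faces X" using X(1) E u by (auto simp: simplicial_complex_def)
    then have "P w" using step[of u w] u by (cases "u = w") auto
    then show "w \<in> {v \<in> ground X. P v}" using X(1) E by (auto simp: simplicial_complex_def)
  qed auto
  then have "{v \<in> ground X. P v} = ground X" using X(2) start unfolding connected_complex_def by blast
  then show ?thesis using v by blast
qed

lemma connected_boundary_edge:
  assumes X: "simplicial_complex X" "connected_complex X" and T: "T \<subseteq> ground X" "T \<noteq> {}" "T \<noteq> ground X"
  obtains a c where "a \<in> T" "c \<in> ground X - T" "{a, c} \<in> faces X"
proof -
  have "\<not> closed_in X T" using X(2) T by (auto simp: connected_complex_def)
  then obtain E a c where "E \<in> faces X" "a \<in> E" "a \<in> T" "c \<in> E" "c \<notin> T"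
    using T(1) by (auto simp: closed_in_def)
  then show ?thesis using that[of a c] X(1) by (auto simp: simplicial_complex_def)
qed

locale comparability_iso =
  fixes X :: "'a set_system" and Y :: "'b set_system" and f
  assumes X: "simplicial_complex X" and Y: "simplicial_complex Y"
    and bij: "bij_betw f (pfaces X) (pfaces Y)"
    and comparable: "S \<in> pfaces X \<Longrightarrow> T \<in> pfaces X \<Longrightarrow> S \<subseteq> T \<or> T \<subseteq> S \<longleftrightarrow> f S \<subseteq> f T \<or> f T \<subseteq> f S"
begin

lemma image_pface: "E \<in> pfaces X \<Longrightarrow> f E \<in> pfaces Y"
  using bij_betwE[OF bij] by blast

lemma preimage_pface:
  assumes "G \<in> pfaces Y"
  obtains E where "E \<in> pfaces X" "f E = G"
  using bij_betw_imp_surj_on[OF bij] assms by (metis imageE)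

lemma image_eq_iff: "E \<in> pfaces X \<Longrightarrow> F \<in> pfaces X \<Longrightarrow> f E = f F \<longleftrightarrow> E = F"
  by (rule inj_on_eq_iff[OF bij_betw_imp_inj_on[OF bij]])

lemma inverse: "comparability_iso Y X (the_inv_into (pfaces X) f)"
proof
  let ?g = "the_inv_into (pfaces X) f"
  have g: "?g (f E) = E" if "E \<in> pfaces X" for E
    by (rule the_inv_into_f_f[OF bij_betw_imp_inj_on[OF bij] that])
  show "bij_betw ?g (pfaces Y) (pfaces X)" by (rule bij_betw_the_inv_into[OF bij])
  show "S \<subseteq> T \<or> T \<subseteq> S \<longleftrightarrow> ?g S \<subseteq> ?g T \<or> ?g T \<subseteq> ?g S" if S: "S \<in> pfaces Y" and T: "T \<in> pfaces Y" for S T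
  proof -
    obtain E F where "E \<in> pfaces X" "f E = S" "F \<in> pfaces X" "f F = T"
      using preimage_pface[OF S] preimage_pface[OF T] by metis
    then show ?thesis using comparable[of E F] g[of E] g[of F] by simp
  qed
qed (rule X Y)+

text \<open>\<open>f\<close> acts on faces only, so the preimage of a set of vertices is assembled
  from the faces with image inside it. Comparable nonempty faces meet, hence so do their images, and
  a closed set containing one image contains the other; two faces that merely meet are linked
  through a common vertex.\<close>

lemma closed_preimage:
  assumes A: "closed_in Y A"
  shows "closed_in X (\<Union>{E \<in> pfaces X. f E \<subseteq> A})"
    and "E \<in> pfaces X \<Longrightarrow> E \<subseteq> \<Union>{E \<in> pfaces X. f E \<subseteq> A} \<longleftrightarrow> f E \<subseteq> A"
proof -
  have step: "f F \<subseteq> A" if "E \<in> pfaces X" "F \<in> pfaces X" "f E \<subseteq> A" "E \<subseteq> F \<or> F \<subseteq> E" for E F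
  proof -
    have "f E \<inter> f F \<noteq> {}"
      using comparable[OF that(1,2)] that(4) image_pface[OF that(1)] image_pface[OF that(2)] by blast
    then have "f F \<inter> A \<noteq> {}" using that(3) by blast
    then show ?thesis using A image_pface[OF that(2)] unfolding closed_in_def by blast
  qed
  have meets: "f F \<subseteq> A" if F: "F \<in> pfaces X" "F \<inter> \<Union>{E \<in> pfaces X. f E \<subseteq> A} \<noteq> {}" for F
  proof -
    obtain v E where v: "v \<in> F" "v \<in> E" "E \<in> pfaces X" "f E \<subseteq> A" using F(2) by blast
    have "{v} \<in> pfaces X" using v(1) pface_ground[OF X F(1)] vertex_pface[OF X] by blast
    then show ?thesis using step[OF v(3) _ v(4), of "{v}"] step[OF _ F(1), of "{v}"] v by blast
  qed
  show "closed_in X (\<Union>{E \<in> pfaces X. f E \<subseteq> A})"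
    unfolding closed_in_def
  proof (intro conjI ballI impI)
    fix E assume E: "E \<in> faces X" "E \<inter> \<Union>{E \<in> pfaces X. f E \<subseteq> A} \<noteq> {}"
    then have "E \<in> pfaces X" by blast
    then show "E \<subseteq> \<Union>{E \<in> pfaces X. f E \<subseteq> A}" using meets E(2) by blast
  qed (use pface_ground[OF X] in blast)
  show "E \<in> pfaces X \<Longrightarrow> E \<subseteq> \<Union>{E \<in> pfaces X. f E \<subseteq> A} \<longleftrightarrow> f E \<subseteq> A"
    using meets by blast
qed

lemma comparability_iso_subcomplex_on:
  assumes "C \<subseteq> ground X" "D \<subseteq> ground Y" "\<And>E. E \<in> pfaces X \<Longrightarrow> E \<subseteq> C \<longleftrightarrow> f E \<subseteq> D"
  shows "comparability_iso (subcomplex_on X C) (subcomplex_on Y D) f"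
proof
  show "bij_betw f (pfaces (subcomplex_on X C)) (pfaces (subcomplex_on Y D))"
  proof (rule bij_betw_subset[OF bij])
    show "f ` pfaces (subcomplex_on X C) = pfaces (subcomplex_on Y D)"
    proof
      show "f ` pfaces (subcomplex_on X C) \<subseteq> pfaces (subcomplex_on Y D)"
        using image_pface assms(3) by auto
      show "pfaces (subcomplex_on Y D) \<subseteq> f ` pfaces (subcomplex_on X C)"
      proof
        fix G assume G: "G \<in> pfaces (subcomplex_on Y D)"
        then obtain E where E: "E \<in> pfaces X" "f E = G" using preimage_pface[of G] by auto
        then have "E \<in> pfaces (subcomplex_on X C)" using assms(3)[OF E(1)] G by simp
        then show "G \<in> f ` pfaces (subcomplex_on X C)" using E(2) by blast
      qed
    qed
  qed auto
qed (use assms(1,2) X Y comparable in \<open>simp_all add: simplicial_complex_subcomplex_on\<close>)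

text \<open>If the two inclusions had different directions, transitivity through \<open>f S\<close>
  would make \<open>f T\<close> and \<open>f T'\<close> comparable, although \<open>T\<close> and
  \<open>T'\<close> are not. The same argument below a common face gives
  \<open>lower_tie\<close>.\<close>

lemma upper_tie:
  assumes "S \<in> pfaces X" "T \<in> pfaces X" "T' \<in> pfaces X" "S \<subset> T" "S \<subset> T'" "\<not> T \<subseteq> T'" "\<not> T' \<subseteq> T"
  shows "f S \<subset> f T \<longleftrightarrow> f S \<subset> f T'"
  using comparable[OF assms(1,2)] comparable[OF assms(1,3)] comparable[OF assms(2,3)]
    image_eq_iff[OF assms(1,2)] image_eq_iff[OF assms(1,3)] assms(4-) by blast

lemma lower_tie:
  assumes "S \<in> pfaces X" "S' \<in> pfaces X" "T \<in> pfaces X" "S \<subset> T" "S' \<subset> T" "\<not> S \<subseteq> S'" "\<not> S' \<subseteq> S"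
  shows "f S \<subset> f T \<longleftrightarrow> f S' \<subset> f T"
  using comparable[OF assms(1,3)] comparable[OF assms(2,3)] comparable[OF assms(1,2)]
    image_eq_iff[OF assms(1,3)] image_eq_iff[OF assms(2,3)] assms(4-) by blast

text \<open>Every inclusion is tied to one of a vertex in an edge, and these are tied to each other
  along the connected 1-skeleton. The link is an edge leaving the face \<open>T\<close>, which is
  incomparable to \<open>T\<close>; such an edge exists for every face except one that is the whole
  ground set.\<close>

lemma uniform_orientation:
  assumes conn: "connected_complex X" and nonsimplex: "ground X \<notin> faces X"
  obtains b where "\<And>S T. S \<in> pfaces X \<Longrightarrow> T \<in> pfaces X \<Longrightarrow> S \<subset> T \<Longrightarrow> f S \<subset> f T \<longleftrightarrow> b"
proof -
  obtain a0 where a0: "a0 \<in> ground X" using conn by (auto simp: connected_complex_def)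
  then have "{a0} \<noteq> ground X" using nonsimplex vertex_pface[OF X a0] by auto
  then obtain c0 where c0: "c0 \<in> ground X - {a0}" "{a0, c0} \<in> faces X"
    using connected_boundary_edge[OF X conn, of "{a0}"] a0 by blast
  define b where "b \<longleftrightarrow> f {a0} \<subset> f {a0, c0}"
  have vert: "{u} \<in> pfaces X" if "{u, w} \<in> faces X" for u w
    using that X by (auto simp: simplicial_complex_def)
  have upper: "f {u} \<subset> f {u, v} \<longleftrightarrow> f {u} \<subset> f {u, w}"
    if "{u, v} \<in> faces X" "{u, w} \<in> faces X" "u \<noteq> v" "u \<noteq> w" for u v w
  proof (cases "v = w")
    case False
    show ?thesis by (rule upper_tie) (use that vert[OF that(1)] False in auto)
  qed simp
  \<comment> \<open>All edges at one vertex have the same direction by \<open>upper\<close>; the two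
    ends of an edge agree by \<open>lower_tie\<close>.\<close>
  have edge: "\<forall>w. w \<noteq> v \<and> {v, w} \<in> faces X \<longrightarrow> (f {v} \<subset> f {v, w} \<longleftrightarrow> b)" if v: "v \<in> ground X" for v
    using X conn v
  proof (induction rule: connected_induct[where a = a0])
    case ground
    show ?case by (rule a0)
  next
    case start
    show ?case
      unfolding b_def using c0 by (intro allI impI upper) auto
  next
    case (step u v)
    have "f {u} \<subset> f {u, v} \<longleftrightarrow> f {v} \<subset> f {u, v}"
      by (rule lower_tie) (use step vert[of u v] vert[of v u] in \<open>auto simp: insert_commute\<close>)
    then have "f {v} \<subset> f {v, u} \<longleftrightarrow> b" using step by (auto simp: insert_commute)
    then show ?case
      using upper[of v u] step(1,2) insert_commute[of u v "{}"] by metis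
  qed
  have "f S \<subset> f T \<longleftrightarrow> b" if ST: "S \<in> pfaces X" "T \<in> pfaces X" "S \<subset> T" for S T
  proof -
    have TX: "T \<subseteq> ground X" "T \<noteq> {}" "T \<noteq> ground X" using ST(2) pface_ground[OF X ST(2)] nonsimplex by auto
    obtain a c where ac: "a \<in> T" "c \<in> ground X - T" "{a, c} \<in> faces X"
      by (rule connected_boundary_edge[OF X conn TX])
    obtain a' where a': "a' \<in> T" "a' \<notin> S" using ST(3) by blast
    have P: "{a} \<in> pfaces X" "{a'} \<in> pfaces X" using vertex_pface[OF X] TX ac a' by blast+
    have T1: "\<not> T \<subseteq> {u}" for u using ST by blast
    \<comment> \<open>Below \<open>T\<close> the comparison moves from \<open>S\<close> to a vertex
      outside \<open>S\<close> and then to \<open>a\<close>; above \<open>{a}\<close> it moves from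
      \<open>T\<close> to the edge that leaves \<open>T\<close>.\<close>
    have "f S \<subset> f T \<longleftrightarrow> f {a'} \<subset> f T"
      by (rule lower_tie) (use ST a' P T1[of a'] in auto)
    also have "\<dots> \<longleftrightarrow> f {a} \<subset> f T"
    proof (cases "a = a'")
      case False
      show ?thesis by (rule lower_tie) (use ST a' ac P T1[of a'] T1[of a] False in auto)
    qed simp
    also have "\<dots> \<longleftrightarrow> f {a} \<subset> f {a, c}"
      by (rule upper_tie) (use ST ac P T1[of a] in auto)
    also have "\<dots> \<longleftrightarrow> b" using edge[rule_format, of a c] ac TX(1) by auto
    finally show ?thesis .
  qed
  then show ?thesis by (rule that)
qed

end

text \<open>A finite connected 2-regular graph is a cycle, and \<open>s\<close> rotates it by one
  step. A walk that never turns back is followed to its first repetition. The last property says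
  that the cycle has more than two vertices and makes the direction of rotation meaningful.\<close>

lemma two_regular_successor:
  fixes N :: "'a \<Rightarrow> 'a set"
  assumes fin: "finite V" and ne: "V \<noteq> {}"
    and N: "\<And>v. v \<in> V \<Longrightarrow> N v \<subseteq> V \<and> v \<notin> N v \<and> card (N v) = 2"
    and sym: "\<And>u v. u \<in> V \<Longrightarrow> v \<in> V \<Longrightarrow> u \<in> N v \<Longrightarrow> v \<in> N u"
    and conn: "\<And>A. A \<subseteq> V \<Longrightarrow> A \<noteq> {} \<Longrightarrow> (\<And>v. v \<in> A \<Longrightarrow> N v \<subseteq> A) \<Longrightarrow> A = V"
  obtains s where "bij_betw s V V" "\<And>v. v \<in> V \<Longrightarrow> s v \<in> N v" "\<And>v. v \<in> V \<Longrightarrow> s (s v) \<noteq> v"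
proof -
  obtain a where a: "a \<in> V" using ne by blast
  then obtain b where b: "b \<in> N a" using N[OF a] by (metis card.empty ex_in_conv zero_neq_numeral)
  have ex: "\<exists>w. w \<in> N v \<and> w \<noteq> u" if "v \<in> V" for u v
  proof (rule ccontr)
    assume "\<not> ?thesis"
    then have "N v \<subseteq> {u}" by blast
    then have "card (N v) \<le> card {u}" by (intro card_mono) auto
    then show False using N[OF that] by simp
  qed
  define nx where "nx u v = (SOME w. w \<in> N v \<and> w \<noteq> u)" for u v
  have nx: "nx u v \<in> N v \<and> nx u v \<noteq> u" if "v \<in> V" for u v
    unfolding nx_def by (rule someI_ex[OF ex[OF that]])
  \<comment> \<open>A walk that must not turn back needs its last two vertices as state;
    \<open>x i\<close> is the older of them.\<close>
  define st where "st i = ((\<lambda>(u, v). (v, nx u v)) ^^ i) (a, b)" for i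
  define x where "x i = fst (st i)" for i
  have st_Suc: "st (Suc i) = (snd (st i), nx (fst (st i)) (snd (st i)))" for i
    by (simp add: st_def case_prod_unfold)
  have x_Suc: "snd (st i) = x (Suc i)" for i by (simp add: x_def st_Suc)
  have x_SucSuc: "x (Suc (Suc i)) = nx (x i) (x (Suc i))" for i
    unfolding x_Suc[symmetric] st_Suc snd_conv by (simp add: x_def)
  have x01: "x 0 = a" "x (Suc 0) = b" using x_Suc[of 0] by (simp_all add: x_def st_def)
  have xV: "x i \<in> V \<and> x (Suc i) \<in> N (x i)" for i
  proof (induction i)
    case 0
    show ?case using a b by (simp add: x01)
  next
    case (Suc i)
    then have "x (Suc i) \<in> V" using N by blast
    then show ?case using nx by (simp add: x_SucSuc)
  qed
  have prev: "x i \<in> N (x (Suc i))" for i using sym xV by blast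
  have x2: "x (Suc (Suc i)) \<noteq> x i" for i using nx xV by (simp add: x_SucSuc)
  have loop: "x (Suc i) \<noteq> x i" for i using xV[of i] N by metis
  have pair: "N v = {p, q}" if "v \<in> V" "p \<in> N v" "q \<in> N v" "p \<noteq> q" for v p q
    using card_seteq[of "N v" "{p, q}"] N[OF that(1)] that fin by (auto intro: finite_subset)
  have nbrs: "N (x (Suc i)) = {x i, x (Suc (Suc i))}" for i
    by (rule pair) (use xV prev x2[of i] in \<open>auto simp: eq_commute\<close>)
  define R where "R j \<longleftrightarrow> (\<exists>i<j. x i = x j)" for j
  have "\<not> inj x"
  proof
    assume "inj x"
    then have "infinite (range x)" by (rule range_inj_infinite)
    moreover have "range x \<subseteq> V" using xV by blast
    ultimately show False using fin finite_subset by blast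
  qed
  then obtain i j where "i \<noteq> j" "x i = x j" by (auto simp: inj_def)
  then have "\<exists>j. R j" unfolding R_def by (metis linorder_neqE_nat)
  define j where "j = (LEAST j. R j)"
  have "R j" unfolding j_def using \<open>\<exists>j. R j\<close> by (rule LeastI_ex)
  then obtain i where i: "i < j" "x i = x j" by (auto simp: R_def)
  have least: "\<not> R k" if "k < j" for k using not_less_Least that unfolding j_def by blast
  have inj: "k = l" if "k < j" "l < j" "x k = x l" for k l
    using least[OF that(1)] least[OF that(2)] that(3) unfolding R_def by (metis linorder_neqE_nat)
  obtain j' where j': "j = Suc j'" using i(1) by (cases j) auto
  \<comment> \<open>If the first repetition hit a later point \<open>x i\<close> of the walk, then
    \<open>x j'\<close> would be one of the two known neighbours of \<open>x i\<close>. This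
    contradicts the minimality of \<open>j\<close>, the absence of backtracking, or the absence of
    loops.\<close>
  have "i = 0"
  proof (rule ccontr)
    assume "i \<noteq> 0"
    then obtain i' where i': "i = Suc i'" by (cases i) auto
    have "x j' \<in> N (x i)" using prev[of j'] i(2) j' by simp
    then consider "x j' = x i'" | "x j' = x (Suc i)" using nbrs[of i'] i' by auto
    then show False
    proof cases
      case 1
      then show False using inj[of j' i'] i(1) i' j' by simp
    next
      case 2
      show False
      proof (cases "Suc i < j")
        case True
        then have "j' = Suc i" using inj[of j' "Suc i"] 2 j' by simp
        then show False using x2[of i] i(2) j' by simp
      next
        case False
        then have "Suc i = j" using i(1) by simp
        then show False using loop[of j'] 2 j' by simp
      qed
    qed
  qed
  then have xj: "x j = x 0" using i(2) by simp
  \<comment> \<open>Returning after one step would be a loop and after two steps a reversal.\<close>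
  have "j \<noteq> Suc 0" "j \<noteq> Suc (Suc 0)" using xj loop[of 0] x2[of 0] by metis+
  then have j3: "Suc (Suc 0) < j" using i(1) by linarith
  have N0: "N (x 0) = {x (Suc 0), x j'}"
  proof (rule pair)
    show "x j' \<in> N (x 0)" using prev[of j'] xj j' by simp
    show "x (Suc 0) \<noteq> x j'" using inj[of "Suc 0" j'] j3 j' by auto
  qed (use xV in auto)
  have V: "V = x ` {..<j}"
  proof (rule conn[symmetric])
    fix v assume "v \<in> x ` {..<j}"
    then obtain k where k: "k < j" "v = x k" by blast
    show "N v \<subseteq> x ` {..<j}"
    proof (cases k)
      case 0
      then show ?thesis using N0 k j3 j' by auto
    next
      case (Suc k')
      have "x (Suc k) \<in> x ` {..<j}"
      proof (cases "Suc k < j")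
        case False
        then have "x (Suc k) = x 0" using k xj by (metis Suc_lessI)
        then show ?thesis using j3 by auto
      qed simp
      then show ?thesis using nbrs[of k'] k Suc by auto
    qed
  qed (use xV j3 in auto)
  define s where "s v = x (Suc (the_inv_into {..<j} x v))" for v
  have s: "s (x k) = x (Suc k)" if "k < j" for k
    using that inj by (simp add: s_def the_inv_into_f_f inj_on_def)
  have "s ` V = V"
  proof
    show "s ` V \<subseteq> V" using V s xV by auto
    show "V \<subseteq> s ` V"
    proof
      fix v assume "v \<in> V"
      then obtain k where k: "k < j" "v = x k" using V by blast
      show "v \<in> s ` V"
      proof (cases k)
        case 0
        then have "v = s (x j')" using s[of j'] j' xj k by simp
        then show ?thesis using xV by blast
      next
        case (Suc k')
        then have "v = s (x k')" using s[of k'] k by simp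
        then show ?thesis using xV by blast
      qed
    qed
  qed
  then have "bij_betw s V V" using fin by (simp add: bij_betw_def eq_card_imp_inj_on)
  moreover have "s v \<in> N v" if "v \<in> V" for v
    using that V s xV by auto
  moreover have "s (s v) \<noteq> v" if "v \<in> V" for v
  proof -
    obtain k where k: "k < j" "v = x k" using \<open>v \<in> V\<close> V by blast
    show ?thesis
    proof (cases "Suc k < j")
      case True
      then show ?thesis using s k x2[of k] by simp
    next
      case False
      then have "Suc k = j" using k(1) by simp
      then have "s (s v) = x (Suc 0)" using s[OF k(1)] s[of 0] k xj j3 by simp
      moreover have "x (Suc 0) \<noteq> x k" using inj[of "Suc 0" k] k(1) j3 \<open>Suc k = j\<close> by auto
      ultimately show ?thesis using k by simp
    qed
  qed
  ultimately show ?thesis by (rule that)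
qed

text \<open>The nonempty faces are the vertices and edges of a cycle. The map sends a vertex to the
  edge following it and an edge to its far end. It reverses inclusion: the two edges at
  \<open>v\<close> go to \<open>v\<close> and \<open>s v\<close>, the two ends of the edge assigned
  to \<open>v\<close>.\<close>

lemma anti_automorphism_two_regular:
  assumes X: "simplicial_complex X" "connected_complex X" and fin: "finite (ground X)"
    and dim: "\<And>S. S \<in> pfaces X \<Longrightarrow> card S \<le> 2"
    and deg: "\<And>v. v \<in> ground X \<Longrightarrow> card {u. u \<noteq> v \<and> {v, u} \<in> faces X} = 2"
  obtains c where "bij_betw c (pfaces X) (pfaces X)"
    "\<And>S T. S \<in> pfaces X \<Longrightarrow> T \<in> pfaces X \<Longrightarrow> S \<subseteq> T \<longleftrightarrow> c T \<subseteq> c S"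
proof -
  let ?V = "ground X" and ?N = "\<lambda>v. {u. u \<noteq> v \<and> {v, u} \<in> faces X}"
  have NV: "u \<in> ?V" if "u \<in> ?N v" for u v using that X(1) by (auto simp: simplicial_complex_def)
  obtain s where s: "bij_betw s ?V ?V" "\<And>v. v \<in> ?V \<Longrightarrow> s v \<in> ?N v" "\<And>v. v \<in> ?V \<Longrightarrow> s (s v) \<noteq> v"
  proof (rule two_regular_successor[of ?V ?N])
    show "A = ?V" if A: "A \<subseteq> ?V" "A \<noteq> {}" "\<And>v. v \<in> A \<Longrightarrow> ?N v \<subseteq> A" for A
    proof (rule ccontr)
      assume "A \<noteq> ?V"
      then obtain a c where "a \<in> A" "c \<in> ?V - A" "{a, c} \<in> faces X"
        using connected_boundary_edge[OF X A(1,2)] by blast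
      then show False using A(3)[of a] by auto
    qed
    show "?N v \<subseteq> ?V \<and> v \<notin> ?N v \<and> card (?N v) = 2" if "v \<in> ?V" for v
      using NV deg[OF that] by auto
  qed (use X(2) fin in \<open>auto simp: connected_complex_def insert_commute\<close>)
  have sV: "s v \<in> ?V" if "v \<in> ?V" for v using bij_betwE[OF s(1)] that by blast
  have sinj: "s u = s v \<longleftrightarrow> u = v" if "u \<in> ?V" "v \<in> ?V" for u v
    using inj_on_eq_iff[OF bij_betw_imp_inj_on[OF s(1)] that] .
  have sne: "s v \<noteq> v" if "v \<in> ?V" for v using s(2)[OF that] by simp
  have spred: "\<exists>p\<in>?V. s p = v" if "v \<in> ?V" for v
    using bij_betw_imp_surj_on[OF s(1)] that by (metis imageE)
  have edge: "{v, s v} \<in> pfaces X" if "v \<in> ?V" for v using s(2)[OF that] by simp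
  \<comment> \<open>The two neighbours of \<open>v\<close> are \<open>s v\<close> and the
    predecessor \<open>p\<close> of \<open>v\<close>, so every edge has the form
    \<open>{v, s v}\<close> for a suitable starting point.\<close>
  have cases: "\<exists>v\<in>?V. S = {v} \<or> S = {v, s v}" if S: "S \<in> pfaces X" for S
  proof -
    obtain v where v: "v \<in> S" using S by blast
    then have vV: "v \<in> ?V" using pface_ground[OF X(1) S] by blast
    have finS: "finite S" using fin pface_ground[OF X(1) S] by (rule rev_finite_subset)
    show ?thesis
    proof (cases "S = {v}")
      case False
      then obtain u where u: "u \<in> S" "u \<noteq> v" using v by blast
      then have "S = {v, u}" using card_seteq[OF finS, of "{v, u}"] dim[OF S] v by auto
      then have uN: "u \<in> ?N v" using S u by auto
      obtain p where p: "p \<in> ?V" "s p = v" using spred[OF vV] by blast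
      have "p \<in> ?N v" using s(2)[OF p(1)] p(2) by (auto simp: insert_commute)
      moreover have "p \<noteq> s v" using s(3)[OF p(1)] p(2) by auto
      moreover have "finite (?N v)" using NV fin by (meson finite_subset subsetI)
      ultimately have "{s v, p} = ?N v"
        using s(2)[OF vV] deg[OF vV] by (intro card_seteq) auto
      then have "u = s v \<or> u = p" using uN by blast
      then show ?thesis
      proof
        assume "u = p"
        then have "S = {p, s p}" unfolding \<open>S = {v, u}\<close> \<open>u = p\<close> p(2) by blast
        then show ?thesis using p(1) by blast
      qed (use \<open>S = {v, u}\<close> vV in blast)
    qed (use vV in blast)
  qed
  \<comment> \<open>For an edge \<open>{v, s v}\<close> the intersection with its image under
    \<open>s\<close> is \<open>{s v}\<close>, so the formula finds the far end without being told
    where the edge starts.\<close>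
  define c where "c S = (if \<exists>v. S = {v} then S \<union> s ` S else S \<inter> s ` S)" for S
  have c1: "c {v} = {v, s v}" for v by (auto simp: c_def)
  have c2: "c {v, s v} = {s v}" if "v \<in> ?V" for v
  proof -
    have "\<not> (\<exists>u. {v, s v} = {u})" using sne[OF that] by auto
    moreover have "v \<noteq> s (s v)" using s(3)[OF that] by simp
    ultimately show ?thesis using sne[OF that] by (auto simp: c_def)
  qed
  note PX = vertex_pface[OF X(1)]
  have "c ` pfaces X = pfaces X"
  proof
    show "c ` pfaces X \<subseteq> pfaces X"
    proof (rule image_subsetI)
      fix S assume "S \<in> pfaces X"
      then show "c S \<in> pfaces X" using cases[of S] c1 c2 edge PX sV by force
    qed
    show "pfaces X \<subseteq> c ` pfaces X"
    proof
      fix S assume "S \<in> pfaces X"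
      then obtain v where v: "v \<in> ?V" "S = {v} \<or> S = {v, s v}" using cases by blast
      obtain p where p: "p \<in> ?V" "s p = v" using spred[OF v(1)] by blast
      show "S \<in> c ` pfaces X"
        using v(2)
      proof
        assume "S = {v}"
        then have "S = c {p, s p}" using c2[OF p(1)] p(2) by simp
        then show ?thesis using edge[OF p(1)] by blast
      next
        assume "S = {v, s v}"
        then have "S = c {v}" by (simp add: c1)
        then show ?thesis using PX[OF v(1)] by blast
      qed
    qed
  qed
  moreover have "finite (pfaces X)"
    by (rule finite_subset[of _ "Pow ?V"]) (use pface_ground[OF X(1)] fin in auto)
  ultimately have "bij_betw c (pfaces X) (pfaces X)" by (simp add: bij_betw_def eq_card_imp_inj_on)
  moreover have "S \<subseteq> T \<longleftrightarrow> c T \<subseteq> c S" if ST: "S \<in> pfaces X" "T \<in> pfaces X" for S T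
  proof -
    obtain u v where uv: "u \<in> ?V" "S = {u} \<or> S = {u, s u}" "v \<in> ?V" "T = {v} \<or> T = {v, s v}"
      using cases[OF ST(1)] cases[OF ST(2)] by blast
    note facts = sne[OF uv(1)] sne[OF uv(3)] s(3)[OF uv(1)] s(3)[OF uv(3)] sinj[OF uv(1,3)]
      c1[of u] c1[of v] c2[OF uv(1)] c2[OF uv(3)] sne[OF sV[OF uv(1)]] sne[OF sV[OF uv(3)]]
    from uv(2,4) show ?thesis
      by (elim disjE) (use facts in auto)
  qed
  ultimately show ?thesis by (rule that)
qed

context comparability_iso begin

text \<open>
  The faces containing a vertex \<open>v\<close> correspond to the nonempty subsets of the facet \<open>f {v}\<close>, so
  that \<open>n v w\<close> below is the neighbour of \<open>v\<close> opposite to \<open>w \<in> f {v}\<close>.  Its number of neighbours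
  \<open>k\<close> does not depend on \<open>v\<close>, with \<open>k = 2\<close> for cycles and \<open>k \<ge> 3\<close> for boundaries of simplices.
\<close>

lemma anti_iso_imp_complex_iso:
  assumes conn: "connected_complex X" and nonsimplex: "ground X \<notin> faces X"
    and fin: "finite (ground X)" "finite (ground Y)" and empty: "{} \<in> faces X" "{} \<in> faces Y"
    and anti: "\<And>S T. S \<in> pfaces X \<Longrightarrow> T \<in> pfaces X \<Longrightarrow> S \<subseteq> T \<longleftrightarrow> f T \<subseteq> f S"
  shows "\<exists>g. complex_iso g X Y"
proof -
  note PX = vertex_pface[OF X] and sub = pface_subset[OF X] and fP = image_pface
  have finf: "finite (f S)" if "S \<in> pfaces X" for S
    using pface_ground[OF Y fP[OF that]] fin(2) by (rule finite_subset)
  \<comment> \<open>Edges at \<open>u\<close> are the minimal faces properly above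
    \<open>{u}\<close>, so under the reversal their images are the maximal proper faces of
    \<open>f {u}\<close>.\<close>
  have coatom: "\<exists>w\<in>f {u}. f {u, v} = f {u} - {w}" if uv: "u \<noteq> v" "{u, v} \<in> faces X" for u v
  proof -
    have P: "{u} \<in> pfaces X" "{u, v} \<in> pfaces X" using uv sub[of "{u, v}" "{u}"] by auto
    have ss: "f {u, v} \<subset> f {u}" using anti[OF P] anti[OF P(2,1)] uv(1) by auto
    then obtain w where w: "w \<in> f {u}" "w \<notin> f {u, v}" by blast
    then have "f {u} - {w} \<in> pfaces Y"
      using fP[OF P(2)] ss by (intro pface_subset[OF Y fP[OF P(1)]]) auto
    then obtain S where S: "S \<in> pfaces X" "f S = f {u} - {w}" by (rule preimage_pface)
    have "u \<in> S" using anti[OF P(1) S(1)] S(2) by simp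
    moreover have "S \<subseteq> {u, v}" using anti[OF S(1) P(2)] S(2) ss w by auto
    moreover have "S \<noteq> {u}" using S(2) w by auto
    ultimately have "S = {u, v}" by blast
    then show ?thesis using S w by blast
  qed
  \<comment> \<open>Conversely, removing one vertex from \<open>f {u}\<close> yields the image of an
    edge at \<open>u\<close>, provided that something nonempty is left.\<close>
  have edge: "\<exists>v. v \<noteq> u \<and> {u, v} \<in> faces X \<and> f {u, v} = f {u} - {w}"
    if u: "u \<in> ground X" and w: "w \<in> f {u}" and two: "2 \<le> card (f {u})" for u w
  proof -
    have "\<not> f {u} \<subseteq> {w}" using two card_mono[of "{w}" "f {u}"] by auto
    then have "f {u} - {w} \<in> pfaces Y" by (intro pface_subset[OF Y fP[OF PX[OF u]]]) auto
    then obtain S where S: "S \<in> pfaces X" "f S = f {u} - {w}" by (rule preimage_pface)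
    have uS: "u \<in> S" using anti[OF PX[OF u] S(1)] S(2) by auto
    have "S \<noteq> {u}" using S(2) w by auto
    then obtain v where v: "v \<in> S" "v \<noteq> u" using uS by blast
    have P: "{u, v} \<in> pfaces X" using uS v by (intro sub[OF S(1)]) auto
    have "f S \<subseteq> f {u, v}" using anti[OF P S(1)] uS v by simp
    moreover have "f {u, v} \<subset> f {u}" using anti[OF PX[OF u] P] anti[OF P PX[OF u]] v(2) by auto
    ultimately have "f {u, v} = f {u} - {w}" using S(2) by blast
    then show ?thesis using P v by blast
  qed
  obtain a where a: "a \<in> ground X" using conn by (auto simp: connected_complex_def)
  define k where "k = card (f {a})"
  \<comment> \<open>The right-hand side depends on the edge alone, so both ends have images of equal
    size, and connectedness makes this size constant.\<close>
  have card_edge: "card (f {u}) = Suc (card (f {u, v}))" if uv: "u \<noteq> v" "{u, v} \<in> faces X" for u v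
  proof -
    have "{u} \<in> pfaces X" using sub[of "{u, v}" "{u}"] uv by auto
    moreover obtain w where "w \<in> f {u}" "f {u, v} = f {u} - {w}" using coatom[OF uv] by blast
    ultimately show ?thesis using card.remove[of "f {u}" w] finf[of "{u}"] by simp
  qed
  have k: "card (f {v}) = k" if "v \<in> ground X" for v
    using X conn that
  proof (induction rule: connected_induct[where a = a])
    case (step u v)
    then show ?case using card_edge[of u v] card_edge[of v u] by (simp add: insert_commute)
  qed (simp_all add: a k_def)
  have "{a} \<noteq> ground X" using nonsimplex PX[OF a] by auto
  then obtain c where c: "c \<noteq> a" "{a, c} \<in> faces X"
    using connected_boundary_edge[OF X conn, of "{a}"] a by blast
  then have "card (f {a, c}) \<noteq> 0" using finf[of "{a, c}"] fP[of "{a, c}"] by auto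
  then have k2: "2 \<le> k" using card_edge[of a c] c by (simp add: k_def)
  have "\<exists>n. \<forall>w\<in>f {v}. n w \<noteq> v \<and> {v, n w} \<in> faces X \<and> f {v, n w} = f {v} - {w}" if "v \<in> ground X" for v
    using edge[OF that] k[OF that] k2 by metis
  then obtain n where n: "\<And>v w. v \<in> ground X \<Longrightarrow> w \<in> f {v} \<Longrightarrow>
      n v w \<noteq> v \<and> {v, n v w} \<in> faces X \<and> f {v, n v w} = f {v} - {w}" by metis
  let ?N = "\<lambda>v. {u. u \<noteq> v \<and> {v, u} \<in> faces X}"
  have Nim: "?N v = n v ` f {v}" if v: "v \<in> ground X" for v
  proof
    show "?N v \<subseteq> n v ` f {v}"
    proof
      fix u assume u: "u \<in> ?N v"
      then obtain w where w: "w \<in> f {v}" "f {v, u} = f {v} - {w}" using coatom[of v u] by auto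
      then have "{v, u} = {v, n v w}" using n[OF v w(1)] u image_eq_iff[of "{v, u}" "{v, n v w}"] by auto
      then have "u = n v w" using u by (auto simp: doubleton_eq_iff)
      then show "u \<in> n v ` f {v}" using w by blast
    qed
  qed (use n[OF v] in auto)
  have n_inj: "inj_on (n v) (f {v})" if v: "v \<in> ground X" for v
  proof (rule inj_onI)
    fix w w' assume w: "w \<in> f {v}" "w' \<in> f {v}" "n v w = n v w'"
    then have "f {v} - {w} = f {v} - {w'}" using n[OF v w(1)] n[OF v w(2)] by simp
    then show "w = w'" using w by blast
  qed
  have cardN: "card (?N v) = k" if v: "v \<in> ground X" for v
    unfolding Nim[OF v] using card_image[OF n_inj[OF v]] k[OF v] by simp
  have "\<exists>c. bij_betw c (pfaces X) (pfaces X) \<and>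
      (\<forall>S\<in>pfaces X. \<forall>T\<in>pfaces X. S \<subseteq> T \<longleftrightarrow> c T \<subseteq> c S)"
  proof (cases "k = 2")
    case True
    \<comment> \<open>\<open>f S\<close> is a nonempty subset of the two-element set
      \<open>f {v}\<close>: either all of it, or one point, which is the image of an edge at
      \<open>v\<close>.\<close>
    have "card S \<le> 2" if S: "S \<in> pfaces X" for S
    proof -
      obtain v where v: "v \<in> S" using S by blast
      then have vV: "v \<in> ground X" using pface_ground[OF X S] by blast
      have "f S \<subseteq> f {v}" using anti[OF PX[OF vV] S] v by simp
      show ?thesis
      proof (cases "f S = f {v}")
        case True
        then have "S = {v}" using image_eq_iff[OF S PX[OF vV]] by simp
        then show ?thesis by simp
      next
        case False
        then obtain w where w: "w \<in> f {v}" "w \<notin> f S" using \<open>f S \<subseteq> f {v}\<close> by blast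
        have "card (f {v} - {w}) = 1" using w k[OF vV] \<open>k = 2\<close> by simp
        then obtain x where x: "f {v} - {w} = {x}" by (rule card_1_singletonE)
        then have "f S = f {v} - {w}" using w \<open>f S \<subseteq> f {v}\<close> fP[OF S] by auto
        then have "f S = f {v, n v w}" "{v, n v w} \<in> pfaces X" using n[OF vV w(1)] by simp_all
        then have "S = {v, n v w}" using image_eq_iff[OF S] by blast
        then show ?thesis by (simp add: card_insert_if)
      qed
    qed
    from anti_automorphism_two_regular[OF X conn fin(1) this] cardN True show ?thesis by (metis (no_types, lifting))
  next
    case False
    then have k3: "3 \<le> k" using k2 by simp
    \<comment> \<open>At least three vertices in \<open>f {v}\<close> allow two to be removed; the
      face with the remaining image contains \<open>v\<close> and both neighbours.\<close>
    have clique: "{n v w, n v w'} \<in> faces X" if v: "v \<in> ground X" and w: "w \<in> f {v}" "w' \<in> f {v}" for v w w'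
    proof -
      have "\<not> f {v} \<subseteq> {w, w'}"
        using k3 k[OF v] card_mono[of "{w, w'}" "f {v}"] card_insert_le_m1[of 2 "{w'}" w] by auto
      then have "f {v} - {w, w'} \<in> pfaces Y" by (intro pface_subset[OF Y fP[OF PX[OF v]]]) auto
      then obtain T where T: "T \<in> pfaces X" "f T = f {v} - {w, w'}" by (rule preimage_pface)
      have "{v, n v w} \<subseteq> T" using anti[of "{v, n v w}" T] n[OF v w(1)] T by auto
      moreover have "{v, n v w'} \<subseteq> T" using anti[of "{v, n v w'}" T] n[OF v w(2)] T by auto
      ultimately show ?thesis using sub[OF T(1), of "{n v w, n v w'}"] by simp
    qed
    have ground: "ground X = insert v (?N v)" if v: "v \<in> ground X" for v
    proof
      have finN: "finite (?N u)" if "u \<in> ground X" for u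
        unfolding Nim[OF that] by (rule finite_imageI[OF finf[OF PX[OF that]]])
      have NV: "u \<in> ground X" if "u \<in> ?N v" for u v using that X by (auto simp: simplicial_complex_def)
      show "insert v (?N v) \<subseteq> ground X" using v NV by blast
      \<comment> \<open>The right-hand side consists of neighbours of \<open>u\<close> by
        \<open>clique\<close>, and it already has \<open>k\<close> elements. Thus \<open>u\<close>
        and \<open>v\<close> have the same closed neighbourhood, which connectedness then extends to
        the whole ground set.\<close>
      have nbr: "?N u = insert v (?N v - {u})" if u: "u \<in> ?N v" for u
      proof (rule card_seteq[symmetric])
        show "finite (?N u)" by (rule finN[OF NV[OF u]])
        have "{u, x} \<in> faces X" if "x \<in> ?N v" for x
          using clique[OF v] u that unfolding Nim[OF v] by blast
        then show "insert v (?N v - {u}) \<subseteq> ?N u" using u by (auto simp: insert_commute)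
        have "card (insert v (?N v - {u})) = Suc (card (?N v - {u}))" using finN[OF v] by simp
        also have "\<dots> = card (?N v)" using card.remove[OF finN[OF v] u] by simp
        finally show "card (?N u) \<le> card (insert v (?N v - {u}))" using cardN v NV[OF u] by simp
      qed
      show "ground X \<subseteq> insert v (?N v)"
      proof
        fix x assume "x \<in> ground X"
        with X conn show "x \<in> insert v (?N v)"
        proof (induction rule: connected_induct[where a = v])
          case (step x y)
          then have "y \<in> ?N x" by simp
          then show ?case using nbr[of x] step(3) by auto
        qed (use v in auto)
      qed
    qed
    \<comment> \<open>The face with image \<open>{w}\<close> contains \<open>v\<close> and all its
      neighbours except the one opposite to \<open>w\<close>, and \<open>v\<close> is chosen so that
      this exception is \<open>u\<close>.\<close>
    have ridge: "ground X - {u} \<in> faces X" if u: "u \<in> ground X" for u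
    proof -
      have "{u} \<noteq> ground X" using nonsimplex PX[OF u] by auto
      then obtain v where v: "v \<in> ground X" "v \<noteq> u" using u by blast
      then have "u \<in> ?N v" using equalityD1[OF ground[OF v(1)]] u by blast
      then obtain w where w: "w \<in> f {v}" "u = n v w" unfolding Nim[OF v(1)] by blast
      have "{w} \<in> pfaces Y" using w by (intro pface_subset[OF Y fP[OF PX[OF v(1)]]]) auto
      then obtain T where T: "T \<in> pfaces X" "f T = {w}" by (rule preimage_pface)
      have "v \<in> T" using anti[OF PX[OF v(1)] T(1)] T(2) w by simp
      moreover have "n v x \<in> T" if x: "x \<in> f {v}" "x \<noteq> w" for x
        using anti[of "{v, n v x}" T] n[OF v(1) x(1)] T w x by auto
      ultimately have "ground X - {u} \<subseteq> T"
        using equalityD1[OF ground[OF v(1)]] w unfolding Nim[OF v(1)] by blast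
      moreover have "u \<notin> T"
      proof
        assume "u \<in> T"
        then have "{v, u} \<subseteq> T" using \<open>v \<in> T\<close> by simp
        then have "w \<in> f {v, u}" using anti[of "{v, u}" T] \<open>u \<in> ?N v\<close> T by auto
        then show False using n[OF v(1) w(1)] w by simp
      qed
      ultimately have "ground X - {u} = T" using pface_ground[OF X T(1)] by blast
      then show ?thesis using T by simp
    qed
    have P: "S \<in> pfaces X \<longleftrightarrow> S \<subseteq> ground X \<and> S \<noteq> {} \<and> S \<noteq> ground X" for S
    proof
      assume S: "S \<subseteq> ground X \<and> S \<noteq> {} \<and> S \<noteq> ground X"
      then obtain u where u: "u \<in> ground X" "u \<notin> S" by blast
      then have "S \<subseteq> ground X - {u}" using S by blast
      then show "S \<in> pfaces X" using ridge[OF u(1)] S X unfolding simplicial_complex_def by blast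
    qed (use pface_ground[OF X] nonsimplex in blast)
    have compl: "ground X - S \<in> pfaces X" if "S \<in> pfaces X" for S
      using that unfolding P by blast
    have "bij_betw (\<lambda>S. ground X - S) (pfaces X) (pfaces X)"
    proof (rule bij_betw_byWitness[where f' = "\<lambda>S. ground X - S"])
      show "\<forall>S\<in>pfaces X. ground X - (ground X - S) = S" "\<forall>S\<in>pfaces X. ground X - (ground X - S) = S"
        using pface_ground[OF X] by (simp_all add: double_diff)
      show "(\<lambda>S. ground X - S) ` pfaces X \<subseteq> pfaces X" "(\<lambda>S. ground X - S) ` pfaces X \<subseteq> pfaces X"
        using compl by (auto simp only: image_subset_iff)
    qed
    moreover have "\<forall>S\<in>pfaces X. \<forall>T\<in>pfaces X. S \<subseteq> T \<longleftrightarrow> ground X - T \<subseteq> ground X - S"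
      using pface_ground[OF X] by blast
    ultimately show ?thesis by blast
  qed
  then obtain c where c: "bij_betw c (pfaces X) (pfaces X)"
    "\<forall>S\<in>pfaces X. \<forall>T\<in>pfaces X. S \<subseteq> T \<longleftrightarrow> c T \<subseteq> c S" by (elim exE conjE)
  show ?thesis
  proof (rule face_order_iso_imp_complex_iso[OF X Y empty bij_betw_trans[OF c(1) bij]])
    fix S T assume ST: "S \<in> pfaces X" "T \<in> pfaces X"
    then have "c S \<in> pfaces X" "c T \<in> pfaces X" using bij_betwE[OF c(1)] by blast+
    then show "S \<subseteq> T \<longleftrightarrow> (f \<circ> c) S \<subseteq> (f \<circ> c) T" using anti[of "c T" "c S"] c(2)[rule_format, OF ST] by simp
  qed
qed

text \<open>The image of the top face is comparable to every vertex of \<open>Y\<close> and so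
  contains all of them. Hence \<open>Y\<close> is a simplex too, and counting nonempty faces gives
  equal dimensions; \<open>f\<close> itself is then discarded.\<close>

lemma simplex_imp_complex_iso:
  assumes ne: "ground X \<noteq> {}" and simplex: "ground X \<in> faces X"
    and fin: "finite (ground X)" "finite (ground Y)"
  shows "\<exists>g. complex_iso g X Y"
proof -
  have t: "f (ground X) \<in> pfaces Y" using image_pface ne simplex by simp
  have "ground Y \<subseteq> f (ground X)"
  proof
    fix w assume "w \<in> ground Y"
    then have w: "{w} \<in> pfaces Y" by (rule vertex_pface[OF Y])
    then obtain E where E: "E \<in> pfaces X" "f E = {w}" by (rule preimage_pface)
    then have "f (ground X) \<subseteq> {w} \<or> {w} \<subseteq> f (ground X)"
      using comparable[of E "ground X"] pface_ground[OF X E(1)] ne simplex by auto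
    then show "w \<in> f (ground X)" using t by blast
  qed
  then have "f (ground X) = ground Y" using pface_ground[OF Y t] by blast
  then have Y_simplex: "ground Y \<in> faces Y" using t by simp
  have faces: "faces Z = Pow (ground Z)" if "simplicial_complex Z" "ground Z \<in> faces Z" for Z :: "'c set_system"
    using that unfolding simplicial_complex_def by blast
  have card: "card (pfaces Z) = 2 ^ card (ground Z) - 1"
    if "simplicial_complex Z" "ground Z \<in> faces Z" "finite (ground Z)" for Z :: "'c set_system"
    using faces[OF that(1,2)] that(3) by (simp add: card_Pow)
  have "(2::nat) ^ card (ground X) - 1 = 2 ^ card (ground Y) - 1"
    using card[OF X simplex fin(1)] card[OF Y Y_simplex fin(2)] bij_betw_same_card[OF bij] by simp
  then have "(2::nat) ^ card (ground X) = 2 ^ card (ground Y)"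
    by (metis One_nat_def Suc_diff_1 zero_less_numeral zero_less_power)
  then have "card (ground X) = card (ground Y)" by simp
  then obtain g where g: "bij_betw g (ground X) (ground Y)" using finite_same_card_bij[OF fin] by blast
  then have "complex_iso g X Y"
    using bij_betw_imp_surj_on[OF g] faces[OF X simplex] faces[OF Y Y_simplex]
    unfolding complex_iso_def by blast
  then show ?thesis by blast
qed

lemma connected_imp_complex_iso:
  assumes conn: "connected_complex X" and fin: "finite (ground X)" "finite (ground Y)"
    and empty: "{} \<in> faces X" "{} \<in> faces Y"
  shows "\<exists>g. complex_iso g X Y"
proof (cases "ground X \<in> faces X")
  case True
  then show ?thesis using simplex_imp_complex_iso conn fin by (simp add: connected_complex_def)
next
  case False
  obtain b where b: "\<And>S T. S \<in> pfaces X \<Longrightarrow> T \<in> pfaces X \<Longrightarrow> S \<subset> T \<Longrightarrow> f S \<subset> f T \<longleftrightarrow> b"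
    using uniform_orientation[OF conn False] by blast
  show ?thesis
  proof (cases b)
    case True
    show ?thesis
    proof (rule face_order_iso_imp_complex_iso[OF X Y empty bij])
      fix S T assume ST: "S \<in> pfaces X" "T \<in> pfaces X"
      show "S \<subseteq> T \<longleftrightarrow> f S \<subseteq> f T"
        using b[OF ST] b[OF ST(2,1)] comparable[OF ST] image_eq_iff[OF ST] True by blast
    qed
  next
    case b_false: False
    show ?thesis
    proof (rule anti_iso_imp_complex_iso[OF conn False fin empty])
      fix S T assume ST: "S \<in> pfaces X" "T \<in> pfaces X"
      show "S \<subseteq> T \<longleftrightarrow> f T \<subseteq> f S"
        using b[OF ST] b[OF ST(2,1)] comparable[OF ST] image_eq_iff[OF ST] b_false by blast
    qed
  qed
qed

end

section \<open>Decomposition into components\<close>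

lemma complex_iso_glue:
  assumes X: "simplicial_complex X" "closed_in X C" and Y: "simplicial_complex Y" "closed_in Y D"
    and g: "complex_iso g (subcomplex_on X C) (subcomplex_on Y D)"
    and h: "complex_iso h (subcomplex_on X (ground X - C)) (subcomplex_on Y (ground Y - D))"
  shows "complex_iso (\<lambda>v. if v \<in> C then g v else h v) X Y"
  unfolding complex_iso_def
proof (intro conjI allI impI)
  let ?k = "\<lambda>v. if v \<in> C then g v else h v"
  let ?C' = "ground X - C" and ?D' = "ground Y - D"
  have CD: "C \<subseteq> ground X" "D \<subseteq> ground Y" using X Y by (auto simp: closed_in_def)
  have gh: "bij_betw g C D" "bij_betw h ?C' ?D'" using g h by (simp_all add: complex_iso_def)
  have "bij_betw ?k C D" using gh(1) bij_betw_cong[of C ?k g] by simp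
  moreover have "bij_betw ?k ?C' ?D'" using gh(2) bij_betw_cong[of ?C' ?k h] by simp
  ultimately have "bij_betw ?k (C \<union> ?C') (D \<union> ?D')" by (rule bij_betw_combine) auto
  moreover have "C \<union> ?C' = ground X" "D \<union> ?D' = ground Y" using CD by auto
  ultimately show "bij_betw ?k (ground X) (ground Y)" by simp
  fix E assume E: "E \<subseteq> ground X"
  have gD: "g v \<in> D" if "v \<in> C" for v using bij_betwE[OF gh(1)] that by blast
  have hD: "h v \<in> ?D'" if "v \<in> ?C'" for v using bij_betwE[OF gh(2)] that by blast
  consider "E \<subseteq> C" | "E \<subseteq> ?C'" | u v where "u \<in> E \<inter> C" "v \<in> E - C" using E by blast
  then show "E \<in> faces X \<longleftrightarrow> ?k ` E \<in> faces Y"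
  proof cases
    case 1
    then have "?k ` E = g ` E" by (intro image_cong) auto
    moreover have "g ` E \<subseteq> D" using 1 gD by blast
    moreover have "E \<in> faces (subcomplex_on X C) \<longleftrightarrow> g ` E \<in> faces (subcomplex_on Y D)"
      using g 1 unfolding complex_iso_def by simp
    ultimately show ?thesis using 1 by simp
  next
    case 2
    then have "?k ` E = h ` E" by (intro image_cong) auto
    moreover have "h ` E \<subseteq> ?D'" using 2 hD by blast
    moreover have "E \<in> faces (subcomplex_on X ?C') \<longleftrightarrow> h ` E \<in> faces (subcomplex_on Y ?D')"
      using h 2 unfolding complex_iso_def by simp
    ultimately show ?thesis using 2 by simp
  next
    case 3
    have "E \<notin> faces X" using X(2) 3 by (auto simp: closed_in_def)
    moreover have "g u \<in> ?k ` E" "h v \<in> ?k ` E" using 3 by (auto intro: rev_image_eqI)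
    moreover have "g u \<in> D" "h v \<notin> D" using 3 E gD[of u] hD[of v] by auto
    ultimately have "?k ` E \<inter> D \<noteq> {}" "\<not> ?k ` E \<subseteq> D" by blast+
    then have "?k ` E \<notin> faces Y" using Y(2) unfolding closed_in_def by metis
    then show ?thesis using \<open>E \<notin> faces X\<close> by simp
  qed
qed

lemma connected_subcomplex_on_minimal:
  assumes C: "closed_in X C" "C \<noteq> {}"
    and min: "\<And>A. closed_in X A \<Longrightarrow> A \<noteq> {} \<Longrightarrow> A \<subseteq> C \<Longrightarrow> A = C"
  shows "connected_complex (subcomplex_on X C)"
  unfolding connected_complex_def
proof (intro conjI allI impI)
  fix A assume A: "closed_in (subcomplex_on X C) A \<and> A \<noteq> {}"
  then have AC: "A \<subseteq> C" by (simp add: closed_in_def)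
  have "closed_in X A"
    unfolding closed_in_def
  proof (intro conjI ballI impI)
    show "A \<subseteq> ground X" using AC C(1) by (auto simp: closed_in_def)
    fix E assume E: "E \<in> faces X" "E \<inter> A \<noteq> {}"
    then have "E \<subseteq> C" using AC C(1) unfolding closed_in_def by blast
    then show "E \<subseteq> A" using A E by (auto simp: closed_in_def)
  qed
  then show "A = ground (subcomplex_on X C)" using min A AC by simp
qed (simp add: C(2))

theorem comparability_iso_imp_complex_iso:
  assumes "comparability_iso X Y f" "finite (ground X)" "finite (ground Y)"
    "{} \<in> faces X" "{} \<in> faces Y"
  shows "\<exists>g. complex_iso g X Y"
  using assms
proof (induction "card (ground X)" arbitrary: X Y rule: less_induct)
  case less
  interpret comparability_iso X Y f by (rule less.prems(1))
  show ?case
  proof (cases "ground X = {}")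
    case True
    have "ground Y = {}"
    proof (rule ccontr)
      assume "ground Y \<noteq> {}"
      then obtain w where "{w} \<in> pfaces Y" using vertex_pface[OF Y] by blast
      then obtain E where "E \<in> pfaces X" by (rule preimage_pface)
      then show False using pface_ground[OF X] True by blast
    qed
    \<comment> \<open>On an empty ground set every function is a bijection.\<close>
    then have "complex_iso undefined X Y" using True less.prems(4,5) by (simp add: complex_iso_def bij_betw_def)
    then show ?thesis by blast
  next
    case False
    have "closed_in X (ground X)" using X by (auto simp: closed_in_def simplicial_complex_def)
    then obtain C where C: "closed_in X C" "C \<noteq> {}"
      and least: "\<And>A. closed_in X A \<Longrightarrow> A \<noteq> {} \<Longrightarrow> card C \<le> card A"
      \<comment> \<open>A nonempty closed set of least size is a component.\<close>
      using ex_has_least_nat[of "\<lambda>C. closed_in X C \<and> C \<noteq> {}" "ground X" card] False by blast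
    have CX: "C \<subseteq> ground X" using C by (simp add: closed_in_def)
    have finC: "finite C" using CX less.prems(2) by (rule finite_subset)
    have min: "A = C" if "closed_in X A" "A \<noteq> {}" "A \<subseteq> C" for A
      using least[OF that(1,2)] that(3) finC by (simp add: card_seteq)
    interpret inv: comparability_iso Y X "the_inv_into (pfaces X) f" by (rule inverse)
    let ?g = "the_inv_into (pfaces X) f"
    have g: "?g (f E) = E" if "E \<in> pfaces X" for E
      by (rule the_inv_into_f_f[OF bij_betw_imp_inj_on[OF bij] that])
    \<comment> \<open>The component of \<open>Y\<close> matching \<open>C\<close>, collected from
      the faces that the inverse map sends into \<open>C\<close>.\<close>
    define D where "D = \<Union>{G \<in> pfaces Y. ?g G \<subseteq> C}"
    have D: "closed_in Y D" unfolding D_def by (rule inv.closed_preimage(1)[OF C(1)])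
    have CD: "E \<subseteq> C \<longleftrightarrow> f E \<subseteq> D" if "E \<in> pfaces X" for E
      using inv.closed_preimage(2)[OF C(1) image_pface[OF that]] g[OF that] by (simp add: D_def)
    have DY: "D \<subseteq> ground Y" using D by (simp add: closed_in_def)
    let ?C' = "ground X - C" and ?D' = "ground Y - D"
    have CD': "E \<subseteq> ?C' \<longleftrightarrow> f E \<subseteq> ?D'" if E: "E \<in> pfaces X" for E
    proof -
      have "E \<subseteq> ?C' \<longleftrightarrow> \<not> E \<subseteq> C"
        using C(1) E pface_ground[OF X E] unfolding closed_in_def by blast
      moreover have "f E \<subseteq> ?D' \<longleftrightarrow> \<not> f E \<subseteq> D"
        using D image_pface[OF E] pface_ground[OF Y image_pface[OF E]] unfolding closed_in_def by blast
      ultimately show ?thesis using CD[OF E] by simp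
    qed
    have "connected_complex (subcomplex_on X C)"
      by (rule connected_subcomplex_on_minimal[OF C min])
    then obtain g where g: "complex_iso g (subcomplex_on X C) (subcomplex_on Y D)"
      using comparability_iso.connected_imp_complex_iso[OF comparability_iso_subcomplex_on[OF CX DY CD]]
        finC finite_subset[OF DY less.prems(3)] less.prems(4,5) by auto
    have "card ?C' < card (ground X)"
      using C(2) CX less.prems(2) by (intro psubset_card_mono) auto
    then obtain h where h: "complex_iso h (subcomplex_on X ?C') (subcomplex_on Y ?D')"
      using less.hyps[of "subcomplex_on X ?C'" "subcomplex_on Y ?D'"]
        comparability_iso_subcomplex_on[of ?C' ?D'] CD' less.prems by auto
    show ?thesis using complex_iso_glue[OF X C(1) Y D g h] by blast
  qed
qed

theorem graph_isomorphic_imp_complex_isomorphic: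
  assumes X: "simplicial_complex X" "finite (ground X)" "{} \<in> faces X"
    and Y: "simplicial_complex Y" "finite (ground Y)" "{} \<in> faces Y"
    and graph: "graph_isomorphic (comparability_graph X) (comparability_graph Y)"
  shows "complex_isomorphic X Y"
proof -
  obtain f where b: "bij_betw f (pfaces X) (pfaces Y)"
    and e: "\<And>E F. E \<in> pfaces X \<Longrightarrow> F \<in> pfaces X \<Longrightarrow>
      {E, F} \<in> edges (comparability_graph X) \<longleftrightarrow> {f E, f F} \<in> edges (comparability_graph Y)"
    using graph by (auto simp: graph_isomorphic_def comparability_graph_def)
  have edges: "{E, F} \<in> edges (comparability_graph Z) \<longleftrightarrow> E \<subset> F \<or> F \<subset> E"
    if "E \<in> pfaces Z" "F \<in> pfaces Z" for E F and Z :: "'c set_system"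
    using that by (auto simp: comparability_graph_def doubleton_eq_iff)
  have "comparability_iso X Y f"
  proof
    fix S T assume ST: "S \<in> pfaces X" "T \<in> pfaces X"
    then have fST: "f S \<in> pfaces Y" "f T \<in> pfaces Y" using bij_betwE[OF b] by blast+
    have "S \<subset> T \<or> T \<subset> S \<longleftrightarrow> f S \<subset> f T \<or> f T \<subset> f S"
      using e[OF ST] edges[OF ST] edges[OF fST] by simp
    then show "S \<subseteq> T \<or> T \<subseteq> S \<longleftrightarrow> f S \<subseteq> f T \<or> f T \<subseteq> f S"
      using inj_on_eq_iff[OF bij_betw_imp_inj_on[OF b] ST] by blast
  qed (rule X(1) Y(1) b)+
  then show ?thesis
    using comparability_iso_imp_complex_iso[OF _ X(2) Y(2) X(3) Y(3)]
      complex_isomorphic_simplicial_iff[OF X(1) Y(1)] by blast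
qed

section \<open>Subdivisions, Stanley-Reisner rings and facet rings\<close>

text \<open>The nontrivial direction forgets all of the subdivision except its 1-skeleton, the
  comparability graph, which already determines the complex.\<close>

lemma complex_isomorphic_barycentric_subdivision_iff:
  assumes X: "simplicial_complex X" "finite (ground X)" "{} \<in> faces X"
    and Y: "simplicial_complex Y" "finite (ground Y)" "{} \<in> faces Y"
  shows "complex_isomorphic (barycentric_subdivision X) (barycentric_subdivision Y) \<longleftrightarrow> complex_isomorphic X Y"
proof
  assume "complex_isomorphic (barycentric_subdivision X) (barycentric_subdivision Y)"
  then show "complex_isomorphic X Y"
    by (rule graph_isomorphic_imp_complex_isomorphic[OF X Y graph_isomorphic_barycentric_subdivision])
next
  assume "complex_isomorphic X Y"
  then obtain f where "complex_iso f X Y" using complex_isomorphic_simplicial_iff[OF X(1) Y(1)] by blast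
  from complex_iso_barycentric_subdivision[OF this X(1) Y(1)]
  show "complex_isomorphic (barycentric_subdivision X) (barycentric_subdivision Y)"
    using complex_isomorphic_simplicial_iff[OF simplicial_complex_barycentric_subdivision
        simplicial_complex_barycentric_subdivision] by blast
qed

lemma iterated_subdivision_simplicial_complex:
  assumes "simplicial_complex X" "finite (ground X)" "{} \<in> faces X"
  shows "simplicial_complex (iterated_subdivision m X) \<and> finite (ground (iterated_subdivision m X)) \<and>
    {} \<in> faces (iterated_subdivision m X)"
proof (induction m)
  case (Suc m)
  have "{} \<in> faces (barycentric_subdivision_nat Z)" for Z
    by (simp add: barycentric_subdivision_nat_def relabel_def barycentric_subdivision_def)
  then show ?case
    using Suc barycentric_subdivision_nat_simplicial_complex[of "iterated_subdivision m X"]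
    by (simp add: iterated_subdivision_def)
qed (simp add: iterated_subdivision_def assms)

lemma complex_isomorphic_iterated_subdivision_iff:
  assumes X: "simplicial_complex X" "finite (ground X)" "{} \<in> faces X"
    and Y: "simplicial_complex Y" "finite (ground Y)" "{} \<in> faces Y"
  shows "complex_isomorphic (iterated_subdivision m X) (iterated_subdivision m Y) \<longleftrightarrow> complex_isomorphic X Y"
proof (induction m)
  case (Suc m)
  let ?X = "iterated_subdivision m X" and ?Y = "iterated_subdivision m Y"
  note X' = iterated_subdivision_simplicial_complex[OF X, of m]
    and Y' = iterated_subdivision_simplicial_complex[OF Y, of m]
  have "complex_isomorphic (barycentric_subdivision_nat ?X) (barycentric_subdivision_nat ?Y) \<longleftrightarrow>
      complex_isomorphic ?X ?Y"
    using X' Y' by (simp add: complex_isomorphic_barycentric_subdivision_nat_iff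
        complex_isomorphic_barycentric_subdivision_iff)
  then show ?case using Suc by (simp add: iterated_subdivision_def)
qed (simp add: iterated_subdivision_def)

section \<open>Complexes recovered from their nonfaces and from their facets\<close>

lemma independence_complex_nonfaces:
  assumes X: "simplicial_complex X"
  shows "independence_complex (ground X) {F. F \<subseteq> ground X \<and> F \<notin> faces X} = X"
proof (rule set_system.expand, intro conjI)
  have "G \<in> faces X" if "v \<in> ground X" "G \<subseteq> {v}" for v G
    using X that unfolding simplicial_complex_def by blast
  then show "ground (independence_complex (ground X) {F. F \<subseteq> ground X \<and> F \<notin> faces X}) = ground X"
    by (auto simp: independence_complex_def)
  show "faces (independence_complex (ground X) {F. F \<subseteq> ground X \<and> F \<notin> faces X}) = faces X"
    using X unfolding simplicial_complex_def independence_complex_def set_system.sel by blast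
qed

text \<open>An antichain is recovered from its independence complex as the family of minimal
  nonfaces: a nonface contains some member of \<open>\<G>\<close>, and minimality lets this member
  omit no vertex.\<close>

lemma minimal_nonface_independence_complex:
  assumes antichain: "\<And>G H. G \<in> \<G> \<Longrightarrow> H \<in> \<G> \<Longrightarrow> G \<subseteq> H \<Longrightarrow> G = H" and F: "F \<subseteq> V"
  shows "F \<in> \<G> \<longleftrightarrow> F \<notin> faces (independence_complex V \<G>) \<and>
    (\<forall>v\<in>F. F - {v} \<in> faces (independence_complex V \<G>))"
proof
  assume FG: "F \<in> \<G>"
  have "\<not> G \<subseteq> F - {v}" if "v \<in> F" "G \<in> \<G>" for v G
    using antichain[OF that(2) FG] that(1) by blast
  then show "F \<notin> faces (independence_complex V \<G>) \<and> (\<forall>v\<in>F. F - {v} \<in> faces (independence_complex V \<G>))"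
    using FG F by (auto simp: independence_complex_def)
next
  assume R: "F \<notin> faces (independence_complex V \<G>) \<and> (\<forall>v\<in>F. F - {v} \<in> faces (independence_complex V \<G>))"
  then obtain G where G: "G \<in> \<G>" "G \<subseteq> F" using F by (auto simp: independence_complex_def)
  have "F \<subseteq> G"
  proof
    fix v assume v: "v \<in> F"
    then have "\<not> G \<subseteq> F - {v}" using R G(1) by (simp add: independence_complex_def)
    then show "v \<in> G" using G(2) by blast
  qed
  then show "F \<in> \<G>" using G by auto
qed

lemma facets_antichain: "G \<in> facets X \<Longrightarrow> H \<in> facets X \<Longrightarrow> G \<subseteq> H \<Longrightarrow> G = H"
  by (simp add: facets_def)

lemma ground_independence_complex_facets:
  assumes X: "simplicial_complex X"
  shows "ground (independence_complex (ground X) (facets X)) = ground X - {v. {v} \<in> facets X}"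
proof -
  have "G = {v}" if v: "v \<in> ground X" and G: "G \<in> facets X" "G \<subseteq> {v}" for v G
    using vertex_pface[OF X v] G by (auto simp: facets_def)
  then show ?thesis unfolding independence_complex_def set_system.sel by blast
qed

text \<open>
  The facets are the minimal nonfaces of the complex whose Stanley-Reisner ring is the facet ring.
  That complex sees only the vertices that are not facets, the others being matched by counting.
\<close>

lemma complex_iso_if_independence_complex_iso:
  assumes X: "simplicial_complex X" "finite (ground X)" and Y: "simplicial_complex Y" "finite (ground Y)"
    and count: "card (ground X) = card (ground Y) \<or> card {v. {v} \<in> facets X} = card {v. {v} \<in> facets Y}"
    and iso: "complex_iso g (independence_complex (ground X) (facets X)) (independence_complex (ground Y) (facets Y))"
  shows "\<exists>f. complex_iso f X Y"
proof -
  let ?X = "independence_complex (ground X) (facets X)" and ?Y = "independence_complex (ground Y) (facets Y)"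
  let ?I = "{v. {v} \<in> facets X}" and ?J = "{v. {v} \<in> facets Y}"
  have IJ: "?I \<subseteq> ground X" "?J \<subseteq> ground Y" using X Y by (auto simp: facets_def simplicial_complex_def)
  have fin: "finite ?I" "finite ?J" by (rule finite_subset[OF IJ(1) X(2)], rule finite_subset[OF IJ(2) Y(2)])
  have g: "bij_betw g (ground X - ?I) (ground Y - ?J)"
    using iso ground_independence_complex_facets[OF X(1)] ground_independence_complex_facets[OF Y(1)]
    by (simp add: complex_iso_def)
  have "card (ground X) = card (ground X - ?I) + card ?I" "card (ground Y) = card (ground Y - ?J) + card ?J"
    using card_Diff_subset[OF fin(1) IJ(1)] card_mono[OF X(2) IJ(1)]
      card_Diff_subset[OF fin(2) IJ(2)] card_mono[OF Y(2) IJ(2)] by simp_all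
  \<comment> \<open>\<open>g\<close> already matches the remaining vertices, so either alternative
    of \<open>count\<close> yields equally many isolated ones.\<close>
  then have "card ?I = card ?J" using count bij_betw_same_card[OF g] by linarith
  then obtain h where h: "bij_betw h ?I ?J" using finite_same_card_bij[OF fin] by blast
  define f where "f v = (if v \<in> ?I then h v else g v)" for v
  have fI: "f v \<in> ?J" if "v \<in> ?I" for v using bij_betwE[OF h] that by (simp add: f_def)
  have "bij_betw f ?I ?J" using h bij_betw_cong[of ?I f h] by (simp add: f_def)
  moreover have "bij_betw f (ground X - ?I) (ground Y - ?J)"
    using g bij_betw_cong[of "ground X - ?I" f g] by (simp add: f_def)
  ultimately have "bij_betw f (?I \<union> (ground X - ?I)) (?J \<union> (ground Y - ?J))"
    by (rule bij_betw_combine) blast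
  then have b: "bij_betw f (ground X) (ground Y)"
    by (simp only: Un_Diff_cancel Un_absorb1[OF IJ(1)] Un_absorb1[OF IJ(2)])
  have isolated: "E \<notin> faces (independence_complex (ground Z) (facets Z))" if "v \<in> E" "{v} \<in> facets Z"
    for E v and Z :: "'c set_system"
    using that by (auto simp: independence_complex_def)
  \<comment> \<open>A set with an isolated vertex contains a facet and is a nonface on both sides;
    on all other sets \<open>f\<close> agrees with \<open>g\<close>.\<close>
  have face: "E \<in> faces ?X \<longleftrightarrow> f ` E \<in> faces ?Y" if E: "E \<subseteq> ground X" for E
  proof (cases "E \<inter> ?I = {}")
    case True
    then have "f ` E = g ` E" by (intro image_cong) (auto simp: f_def)
    moreover have "E \<subseteq> ground ?X" using True E by (auto simp: ground_independence_complex_facets[OF X(1)])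
    ultimately show ?thesis using iso by (simp add: complex_iso_def)
  next
    case False
    then obtain v where v: "v \<in> E" "v \<in> ?I" by blast
    then have "f v \<in> f ` E" "{f v} \<in> facets Y" using fI[of v] by simp_all
    then show ?thesis using isolated[of "f v" "f ` E" Y] isolated[of v E X] v by simp
  qed
  have "complex_iso f X Y"
  proof (rule complex_isoI_facets[OF X(2,1) Y(2,1) b])
    fix F assume F: "F \<subseteq> ground X"
    have "F - {v} \<in> faces ?X \<longleftrightarrow> f ` F - {f v} \<in> faces ?Y" if "v \<in> F" for v
    proof -
      have "f ` (F - {v}) = f ` F - {f v}"
        using inj_on_image_set_diff[OF bij_betw_imp_inj_on[OF b], of F "{v}"] F that by auto
      then show ?thesis using face[of "F - {v}"] F by auto
    qed
    moreover have "f ` F \<subseteq> ground Y" using bij_betw_imp_surj_on[OF b] F by (metis image_mono)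
    ultimately show "F \<in> facets X \<longleftrightarrow> f ` F \<in> facets Y"
      using minimal_nonface_independence_complex[where \<G> = "facets X", OF facets_antichain F]
        minimal_nonface_independence_complex[where \<G> = "facets Y" and F = "f ` F" and V = "ground Y", OF facets_antichain]
        face[OF F]
      by simp
  qed
  then show ?thesis by blast
qed

lemma stanley_reisner_ring_squarefree:
  "stanley_reisner_ring X =
    quotient_algebra (ground X) (squarefree_ideal (ground X) {F. F \<subseteq> ground X \<and> F \<notin> faces X})"
  by (simp add: stanley_reisner_ring_def stanley_reisner_ideal_def squarefree_ideal_def conj_assoc)

lemma facet_ring_squarefree:
  "facet_ring X = quotient_algebra (ground X) (squarefree_ideal (ground X) (facets X))"
  by (simp add: facet_ring_def facet_ideal_def squarefree_ideal_def)

theorem stanley_reisner_ring_isomorphic_iff: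
  fixes X :: "'v::linorder set_system" and Y :: "'w::linorder set_system"
  assumes X: "simplicial_complex X" "finite (ground X)" and Y: "simplicial_complex Y" "finite (ground Y)"
  shows "algebra_isomorphic (stanley_reisner_ring X :: ('k::field, ('v, 'k) mpoly set) module)
      (stanley_reisner_ring Y :: ('k, ('w, 'k) mpoly set) module) \<longleftrightarrow> (\<exists>f. complex_iso f X Y)"
proof
  assume "\<exists>f. complex_iso f X Y"
  then obtain f where f: "complex_iso f X Y" by blast
  then have b: "bij_betw f (ground X) (ground Y)" by (simp add: complex_iso_def)
  show "algebra_isomorphic (stanley_reisner_ring X :: ('k, ('v, 'k) mpoly set) module)
      (stanley_reisner_ring Y :: ('k, ('w, 'k) mpoly set) module)"
    unfolding stanley_reisner_ring_squarefree
  proof (rule algebra_isomorphic_squarefree[OF b])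
    fix G assume "G \<subseteq> ground X"
    moreover from this have "f ` G \<subseteq> ground Y" using bij_betw_imp_surj_on[OF b] by (metis image_mono)
    ultimately show "G \<in> {F. F \<subseteq> ground X \<and> F \<notin> faces X} \<longleftrightarrow> f ` G \<in> {F. F \<subseteq> ground Y \<and> F \<notin> faces Y}"
      using f by (simp add: complex_iso_def)
  qed auto
next
  let ?NX = "{F. F \<subseteq> ground X \<and> F \<notin> faces X}" and ?NY = "{F. F \<subseteq> ground Y \<and> F \<notin> faces Y}"
  have N: "\<Union>?NX \<subseteq> ground X" "\<Union>?NY \<subseteq> ground Y" by auto
  assume "algebra_isomorphic (stanley_reisner_ring X :: ('k, ('v, 'k) mpoly set) module)
      (stanley_reisner_ring Y :: ('k, ('w, 'k) mpoly set) module)"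
  then obtain \<Phi> :: "('v, 'k) mpoly \<Rightarrow> ('w, 'k) mpoly" and \<Psi>
    where "mod_iso (ground X) (squarefree_ideal (ground X) ?NX) (ground Y) (squarefree_ideal (ground Y) ?NY) \<Phi> \<Psi>"
    unfolding stanley_reisner_ring_squarefree
    by (rule algebra_isomorphic_imp_mod_iso[OF ideal_squarefree_ideal[OF N(1)] ideal_squarefree_ideal[OF N(2)]])
  from mod_iso_imp_complex_iso[OF X(2) Y(2) N this]
  show "\<exists>f. complex_iso f X Y"
    by (simp only: independence_complex_nonfaces[OF X(1)] independence_complex_nonfaces[OF Y(1)])
qed

theorem facet_ring_isomorphic:
  fixes X :: "'v set_system" and Y :: "'w set_system"
  assumes X: "simplicial_complex X" and Y: "simplicial_complex Y" and f: "complex_iso f X Y"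
  shows "algebra_isomorphic (facet_ring X :: ('k::field, ('v, 'k) mpoly set) module)
      (facet_ring Y :: ('k, ('w, 'k) mpoly set) module)"
  unfolding facet_ring_squarefree
proof (rule algebra_isomorphic_squarefree)
  show "bij_betw f (ground X) (ground Y)" using f by (simp add: complex_iso_def)
  show "G \<in> facets X \<longleftrightarrow> f ` G \<in> facets Y" if "G \<subseteq> ground X" for G
    by (rule complex_iso_facet_iff[OF f faces_subset_ground[OF X] faces_subset_ground[OF Y] that])
qed (use X Y in \<open>auto simp: facets_def simplicial_complex_def\<close>)

theorem facet_ring_isomorphic_imp_complex_iso:
  fixes X :: "'v::linorder set_system" and Y :: "'w::linorder set_system"
  assumes X: "simplicial_complex X" "finite (ground X)" and Y: "simplicial_complex Y" "finite (ground Y)"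
    and count: "card (ground X) = card (ground Y) \<or> card {v. {v} \<in> facets X} = card {v. {v} \<in> facets Y}"
    and iso: "algebra_isomorphic (facet_ring X :: ('k::field, ('v, 'k) mpoly set) module)
      (facet_ring Y :: ('k, ('w, 'k) mpoly set) module)"
  shows "\<exists>f. complex_iso f X Y"
proof -
  have N: "\<Union>(facets X) \<subseteq> ground X" "\<Union>(facets Y) \<subseteq> ground Y"
    using Union_facets[OF X(2,1)] Union_facets[OF Y(2,1)] by simp_all
  obtain \<Phi> :: "('v, 'k) mpoly \<Rightarrow> ('w, 'k) mpoly" and \<Psi>
    where "mod_iso (ground X) (squarefree_ideal (ground X) (facets X)) (ground Y) (squarefree_ideal (ground Y) (facets Y)) \<Phi> \<Psi>"
    by (rule algebra_isomorphic_imp_mod_iso[OF ideal_squarefree_ideal[OF N(1)] ideal_squarefree_ideal[OF N(2)]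
        iso[unfolded facet_ring_squarefree]])
  from mod_iso_imp_complex_iso[OF X(2) Y(2) N this]
  show ?thesis using complex_iso_if_independence_complex_iso[OF X Y count] by blast
qed

lemma simplicial_complex_onD:
  assumes "simplicial_complex_on n X"
  shows "simplicial_complex X" "finite (ground X)" "{} \<in> faces X" "card (ground X) = n"
proof -
  show X: "simplicial_complex X" and "finite (ground X)" "card (ground X) = n"
    using assms by (simp_all add: simplicial_complex_on_def)
  have "{1} \<in> faces X" using assms by (simp add: simplicial_complex_on_def simplicial_complex_def)
  then show "{} \<in> faces X" using X unfolding simplicial_complex_def by blast
qed

theorem theorem2p3:
  fixes n1 n2 :: nat and X1 X2 :: "nat set_system"
  assumes X1: "simplicial_complex_on n1 X1" and X2: "simplicial_complex_on n2 X2"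
  shows
    "(complex_isomorphic X1 X2 \<longleftrightarrow>
        complex_isomorphic (alexander_dual X1) (alexander_dual X2)) \<and>
     (complex_isomorphic X1 X2 \<longleftrightarrow>
        complex_isomorphic (complement_complex X1) (complement_complex X2)) \<and>
     (complex_isomorphic X1 X2 \<longleftrightarrow>
        complex_isomorphic (barycentric_subdivision X1) (barycentric_subdivision X2)) \<and>
     (complex_isomorphic X1 X2 \<longleftrightarrow>
        (\<exists>m\<ge>1. complex_isomorphic (iterated_subdivision m X1) (iterated_subdivision m X2))) \<and>
     (complex_isomorphic X1 X2 \<longleftrightarrow>
        algebra_isomorphic
          (stanley_reisner_ring X1 :: ('k::field, (nat, 'k) mpoly set) module)
          (stanley_reisner_ring X2 :: ('k, (nat, 'k) mpoly set) module)) \<and>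
     (complex_isomorphic X1 X2 \<longleftrightarrow>
        graph_isomorphic (comparability_graph X1) (comparability_graph X2)) \<and>
     (complex_isomorphic X1 X2 \<longrightarrow>
        algebra_isomorphic
          (facet_ring X1 :: ('k, (nat, 'k) mpoly set) module)
          (facet_ring X2 :: ('k, (nat, 'k) mpoly set) module)) \<and>
     (n1 = n2 \<or>
      card {v. {v} \<in> facets X1} = card {v. {v} \<in> facets X2} \<longrightarrow>
        (complex_isomorphic X1 X2 \<longleftrightarrow>
          algebra_isomorphic
            (facet_ring X1 :: ('k, (nat, 'k) mpoly set) module)
            (facet_ring X2 :: ('k, (nat, 'k) mpoly set) module)))"
proof -
  note X = simplicial_complex_onD[OF X1] and Y = simplicial_complex_onD[OF X2]
  note iso_iff = complex_isomorphic_simplicial_iff[OF X(1) Y(1)]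
  have dual: "complex_isomorphic X1 X2 \<longleftrightarrow> complex_isomorphic (alexander_dual X1) (alexander_dual X2)"
    unfolding iso_iff complex_isomorphic_iff[OF alexander_dual_faces_subset alexander_dual_faces_subset]
      complex_iso_alexander_dual_iff by (rule refl)
  have complement: "complex_isomorphic X1 X2 \<longleftrightarrow> complex_isomorphic (complement_complex X1) (complement_complex X2)"
    unfolding iso_iff complex_isomorphic_iff[OF complement_complex_faces_subset complement_complex_faces_subset]
      complex_iso_complement_complex_iff[OF X(2,1) Y(2,1)] by (rule refl)
  have subdivision: "complex_isomorphic (barycentric_subdivision X1) (barycentric_subdivision X2) \<longleftrightarrow>
      complex_isomorphic X1 X2"
    by (rule complex_isomorphic_barycentric_subdivision_iff[OF X(1-3) Y(1-3)])
  \<comment> \<open>The equivalence holds for every single \<open>m\<close>, so one value is as good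
    as all; \<open>m = 1\<close> provides the witness.\<close>
  have iterated: "(\<exists>m\<ge>1. complex_isomorphic (iterated_subdivision m X1) (iterated_subdivision m X2)) \<longleftrightarrow>
      complex_isomorphic X1 X2"
    using complex_isomorphic_iterated_subdivision_iff[OF X(1-3) Y(1-3)] by blast
  have graph: "complex_isomorphic X1 X2 \<longleftrightarrow>
      graph_isomorphic (comparability_graph X1) (comparability_graph X2)"
    using graph_isomorphic_imp_complex_isomorphic[OF X(1-3) Y(1-3)]
      graph_isomorphic_barycentric_subdivision subdivision by blast
  have stanley_reisner: "algebra_isomorphic
      (stanley_reisner_ring X1 :: ('k::field, (nat, 'k) mpoly set) module)
      (stanley_reisner_ring X2 :: ('k, (nat, 'k) mpoly set) module) \<longleftrightarrow> complex_isomorphic X1 X2"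
    unfolding iso_iff by (rule stanley_reisner_ring_isomorphic_iff[OF X(1,2) Y(1,2)])
  have facet: "complex_isomorphic X1 X2 \<Longrightarrow> algebra_isomorphic
      (facet_ring X1 :: ('k, (nat, 'k) mpoly set) module) (facet_ring X2 :: ('k, (nat, 'k) mpoly set) module)"
    unfolding iso_iff using facet_ring_isomorphic[OF X(1) Y(1)] by blast
  have facet_converse: "complex_isomorphic X1 X2"
    if "n1 = n2 \<or> card {v. {v} \<in> facets X1} = card {v. {v} \<in> facets X2}"
      "algebra_isomorphic
        (facet_ring X1 :: ('k, (nat, 'k) mpoly set) module) (facet_ring X2 :: ('k, (nat, 'k) mpoly set) module)"
    unfolding iso_iff
    by (rule facet_ring_isomorphic_imp_complex_iso[OF X(1,2) Y(1,2) _ that(2)]) (use that(1) X(4) Y(4) in simp)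
  show ?thesis
    using dual complement subdivision iterated stanley_reisner graph facet facet_converse by blast
qed

end
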